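(* Let $n,r,s$ be integers with $0\le r<n$ and $1\le s\le n-r-1$, let $\mathbf{d}=(d_1,\dots,d_s)$ be a sequence of positive integers, and let $t:=\max_i d_i$. Assume $t\ge 3$ and that $t$ occurs exactly once in $\mathbf{d}$. Put $$\rho := (r+2)(n-r)-1-\sum_{i=1}^s\binom{d_i+r+1}{r+1}+\sum_{d_i\ge t}\binom{d_i-t+r+1}{r+1}.$$ If $\rho\ge 0$, then for any complete intersection $Y$ of type $\mathbf{d}$ in $\mathbb{P}^n$, the Hilbert scheme of $t$-fat $r$-planes in $Y$ is nonempty.
   Context: The base field is algebraically closed of characteristic zero. A complete intersection of type $\mathbf{d}$ in $\mathbb{P}^n$ is an $s$-codimensional subscheme defined by $s$ homogeneous equations of degrees $d_1,\dots,d_s$. A $t$-fat $r$-plane in $\mathbb{P}^n$ is the $t$-th infinitesimal neighborhood of an $r$-plane in an $(r+1)$-plane, i.e. the subscheme of an $(r+1)$-plane $L'$ defined by $x_0^t=0$, where $x_0=0$ is the equation in $L'$ of an $r$-plane. The Hilbert scheme of $t$-fat $r$-planes in $Y$ parametrizes the $t$-fat $r$-planes contained in $Y$ as subschemes. *)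

theory Defs
  imports
    "HOL-Analysis.Abstract_Topology"
    "HOL-Algebra.Ideal"
    "HOL-Library.Poly_Mapping"
    "HOL-Library.Extended_Nat"
    "HOL-Computational_Algebra.Polynomial"
begin

section \<open>The homogeneous coordinate ring of projective space\<close>

text \<open>
  Polynomials are finitely supported maps from monomials to coefficients, and monomials are finitely
  supported maps from variable indices to exponents.  The coordinate ring \<open>k[x\<^sub>0,\<dots>,x\<^sub>n]\<close> of
  \<open>\<P>\<^sup>n\<close> consists of the polynomials in which only the variables \<open>0,\<dots>,n\<close> occur.
\<close>

type_synonym 'k mpoly = "(nat \<Rightarrow>\<^sub>0 nat) \<Rightarrow>\<^sub>0 'k"

definition mdeg :: "(nat \<Rightarrow>\<^sub>0 nat) \<Rightarrow> nat" where
  "mdeg m = (\<Sum>i\<in>Poly_Mapping.keys m. Poly_Mapping.lookup m i)"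

definition polys :: "nat \<Rightarrow> 'k::field mpoly set" where
  "polys n = {p. \<forall>m\<in>Poly_Mapping.keys p. Poly_Mapping.keys m \<subseteq> {..n}}"

definition poly_ring :: "nat \<Rightarrow> 'k::field mpoly ring" where
  "poly_ring n = \<lparr>carrier = polys n, monoid.mult = (*), one = 1, zero = 0, add = (+)\<rparr>"

definition var :: "nat \<Rightarrow> 'k::field mpoly" where
  "var i = Poly_Mapping.single (Poly_Mapping.single i 1) 1"

definition const_poly :: "'k::field \<Rightarrow> 'k mpoly" where
  "const_poly c = Poly_Mapping.single 0 c"

text \<open>Forms of degree \<open>d\<close>; the zero polynomial is a form of every degree.\<close>

definition forms :: "nat \<Rightarrow> nat \<Rightarrow> 'k::field mpoly set" where
  "forms n d = {p \<in> polys n. \<forall>m\<in>Poly_Mapping.keys p. mdeg m = d}"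

definition homogeneous_ideal :: "nat \<Rightarrow> 'k::field mpoly set \<Rightarrow> bool" where
  "homogeneous_ideal n I \<longleftrightarrow>
     ideal I (poly_ring n) \<and> I = Idl\<^bsub>poly_ring n\<^esub> (I \<inter> (\<Union>d. forms n d))"

section \<open>The topological space Proj\<close>

definition Proj_points :: "nat \<Rightarrow> 'k::field mpoly set set" where
  "Proj_points n = {P. primeideal P (poly_ring n) \<and> homogeneous_ideal n P \<and> (\<exists>i\<le>n. var i \<notin> P)}"

definition zero_locus :: "nat \<Rightarrow> 'k::field mpoly set \<Rightarrow> 'k mpoly set set" where
  "zero_locus n S = {P \<in> Proj_points n. S \<subseteq> P}"

definition Proj_space :: "nat \<Rightarrow> 'k::field mpoly set topology" where
  "Proj_space n = topology (\<lambda>U. \<exists>S \<subseteq> (\<Union>d. forms n d). U = Proj_points n - zero_locus n S)"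

section \<open>Codimension\<close>

definition irreducible_closed :: "'a topology \<Rightarrow> 'a set \<Rightarrow> bool" where
  "irreducible_closed X Z \<longleftrightarrow> closedin X Z \<and> Z \<noteq> {} \<and>
     (\<forall>A B. closedin X A \<and> closedin X B \<and> Z = A \<union> B \<longrightarrow> Z = A \<or> Z = B)"

text \<open>
  The codimension of an irreducible closed subset is the supremum of the lengths of chains of
  irreducible closed subsets starting with it; that of a closed subset is the infimum of the
  codimensions of the irreducible closed subsets it contains.
\<close>

definition codim_irreducible :: "'a topology \<Rightarrow> 'a set \<Rightarrow> enat" where
  "codim_irreducible X Z =
     (SUP l \<in> {l. \<exists>C. C 0 = Z \<and> (\<forall>i\<le>l. irreducible_closed X (C i)) \<and> (\<forall>i<l. C i \<subset> C (Suc i))}.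
        enat l)"

definition codim :: "'a topology \<Rightarrow> 'a set \<Rightarrow> enat" where
  "codim X Y = (INF Z \<in> {Z. irreducible_closed X Z \<and> Z \<subseteq> Y}. codim_irreducible X Z)"

section \<open>Closed subschemes\<close>

text \<open>
  A closed subscheme of \<open>\<P>\<^sup>n\<close> is represented by its saturated homogeneous ideal, which determines
  it and is determined by it.  Inclusion of subschemes is reverse inclusion of these ideals.
\<close>

definition saturation :: "nat \<Rightarrow> 'k::field mpoly set \<Rightarrow> 'k mpoly set" where
  "saturation n I = {p \<in> polys n. \<exists>N. \<forall>q\<in>forms n N. q * p \<in> I}"

text \<open>The closed subscheme defined by the vanishing of a set of forms.\<close>

definition subscheme :: "nat \<Rightarrow> 'k::field mpoly set \<Rightarrow> 'k mpoly set" where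
  "subscheme n S = saturation n (Idl\<^bsub>poly_ring n\<^esub> S)"

definition contained_in :: "'k::field mpoly set \<Rightarrow> 'k mpoly set \<Rightarrow> bool" where
  "contained_in Z Y \<longleftrightarrow> Y \<subseteq> Z"

definition complete_intersection ::
    "nat \<Rightarrow> nat \<Rightarrow> (nat \<Rightarrow> nat) \<Rightarrow> 'k::field mpoly set \<Rightarrow> bool" where
  "complete_intersection n s d Y \<longleftrightarrow>
     (\<exists>f. (\<forall>i\<in>{1..s}. f i \<in> forms n (d i)) \<and> Y = subscheme n (f ` {1..s})) \<and>
     codim (Proj_space n) (zero_locus n Y) = enat s"

definition linearly_independent :: "nat \<Rightarrow> (nat \<Rightarrow> 'k::field mpoly) \<Rightarrow> bool" where
  "linearly_independent h l \<longleftrightarrow>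
     (\<forall>c. (\<Sum>i<h. const_poly (c i) * l i) = 0 \<longrightarrow> (\<forall>i<h. c i = 0))"

definition is_plane :: "nat \<Rightarrow> nat \<Rightarrow> 'k::field mpoly set \<Rightarrow> bool" where
  "is_plane n m L \<longleftrightarrow> m \<le> n \<and>
     (\<exists>l. (\<forall>i<n - m. l i \<in> forms n 1) \<and> linearly_independent (n - m) l \<and>
          L = subscheme n (l ` {..<n - m}))"

text \<open>
  In the next definition \<open>L\<close> is an \<open>(r+1)\<close>-plane, \<open>subscheme n (L \<union> {x})\<close> is its closed subscheme
  with equation \<open>x = 0\<close>, required to be an \<open>r\<close>-plane, and \<open>Z\<close> is its closed subscheme with equation
  \<open>x\<^sup>t = 0\<close>.
\<close>

definition is_fat_plane :: "nat \<Rightarrow> nat \<Rightarrow> nat \<Rightarrow> 'k::field mpoly set \<Rightarrow> bool" where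
  "is_fat_plane n r t Z \<longleftrightarrow>
     (\<exists>L x. is_plane n (r + 1) L \<and> x \<in> forms n 1 \<and> is_plane n r (subscheme n (L \<union> {x})) \<and>
            Z = subscheme n (L \<union> {x ^ t}))"

text \<open>
  The set of closed points of the Hilbert scheme of \<open>t\<close>-fat \<open>r\<close>-planes in \<open>Y\<close>.  Being of finite type
  over an algebraically closed field, this scheme is nonempty if and only if it has a closed point.
\<close>

definition Hilbert_fat_planes ::
    "nat \<Rightarrow> nat \<Rightarrow> nat \<Rightarrow> 'k::field mpoly set \<Rightarrow> 'k mpoly set set" where
  "Hilbert_fat_planes n r t Y = {Z. is_fat_plane n r t Z \<and> contained_in Z Y}"

section \<open>Well-definedness\<close>

lemma poly_ring_simps [simp]:
  "carrier (poly_ring n) = polys n" "monoid.mult (poly_ring n) = (*)" "one (poly_ring n) = 1"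
  "zero (poly_ring n) = 0" "add (poly_ring n) = (+)"
  by (simp_all add: poly_ring_def)

lemma polys_add: "p \<in> polys n \<Longrightarrow> q \<in> polys n \<Longrightarrow> p + q \<in> polys n"
  unfolding polys_def using Poly_Mapping.keys_add[of p q] by blast

lemma polys_uminus: "p \<in> polys n \<Longrightarrow> - p \<in> polys n"
  unfolding polys_def by (simp add: Poly_Mapping.keys_minus)

lemma polys_mult:
  assumes "p \<in> polys n" "q \<in> polys n" shows "p * q \<in> polys n"
  unfolding polys_def
proof (intro CollectI ballI)
  fix m assume "m \<in> Poly_Mapping.keys (p * q)"
  then obtain a b where ab: "a \<in> Poly_Mapping.keys p" "b \<in> Poly_Mapping.keys q" "m = a + b"
    using Poly_Mapping.keys_mult[of p q] by blast
  then show "Poly_Mapping.keys m \<subseteq> {..n}"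
    using assms Poly_Mapping.keys_add[of a b] unfolding polys_def by blast
qed

lemma cring_poly_ring: "cring (poly_ring n :: 'k::field mpoly ring)"
proof (rule cringI)
  have "\<exists>y\<in>polys n. y + x = 0" if "x \<in> polys n" for x :: "'k mpoly"
    using polys_uminus[OF that] by (intro bexI[of _ "- x"]) auto
  then show "abelian_group (poly_ring n :: 'k mpoly ring)"
    by (intro abelian_groupI) (auto simp: polys_add add_ac, simp add: polys_def)
  show "Group.comm_monoid (poly_ring n :: 'k mpoly ring)"
    by (rule comm_monoidI) (auto simp: polys_mult mult_ac, simp add: polys_def)
qed (simp add: distrib_right)

lemma mdeg_superset:
  assumes "finite A" "Poly_Mapping.keys m \<subseteq> A"
  shows "mdeg m = (\<Sum>i\<in>A. Poly_Mapping.lookup m i)"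
  unfolding mdeg_def using assms
  by (intro sum.mono_neutral_left) (auto simp: in_keys_iff)

lemma mdeg_add: "mdeg (a + b) = mdeg a + mdeg b"
proof -
  let ?A = "Poly_Mapping.keys a \<union> Poly_Mapping.keys b"
  have "mdeg (a + b) = (\<Sum>i\<in>?A. Poly_Mapping.lookup (a + b) i)"
    by (rule mdeg_superset) (use Poly_Mapping.keys_add[of a b] in auto)
  also have "\<dots> = mdeg a + mdeg b"
    by (simp add: lookup_add sum.distrib mdeg_superset[of ?A])
  finally show ?thesis .
qed

lemma forms_mult:
  assumes "p \<in> forms n d" "q \<in> forms n e" shows "p * q \<in> forms n (d + e)"
proof -
  have "mdeg m = d + e" if "m \<in> Poly_Mapping.keys (p * q)" for m
  proof -
    from that obtain a b where "a \<in> Poly_Mapping.keys p" "b \<in> Poly_Mapping.keys q" "m = a + b"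
      using Poly_Mapping.keys_mult[of p q] by blast
    then show ?thesis using assms by (auto simp: forms_def mdeg_add)
  qed
  then show ?thesis using assms polys_mult by (auto simp: forms_def)
qed

lemma zero_locus_Union: "zero_locus n (\<Union>K) = Proj_points n \<inter> (\<Inter>S\<in>K. zero_locus n S)"
  by (auto simp: zero_locus_def)

lemma zero_locus_products:
  assumes S: "S \<subseteq> (\<Union>d. forms n d)" and T: "T \<subseteq> (\<Union>d. forms n d)"
  shows "zero_locus n {p * q |p q. p \<in> S \<and> q \<in> T} = zero_locus n S \<union> zero_locus n T"
proof (intro equalityI subsetI)
  fix P assume P: "P \<in> zero_locus n {p * q |p q. p \<in> S \<and> q \<in> T}"
  then have prime: "primeideal P (poly_ring n)" by (auto simp: zero_locus_def Proj_points_def)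
  have "S \<subseteq> P" if "\<not> T \<subseteq> P"
  proof
    fix p assume p: "p \<in> S"
    from that obtain q where q: "q \<in> T" "q \<notin> P" by blast
    have "p \<in> polys n" "q \<in> polys n" using p q S T by (auto simp: forms_def)
    moreover have "p * q \<in> P" using P p q by (auto simp: zero_locus_def)
    ultimately show "p \<in> P" using primeideal.I_prime[OF prime, of p q] q by auto
  qed
  then show "P \<in> zero_locus n S \<union> zero_locus n T" using P by (auto simp: zero_locus_def)
next
  fix P assume P: "P \<in> zero_locus n S \<union> zero_locus n T"
  then have "ideal P (poly_ring n)"
    by (auto simp: zero_locus_def Proj_points_def primeideal_def)
  note closed = ideal.I_l_closed[OF this] ideal.I_r_closed[OF this]
  have "p * q \<in> P" if "p \<in> S" "q \<in> T" for p q
  proof -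
    have "p \<in> polys n" "q \<in> polys n" using that S T by (auto simp: forms_def)
    then show ?thesis using closed that P by (auto simp: zero_locus_def)
  qed
  then show "P \<in> zero_locus n {p * q |p q. p \<in> S \<and> q \<in> T}"
    using P by (auto simp: zero_locus_def)
qed

lemma istopology_Proj:
  "istopology (\<lambda>U. \<exists>S \<subseteq> (\<Union>d. forms n d). U = Proj_points n - zero_locus n S)"
  unfolding istopology_def
proof (intro conjI allI impI, goal_cases)
  case (1 U V)
  from 1(1) obtain S where S: "S \<subseteq> (\<Union>d. forms n d)" "U = Proj_points n - zero_locus n S"
    by (elim exE conjE)
  from 1(2) obtain T where T: "T \<subseteq> (\<Union>d. forms n d)" "V = Proj_points n - zero_locus n T"
    by (elim exE conjE)
  have "p * q \<in> (\<Union>d. forms n d)" if pq: "p \<in> S" "q \<in> T" for p q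
  proof -
    from pq S(1) T(1) obtain d e where "p \<in> forms n d" "q \<in> forms n e" by fast
    then have "p * q \<in> forms n (d + e)" by (rule forms_mult)
    then show ?thesis by (rule UN_I[OF UNIV_I])
  qed
  then have "{p * q |p q. p \<in> S \<and> q \<in> T} \<subseteq> (\<Union>d. forms n d)" by fast
  moreover have "U \<inter> V = Proj_points n - zero_locus n {p * q |p q. p \<in> S \<and> q \<in> T}"
    unfolding zero_locus_products[OF S(1) T(1)] S(2) T(2) by (rule Diff_Un[symmetric])
  ultimately show ?case by (intro exI conjI)
next
  case (2 K)
  from bchoice[OF this] obtain S where S: "\<And>U. U \<in> K \<Longrightarrow> S U \<subseteq> (\<Union>d. forms n d)"
    "\<And>U. U \<in> K \<Longrightarrow> U = Proj_points n - zero_locus n (S U)" by auto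
  have "\<Union>K = Proj_points n - zero_locus n (\<Union>(S ` K))"
    unfolding zero_locus_Union using S(2) by auto
  moreover have "\<Union>(S ` K) \<subseteq> (\<Union>d. forms n d)" using S(1) by (rule UN_least)
  ultimately show ?case by (intro exI conjI)
qed

lemma openin_Proj_space:
  "openin (Proj_space n) U \<longleftrightarrow> (\<exists>S \<subseteq> (\<Union>d. forms n d). U = Proj_points n - zero_locus n S)"
  unfolding Proj_space_def topology_inverse'[OF istopology_Proj] ..

lemma topspace_Proj_space: "topspace (Proj_space n) = (Proj_points n :: 'k::field mpoly set set)"
proof
  show "topspace (Proj_space n) \<subseteq> (Proj_points n :: 'k mpoly set set)"
    by (auto simp: topspace_def openin_Proj_space)
  have "1 \<in> (forms n 0 :: 'k mpoly set)" by (simp add: forms_def polys_def mdeg_def)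
  moreover have "zero_locus n {1 :: 'k mpoly} = {}"
  proof -
    have "1 \<notin> P" if P: "primeideal P (poly_ring n)" for P :: "'k mpoly set"
      using primeideal.I_notcarr[OF P] ideal.one_imp_carrier[of P "poly_ring n"]
        primeideal.axioms(1)[OF P] by auto
    then show ?thesis by (auto simp: zero_locus_def Proj_points_def)
  qed
  ultimately have "openin (Proj_space n) (Proj_points n :: 'k mpoly set set)"
    unfolding openin_Proj_space by (intro exI[of _ "{1}"]) auto
  then show "(Proj_points n :: 'k mpoly set set) \<subseteq> topspace (Proj_space n)"
    by (rule openin_subset)
qed

lemma closedin_Proj_space:
  "closedin (Proj_space n) C \<longleftrightarrow> (\<exists>S \<subseteq> (\<Union>d. forms n d). C = zero_locus n S)"
proof -
  have sub: "zero_locus n S \<subseteq> Proj_points n" for S :: "'a mpoly set"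
    by (auto simp: zero_locus_def)
  have "C \<subseteq> Proj_points n \<and> Proj_points n - C = Proj_points n - zero_locus n S
          \<longleftrightarrow> C = zero_locus n S" for S :: "'a mpoly set"
    using sub[of S] by blast
  then show ?thesis
    unfolding closedin_def topspace_Proj_space openin_Proj_space by blast
qed

end

theory Submission
  imports Defs
    "HOL-Library.FuncSet"
    "HOL-Library.Multiset"
    "HOL-Number_Theory.Cong"
    "HOL-Computational_Algebra.Formal_Laurent_Series"
    "HOL-Computational_Algebra.Polynomial_FPS"
begin

text \<open>
  Let \<open>f i\<close> be the forms that define \<open>Y\<close>.  A \<open>t\<close>-fat \<open>r\<close>-plane is given by a flag of an \<open>r\<close>-plane \<open>x = 0\<close> in an
  \<open>(r + 1)\<close>-plane \<open>L\<close>, and it is contained in \<open>Y\<close> if every \<open>f i\<close> restricts on \<open>L\<close> to a multiple of \<open>x ^ t\<close>.  For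
  \<open>d i < t\<close> this means that the restriction vanishes.  The number \<open>\<rho>\<close> is the dimension of the space of flags minus the
  number of these conditions.  In terms of \<open>w = r + 1\<close> and \<open>m = n - w\<close>, the hypothesis \<open>0 \<le> \<rho>\<close> reads
  \<open>(\<Sum>i. (w + d i) choose d i) \<le> (w + 1) * (m + 1)\<close>, because the maximal degree \<open>t\<close> occurs only once.

  The pairs of a system of forms and a flag that solves it are projective over the space of systems.  So every
  system has a solution if a general one has, and for this it suffices to find one system \<open>g\<close> with a solution
  at which the differential of the equations is surjective.  Both halves are made elementary as follows.

  Surjectivity (\<open>general_forms\<close>).  At the coordinate flag, the differential for a suitable \<open>g\<close> is multiplication
  by linear forms on the span of \<open>m\<close> arbitrary tuples of forms of degrees \<open>d i - 1\<close> and of \<open>x ^ (t - 1)\<close> in the component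
  of degree \<open>t\<close>.  That it is onto for some choice is a dimension count of the functionals vanishing on the
  image, stratified by rank.  It is carried out by counting over \<open>\<int> / p\<close> for a large prime \<open>p\<close> and lifted to
  characteristic zero.  The inequality for full rank is \<open>0 \<le> \<rho>\<close>, and those for lower rank follow from it because \<open>t \<ge> 3\<close>
  (\<open>dimension_bound\<close>).

  Dominance and properness (\<open>deformation\<close>, \<open>limit_of_deformation\<close>).  By surjectivity, the equations can be solved for
  the pencil \<open>(1 - X) * g + X * f\<close> over formal power series in \<open>X\<close>.  Evaluation \<open>X \<mapsto> 1\<close> extends from polynomials to a
  place of the field of Laurent series with values in the algebraically closed ground field (\<open>place_extension\<close>).
  A basis of the flag with entries in the valuation ring, chosen by Gaussian elimination (\<open>echelon_form\<close>), can be
  specialised along the place, and gives a solution for \<open>f\<close>.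

  Finally, the vanishing of polynomials on linear subspaces is translated into membership in ideals
  (\<open>vanishing_subset_ideal\<close>, \<open>fat_plane\<close>).
\<close>

section \<open>Evaluation of polynomials\<close>

type_synonym monomial = "nat \<Rightarrow>\<^sub>0 nat"

abbreviation "lookup \<equiv> Poly_Mapping.lookup"
abbreviation "keys \<equiv> Poly_Mapping.keys"
abbreviation "single \<equiv> Poly_Mapping.single"

definition power_product :: "(nat \<Rightarrow> 'a::comm_monoid_mult) \<Rightarrow> monomial \<Rightarrow> 'a" where
  "power_product a m = (\<Prod>i\<in>keys m. a i ^ lookup m i)"

definition peval :: "('k::zero \<Rightarrow> 'a::comm_semiring_1) \<Rightarrow> (nat \<Rightarrow> 'a) \<Rightarrow> 'k mpoly \<Rightarrow> 'a" where
  "peval \<iota> a p = (\<Sum>m\<in>keys p. \<iota> (lookup p m) * power_product a m)"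

abbreviation "value_at \<equiv> peval (\<lambda>x. x)"

locale coeff_hom =
  fixes \<iota> :: "'k::field \<Rightarrow> 'a::comm_ring_1"
  assumes hom_0 [simp]: "\<iota> 0 = 0" and hom_1 [simp]: "\<iota> 1 = 1"
    and hom_add: "\<iota> (x + y) = \<iota> x + \<iota> y" and hom_mult: "\<iota> (x * y) = \<iota> x * \<iota> y"

lemma coeff_hom_id: "coeff_hom (\<lambda>x. x)"
  by unfold_locales auto

lemma power_product_superset:
  assumes "finite A" "keys m \<subseteq> A"
  shows "power_product a m = (\<Prod>i\<in>A. a i ^ lookup m i)"
  unfolding power_product_def using assms
  by (intro prod.mono_neutral_left) (auto simp: in_keys_iff)

lemma power_product_0 [simp]: "power_product a 0 = 1"
  by (simp add: power_product_def)

lemma power_product_single [simp]: "power_product a (single i e) = a i ^ e"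
  by (cases "e = 0") (simp_all add: power_product_def)

lemma power_product_add: "power_product a (m + m') = power_product a m * power_product a m'"
proof -
  let ?A = "keys m \<union> keys m'"
  have "power_product a (m + m') = (\<Prod>i\<in>?A. a i ^ lookup (m + m') i)"
    by (rule power_product_superset) (use Poly_Mapping.keys_add[of m m'] in auto)
  also have "\<dots> = power_product a m * power_product a m'"
    by (simp add: lookup_add power_add prod.distrib power_product_superset[of ?A])
  finally show ?thesis .
qed

lemma peval_superset:
  assumes "finite A" "keys p \<subseteq> A" "\<iota> 0 = 0"
  shows "peval \<iota> a p = (\<Sum>m\<in>A. \<iota> (lookup p m) * power_product a m)"
  unfolding peval_def using assms
  by (intro sum.mono_neutral_left) (auto simp: in_keys_iff)

lemma sum_monomials: "(\<Sum>m\<in>keys p. single m (lookup p m)) = p"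
  by (rule poly_mapping_eqI) (auto simp: lookup_sum lookup_single when_def in_keys_iff)

context coeff_hom
begin

lemma peval_0 [simp]: "peval \<iota> a 0 = 0"
  by (simp add: peval_def)

lemma peval_single [simp]: "peval \<iota> a (single m c) = \<iota> c * power_product a m"
  by (simp add: peval_def)

lemma peval_1 [simp]: "peval \<iota> a 1 = 1"
  by (simp flip: single_one)

lemma peval_add: "peval \<iota> a (p + q) = peval \<iota> a p + peval \<iota> a q"
proof -
  let ?A = "keys p \<union> keys q"
  have "peval \<iota> a (p + q) = (\<Sum>m\<in>?A. \<iota> (lookup (p + q) m) * power_product a m)"
    by (rule peval_superset) (use Poly_Mapping.keys_add[of p q] in auto)
  also have "\<dots> = peval \<iota> a p + peval \<iota> a q"
    by (simp add: lookup_add hom_add distrib_right sum.distrib peval_superset[of ?A])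
  finally show ?thesis .
qed

lemma peval_sum: "peval \<iota> a (\<Sum>x\<in>A. f x) = (\<Sum>x\<in>A. peval \<iota> a (f x))"
  by (induction A rule: infinite_finite_induct) (auto simp: peval_add)

lemma peval_mult: "peval \<iota> a (p * q) = peval \<iota> a p * peval \<iota> a q"
proof -
  have "p * q = (\<Sum>m\<in>keys p. single m (lookup p m)) *
      (\<Sum>m\<in>keys q. single m (lookup q m))"
    by (simp add: sum_monomials)
  then show ?thesis
    by (simp add: sum_product mult_single peval_sum peval_def[of _ _ p] peval_def[of _ _ q]
        hom_mult power_product_add mult_ac)
qed

lemma peval_uminus: "peval \<iota> a (- p) = - peval \<iota> a p"
  using peval_add[of a p "- p"] by (simp add: eq_neg_iff_add_eq_0 add.commute)

lemma peval_diff: "peval \<iota> a (p - q) = peval \<iota> a p - peval \<iota> a q"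
  using peval_add[of a p "- q"] by (simp add: peval_uminus)

lemma peval_power: "peval \<iota> a (p ^ e) = peval \<iota> a p ^ e"
  by (induction e) (auto simp: peval_mult)

end

text \<open>
  Every statement that polynomial evaluation is compatible with some structure -- ring
  homomorphisms, partially defined homomorphisms, congruences -- is an instance of the following
  parametricity property.
\<close>

lemma peval_rel:
  fixes p :: "'k::field mpoly"
  assumes "R 0 0" "R 1 1"
    and add: "\<And>x y x' y'. R x x' \<Longrightarrow> R y y' \<Longrightarrow> R (x + y) (x' + y')"
    and mult: "\<And>x y x' y'. R x x' \<Longrightarrow> R y y' \<Longrightarrow> R (x * y) (x' * y')"
    and coeff: "\<And>c. R (\<iota> c) (\<kappa> c)"
    and p: "p \<in> polys n" and var: "\<And>i. i \<le> n \<Longrightarrow> R (a i) (b i)"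
  shows "R (peval \<iota> a p) (peval \<kappa> b p)"
proof -
  have power: "R (x ^ e) (x' ^ e)" if "R x x'" for x x' e
    by (induction e) (auto intro: that assms)
  have prod: "R (\<Prod>i\<in>A. f i) (\<Prod>i\<in>A. g i)" if "\<And>i. i \<in> A \<Longrightarrow> R (f i) (g i)" for A :: "nat set" and f g
    using that by (induction A rule: infinite_finite_induct) (auto intro: assms)
  have sum: "R (\<Sum>i\<in>A. f i) (\<Sum>i\<in>A. g i)" if "\<And>i. i \<in> A \<Longrightarrow> R (f i) (g i)"
    for A :: "monomial set" and f g
    using that by (induction A rule: infinite_finite_induct) (auto intro: assms)
  show ?thesis
    unfolding peval_def power_product_def
    by (intro sum mult coeff prod power var) (use p in \<open>auto simp: polys_def\<close>)
qed

lemma const_poly_in_polys [simp]: "const_poly c \<in> polys n"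
  by (simp add: const_poly_def polys_def)

lemma var_in_forms [simp]: "i \<le> n \<Longrightarrow> var i \<in> forms n (Suc 0)"
  by (simp add: var_def forms_def polys_def mdeg_def)

lemma forms_imp_polys: "p \<in> forms n e \<Longrightarrow> p \<in> polys n"
  by (simp add: forms_def)

lemma coeff_hom_const_poly: "coeff_hom const_poly"
  by unfold_locales (auto simp: const_poly_def single_add mult_single)

context coeff_hom
begin
lemma peval_const [simp]: "peval \<iota> a (const_poly c) = \<iota> c"
  by (simp add: const_poly_def)
end

lemma peval_var [simp]:
  fixes \<iota> :: "'k::field \<Rightarrow> 'a::comm_ring_1"
  assumes "coeff_hom \<iota>" shows "peval \<iota> a (var i) = a i"
  using assms by (simp add: var_def coeff_hom.peval_single coeff_hom.hom_1)

lemma prod_single_power: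
  fixes e :: "nat \<Rightarrow> nat"
  shows "(\<Prod>i\<in>A. (single (single i 1) 1) ^ e i) =
    single (\<Sum>i\<in>A. single i (e i)) (1::'k::field)"
proof -
  have *: "(single (single i (Suc 0)) 1) ^ e = single (single i e) (1::'k)" for i e :: nat
    by (induction e) (auto simp: mult_single simp flip: single_add)
  show ?thesis
    by (induction A rule: infinite_finite_induct) (auto simp: mult_single * simp flip: single_one)
qed

lemma sum_single_lookup: "(\<Sum>i\<in>keys m. single i (lookup m i)) = m"
  by (rule poly_mapping_eqI) (auto simp: lookup_sum lookup_single when_def in_keys_iff)

lemma peval_identity: "peval const_poly var p = p"
  unfolding peval_def power_product_def var_def prod_single_power sum_single_lookup
  by (simp add: const_poly_def mult_single sum_monomials)

lemma peval_compose:
  fixes p :: "'k::field mpoly" and \<kappa> :: "'f::field \<Rightarrow> 'a::comm_ring_1"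
  assumes \<kappa>: "coeff_hom \<kappa>" and p: "p \<in> polys n"
  shows "peval \<kappa> b (peval (\<lambda>c. const_poly (\<iota> c)) q p) = peval (\<lambda>c. \<kappa> (\<iota> c)) (\<lambda>i. peval \<kappa> b (q i)) p"
  by (rule peval_rel[where R = "\<lambda>u x. peval \<kappa> b u = x", OF _ _ _ _ _ p])
    (simp_all add: \<kappa> coeff_hom.peval_0 coeff_hom.peval_1 coeff_hom.peval_add coeff_hom.peval_mult coeff_hom.peval_const)

lemma polys_0: "0 \<in> polys n" and polys_1: "1 \<in> polys n"
  by (simp_all add: polys_def)

lemma polys_diff: "p \<in> polys n \<Longrightarrow> q \<in> polys n \<Longrightarrow> p - q \<in> polys n"
  using polys_add[of p n "- q"] by (simp add: polys_uminus)

lemma polys_power: "p \<in> polys n \<Longrightarrow> p ^ e \<in> polys n"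
  by (induction e) (auto simp: polys_1 polys_mult)

lemma polys_sum: "(\<And>i. i \<in> A \<Longrightarrow> f i \<in> polys n) \<Longrightarrow> sum f A \<in> polys n"
  by (induction A rule: infinite_finite_induct) (auto simp: polys_0 polys_add)

section \<open>Polynomials vanishing on a grid\<close>

text \<open>
  Induction on the number of variables, splitting off one of them and using that a nonzero univariate
  polynomial has finitely many roots.  The monomials are an abstract index set \<open>M\<close> with exponents \<open>e\<close>,
  so that the terms with a fixed exponent of the split-off variable form an instance of the same
  statement without any reindexing.
\<close>

lemma grid_sum_eq_0:
  fixes c :: "'i \<Rightarrow> 'a::idom" and e :: "'i \<Rightarrow> nat \<Rightarrow> nat"
  assumes "finite V" "finite M" "infinite S"
    and "\<And>m m'. m \<in> M \<Longrightarrow> m' \<in> M \<Longrightarrow> (\<forall>i\<in>V. e m i = e m' i) \<Longrightarrow> m = m'"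
    and "\<And>y. (\<And>i. y i \<in> S) \<Longrightarrow> (\<Sum>m\<in>M. c m * (\<Prod>i\<in>V. y i ^ e m i)) = 0"
    and "m \<in> M"
  shows "c m = 0"
  using assms(1,2,4-)
proof (induction V arbitrary: M m c rule: finite_induct)
  case empty
  obtain z where "z \<in> S" using assms(3) by (meson finite.emptyI finite_subset subsetI)
  have "M = {m}" using empty.prems(2,4) by auto
  with empty.prems(3)[of "\<lambda>_. z"] \<open>z \<in> S\<close> show ?case by simp
next
  case (insert x V)
  define M' where "M' = {m' \<in> M. e m' x = e m x}"
  have "(\<Sum>m'\<in>M'. c m' * (\<Prod>i\<in>V. y i ^ e m' i)) = 0" if y: "\<And>i. y i \<in> S" for y
  proof -
    define P where "P = (\<Sum>m'\<in>M. monom (c m' * (\<Prod>i\<in>V. y i ^ e m' i)) (e m' x))"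
    have "poly P z = 0" if "z \<in> S" for z
    proof -
      have "(\<Sum>m'\<in>M. c m' * (\<Prod>i\<in>insert x V. (y(x := z)) i ^ e m' i)) = 0"
        by (rule insert.prems) (use y that in auto)
      moreover have "(\<Prod>i\<in>insert x V. (y(x := z)) i ^ e m' i) = z ^ e m' x * (\<Prod>i\<in>V. y i ^ e m' i)" for m'
      proof -
        have "(\<Prod>i\<in>V. (y(x := z)) i ^ e m' i) = (\<Prod>i\<in>V. y i ^ e m' i)"
          by (rule prod.cong) (use insert.hyps in auto)
        then show ?thesis using insert.hyps by simp
      qed
      ultimately show ?thesis by (simp add: P_def poly_sum poly_monom mult_ac)
    qed
    then have "S \<subseteq> {z. poly P z = 0}" by auto
    then have "P = 0" using assms(3) poly_roots_finite[of P] finite_subset by blast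
    then have "coeff P (e m x) = 0" by simp
    then show ?thesis
      using insert.prems(1) by (simp add: P_def coeff_sum M'_def sum.If_cases Int_def conj_commute if_distrib)
  qed
  moreover have "m1 = m2" if "m1 \<in> M'" "m2 \<in> M'" "\<forall>i\<in>V. e m1 i = e m2 i" for m1 m2
    using that insert.prems(2)[of m1 m2] by (auto simp: M'_def)
  moreover have "finite M'" "m \<in> M'" using insert.prems by (auto simp: M'_def)
  ultimately show ?case
    using insert.IH[of M' c m] by blast
qed

lemma peval_grid_imp_0:
  fixes p :: "'a::field mpoly"
  assumes "infinite S" and "\<And>y. (\<And>i. y i \<in> S) \<Longrightarrow> peval (\<lambda>c. c) y p = 0"
  shows "p = 0"
proof -
  define V where "V = (\<Union>m\<in>keys p. keys m)"
  have V: "finite V" by (simp add: V_def)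
  have "lookup p m = 0" if "m \<in> keys p" for m
  proof (rule grid_sum_eq_0[where c = "lookup p" and m = m and V = V and M = "keys p" and S = S and e = lookup])
    fix m m' assume m: "m \<in> keys p" "m' \<in> keys p"
      and eq: "\<forall>i\<in>V. lookup m i = lookup m' i"
    have "lookup m i = lookup m' i" for i
      using m eq by (cases "i \<in> V") (auto simp: V_def in_keys_iff)
    then show "m = m'" by (simp add: poly_mapping_eqI)
  next
    fix y :: "nat \<Rightarrow> 'a" assume y: "\<And>i. y i \<in> S"
    have "(\<Sum>m\<in>keys p. lookup p m * (\<Prod>i\<in>V. y i ^ lookup m i)) = peval (\<lambda>c. c) y p"
      unfolding peval_def by (intro sum.cong refl arg_cong2[where f = "(*)"] power_product_superset[symmetric])
        (use V in \<open>auto simp: V_def\<close>)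
    then show "(\<Sum>m\<in>keys p. lookup p m * (\<Prod>i\<in>V. y i ^ lookup m i)) = 0"
      using assms(2)[OF y] by simp
  qed (use V assms that in auto)
  then show ?thesis by (metis in_keys_iff poly_mapping_eqI lookup_zero)
qed

section \<open>Places\<close>

text \<open>
  A ring homomorphism defined on a subring of \<open>'f\<close> is represented by its graph, a subring of
  \<open>'f \<times> 'k\<close> which meets \<open>{0} \<times> 'k\<close> only in \<open>0\<close>.  Extension is then inclusion, which is the form that
  Zorn's lemma wants.
\<close>

definition partial_hom :: "('f::field \<times> 'k::field) set \<Rightarrow> bool" where
  "partial_hom G \<longleftrightarrow> (0, 0) \<in> G \<and> (1, 1) \<in> G \<and>
     (\<forall>x a y b. (x, a) \<in> G \<longrightarrow> (y, b) \<in> G \<longrightarrow> (x + y, a + b) \<in> G \<and> (x * y, a * b) \<in> G) \<and>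
     (\<forall>x a. (x, a) \<in> G \<longrightarrow> (- x, - a) \<in> G) \<and> (\<forall>a. (0, a) \<in> G \<longrightarrow> a = 0)"

lemma partial_homI:
  assumes "(0, 0) \<in> G" "(1, 1) \<in> G"
    and "\<And>x a y b. (x, a) \<in> G \<Longrightarrow> (y, b) \<in> G \<Longrightarrow> (x + y, a + b) \<in> G"
    and "\<And>x a y b. (x, a) \<in> G \<Longrightarrow> (y, b) \<in> G \<Longrightarrow> (x * y, a * b) \<in> G"
    and "\<And>x a. (x, a) \<in> G \<Longrightarrow> (- x, - a) \<in> G" and "\<And>a. (0, a) \<in> G \<Longrightarrow> a = 0"
  shows "partial_hom G"
  unfolding partial_hom_def using assms by blast

lemma partial_homD:
  assumes "partial_hom G"
  shows "(0, 0) \<in> G" "(1, 1) \<in> G"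
    and "(x, a) \<in> G \<Longrightarrow> (y, b) \<in> G \<Longrightarrow> (x + y, a + b) \<in> G"
    and "(x, a) \<in> G \<Longrightarrow> (y, b) \<in> G \<Longrightarrow> (x * y, a * b) \<in> G"
    and "(x, a) \<in> G \<Longrightarrow> (- x, - a) \<in> G" and "(0, a) \<in> G \<Longrightarrow> a = 0"
  using assms unfolding partial_hom_def by blast+

lemma partial_hom_diff:
  assumes "partial_hom G" "(x, a) \<in> G" "(y, b) \<in> G"
  shows "(x - y, a - b) \<in> G"
  using partial_homD(3)[OF assms(1,2) partial_homD(5)[OF assms(1,3)]] by simp

lemma partial_hom_unique:
  assumes "partial_hom G" "(x, a) \<in> G" "(x, b) \<in> G"
  shows "a = b"
  using partial_homD(6)[OF assms(1), of "a - b"] partial_hom_diff[OF assms] by simp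

lemma partial_hom_sum:
  assumes "partial_hom G" "\<And>i. i \<in> A \<Longrightarrow> (f i, g i) \<in> G"
  shows "(sum f A, sum g A) \<in> G"
  using assms(2) by (induction A rule: infinite_finite_induct) (auto intro: partial_homD assms)

definition coeff_rel :: "('f::field \<times> 'k::field) set \<Rightarrow> 'f poly \<Rightarrow> 'k poly \<Rightarrow> bool" where
  "coeff_rel G P Q \<longleftrightarrow> (\<forall>i. (coeff P i, coeff Q i) \<in> G)"

lemma coeff_rel_ring:
  assumes "partial_hom G"
  shows "coeff_rel G 0 0" "coeff_rel G 1 1"
    and "coeff_rel G P Q \<Longrightarrow> coeff_rel G P' Q' \<Longrightarrow> coeff_rel G (P + P') (Q + Q')"
    and "coeff_rel G P Q \<Longrightarrow> coeff_rel G P' Q' \<Longrightarrow> coeff_rel G (P * P') (Q * Q')"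
    and "coeff_rel G P Q \<Longrightarrow> coeff_rel G (- P) (- Q)"
    and "(x, a) \<in> G \<Longrightarrow> coeff_rel G [:x:] [:a:]"
    and "coeff_rel G [:0, 1:] [:0, 1:]"
  unfolding coeff_rel_def using assms
  by (auto simp: coeff_mult coeff_1 coeff_pCons intro: partial_homD intro!: partial_hom_sum split: nat.splits)

lemma coeff_rel_lift:
  assumes "partial_hom G" and surj: "\<And>a. \<exists>x. (x, a) \<in> G"
  shows "\<exists>P. coeff_rel G P Q"
proof (induction Q rule: pCons_induct)
  case 0 then show ?case using coeff_rel_ring(1)[OF assms(1)] by blast
next
  case (pCons a Q)
  then obtain P x where "coeff_rel G P Q" "(x, a) \<in> G" using surj by blast
  then have "coeff_rel G (pCons x P) (pCons a Q)"
    by (auto simp: coeff_rel_def coeff_pCons split: nat.splits)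
  then show ?case by blast
qed

text \<open>
  The extension of the homomorphism with graph \<open>G\<close> to polynomial expressions in \<open>x\<close> that sends
  \<open>x\<close> to \<open>\<alpha>\<close>.
\<close>

definition root_extension :: "('f::field \<times> 'k::field) set \<Rightarrow> 'f \<Rightarrow> 'k \<Rightarrow> ('f \<times> 'k) set" where
  "root_extension G x \<alpha> = {(poly P x, poly Q \<alpha>) | P Q. coeff_rel G P Q}"

lemma partial_hom_root_extension:
  assumes G: "partial_hom G"
    and root: "\<And>P Q. coeff_rel G P Q \<Longrightarrow> poly P x = 0 \<Longrightarrow> poly Q \<alpha> = 0"
  shows "partial_hom (root_extension G x \<alpha>)" "G \<subseteq> root_extension G x \<alpha>" "(x, \<alpha>) \<in> root_extension G x \<alpha>"
proof -
  note ring = coeff_rel_ring[OF G]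
  have mem: "(u, w) \<in> root_extension G x \<alpha> \<longleftrightarrow> (\<exists>P Q. coeff_rel G P Q \<and> u = poly P x \<and> w = poly Q \<alpha>)" for u w
    by (auto simp: root_extension_def)
  show "partial_hom (root_extension G x \<alpha>)"
  proof (rule partial_homI)
    show "(0, 0) \<in> root_extension G x \<alpha>" unfolding mem using ring(1) by force
    show "(1, 1) \<in> root_extension G x \<alpha>" unfolding mem using ring(2) by force
    fix u a w b assume "(u, a) \<in> root_extension G x \<alpha>" "(w, b) \<in> root_extension G x \<alpha>"
    then obtain P Q P' Q' where *: "coeff_rel G P Q" "u = poly P x" "a = poly Q \<alpha>"
      "coeff_rel G P' Q'" "w = poly P' x" "b = poly Q' \<alpha>" unfolding mem by blast
    show "(u + w, a + b) \<in> root_extension G x \<alpha>"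
      unfolding mem using ring(3)[OF *(1,4)] by (intro exI conjI) (auto simp: *)
    show "(u * w, a * b) \<in> root_extension G x \<alpha>"
      unfolding mem using ring(4)[OF *(1,4)] by (intro exI conjI) (auto simp: *)
    show "(- u, - a) \<in> root_extension G x \<alpha>"
      unfolding mem using ring(5)[OF *(1)] by (intro exI conjI) (auto simp: *)
  next
    fix a assume "(0, a) \<in> root_extension G x \<alpha>"
    then show "a = 0" unfolding mem using root by metis
  qed
  show "G \<subseteq> root_extension G x \<alpha>"
  proof clarify
    fix u a assume "(u, a) \<in> G"
    from ring(6)[OF this] show "(u, a) \<in> root_extension G x \<alpha>" unfolding mem by force
  qed
  show "(x, \<alpha>) \<in> root_extension G x \<alpha>" unfolding mem using ring(7) by force
qed

text \<open>
  The weak Nullstellensatz in one variable: an element of least degree in \<open>J\<close> divides all others, so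
  any root of it will do.
\<close>

lemma common_root:
  fixes J :: "'k::alg_closed_field poly set"
  assumes J: "0 \<in> J" "1 \<notin> J" "\<And>P Q. P \<in> J \<Longrightarrow> Q \<in> J \<Longrightarrow> P + Q \<in> J" "\<And>P Q. Q \<in> J \<Longrightarrow> P * Q \<in> J"
  obtains \<alpha> where "\<And>Q. Q \<in> J \<Longrightarrow> poly Q \<alpha> = 0"
proof (cases "J = {0}")
  case True
  then show ?thesis using that by auto
next
  case False
  then obtain g0 where "g0 \<in> J \<and> g0 \<noteq> 0" using J(1) by blast
  from arg_min_natI[of "\<lambda>g. g \<in> J \<and> g \<noteq> 0", OF this, where m = degree] arg_min_nat_le[of "\<lambda>g. g \<in> J \<and> g \<noteq> 0", where m = degree]
  obtain g where g: "g \<in> J" "g \<noteq> 0" and min: "\<And>h. h \<in> J \<Longrightarrow> h \<noteq> 0 \<Longrightarrow> degree g \<le> degree h" by blast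
  have "degree g > 0"
  proof (rule ccontr)
    assume "\<not> degree g > 0"
    then obtain c where "g = [:c:]" by (meson degree_eq_zeroE neq0_conv)
    then have "[:inverse c:] * g = 1" using g by simp
    with J(2,4) g show False by metis
  qed
  then obtain \<alpha> where \<alpha>: "poly g \<alpha> = 0" using alg_closed_imp_poly_has_root by blast
  have "poly Q \<alpha> = 0" if "Q \<in> J" for Q
  proof -
    have "Q mod g = Q + (- (Q div g)) * g" by (simp add: minus_mult_div_eq_mod[symmetric] mult.commute)
    then have "Q mod g \<in> J" using J that g by metis
    then have "Q mod g = 0" using min[of "Q mod g"] degree_mod_less[OF g(2), of Q] by force
    then show ?thesis using \<alpha> by (metis mod_0_imp_dvd dvdE mult_zero_left poly_mult)
  qed
  then show ?thesis using that by blast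
qed

text \<open>
  A relation \<open>p 0 + p 1 * x + \<dots> + p n * x^n = 0\<close> over the subring in which \<open>p 0\<close> maps to \<open>1\<close> and the other
  coefficients to \<open>0\<close>: an obstruction to extending the homomorphism to \<open>x\<close>.
\<close>

definition unit_relation :: "('f::field \<times> 'k::field) set \<Rightarrow> 'f \<Rightarrow> nat \<Rightarrow> bool" where
  "unit_relation G x n \<longleftrightarrow>
     (\<exists>p. (p 0, 1) \<in> G \<and> (\<forall>i\<in>{1..n}. (p i, 0) \<in> G) \<and> (\<Sum>i\<le>n. p i * x ^ i) = 0)"

lemma unit_relation_pos:
  assumes "partial_hom G" "unit_relation G x n" shows "0 < n"
proof (rule ccontr)
  assume "\<not> 0 < n"
  then have "(0, 1) \<in> G" using assms(2) by (auto simp: unit_relation_def)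
  then show False using partial_homD(6)[OF assms(1)] by force
qed

text \<open>
  A relation of degree \<open>l \<le> n\<close> for \<open>inverse x\<close>, multiplied by \<open>x^n\<close>, has leading coefficient mapping to
  \<open>1\<close>.  It is used to cancel the leading term of the relation for \<open>x\<close>; cross-multiplying by the two leading
  coefficients avoids any division in the subring.
\<close>

lemma unit_relation_reduce:
  assumes G: "partial_hom G" and x: "x \<noteq> 0" and "unit_relation G x n" "unit_relation G (inverse x) l" "l \<le> n"
  shows "unit_relation G x (n - 1)"
proof -
  have n: "0 < n" "0 < l" using assms unit_relation_pos by blast+
  obtain p where p: "(p 0, 1) \<in> G" "\<And>i. 1 \<le> i \<Longrightarrow> i \<le> n \<Longrightarrow> (p i, 0) \<in> G" "(\<Sum>i\<le>n. p i * x ^ i) = 0"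
    using assms(3) by (auto simp: unit_relation_def)
  obtain q where q: "(q 0, 1) \<in> G" "\<And>i. 1 \<le> i \<Longrightarrow> i \<le> l \<Longrightarrow> (q i, 0) \<in> G" "(\<Sum>i\<le>l. q i * inverse x ^ i) = 0"
    using assms(4) by (auto simp: unit_relation_def)
  define q' where "q' i = (if n \<le> i + l then q (n - i) else 0)" for i
  define u where "u i = q 0 * p i - p n * q' i" for i
  have "(\<Sum>i\<le>n. q' i * x ^ i) = (\<Sum>i\<in>{n-l..n}. q (n - i) * x ^ i)"
    by (rule sum.mono_neutral_cong_right) (auto simp: q'_def)
  also have "\<dots> = (\<Sum>j\<le>l. q j * x ^ (n - j))"
    by (rule sum.reindex_bij_witness[where i = "\<lambda>j. n - j" and j = "\<lambda>j. n - j"]) (use \<open>l \<le> n\<close> in auto)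
  also have "\<dots> = x ^ n * (\<Sum>j\<le>l. q j * inverse x ^ j)"
    unfolding sum_distrib_left
    by (rule sum.cong) (use \<open>l \<le> n\<close> x in \<open>auto simp: power_diff field_simps\<close>)
  finally have "(\<Sum>i\<le>n. u i * x ^ i) = 0"
    using p(3) q(3) by (simp add: u_def left_diff_distrib sum_subtractf mult.assoc flip: sum_distrib_left)
  moreover have "u n = 0" by (simp add: u_def q'_def)
  moreover have "{..n} = insert n {..n - 1}" using n by auto
  ultimately have "(\<Sum>i\<le>n - 1. u i * x ^ i) = 0" using n by simp
  moreover have q': "\<exists>a. (q' i, a) \<in> G" for i
  proof (cases "n \<le> i + l \<and> i < n")
    case True
    then have "(q (n - i), 0) \<in> G" by (intro q(2)) auto
    with True show ?thesis by (auto simp: q'_def)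
  next
    case False then show ?thesis using q(1) partial_homD(1)[OF G] by (auto simp: q'_def)
  qed
  have pn: "(p n * q' i, 0) \<in> G" for i
    using q'[of i] partial_homD(4)[OF G p(2)[of n]] n by fastforce
  have "(u 0, 1) \<in> G"
    using partial_hom_diff[OF G partial_homD(4)[OF G q(1) p(1)] pn[of 0]] by (simp add: u_def)
  moreover have "(u i, 0) \<in> G" if "i \<in> {1..n - 1}" for i
    using partial_hom_diff[OF G partial_homD(4)[OF G q(1) p(2)[of i]] pn[of i]] that by (auto simp: u_def)
  ultimately show ?thesis unfolding unit_relation_def by blast
qed

lemma not_both_unit_relations:
  assumes G: "partial_hom G" and "x \<noteq> 0" "unit_relation G x n" "unit_relation G (inverse x) l"
  shows False
  using assms(2-)
proof (induction "n + l" arbitrary: n l x rule: less_induct)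
  case less
  have pos: "0 < n" "0 < l" using unit_relation_pos[OF G] less.prems by blast+
  show False
  proof (cases "l \<le> n")
    case True
    then have "unit_relation G x (n - 1)" using unit_relation_reduce[OF G] less.prems by blast
    then show False using less.hyps[of "n - 1" l x] less.prems pos by auto
  next
    case False
    then have "unit_relation G (inverse x) (l - 1)"
      using unit_relation_reduce[OF G, of "inverse x" l n] less.prems by auto
    then show False using less.hyps[of n "l - 1" x] less.prems pos by auto
  qed
qed

text \<open>
  Chevalley's extension theorem, for homomorphisms onto an algebraically closed field.  In a maximal
  extension, an element \<open>x\<close> outside the domain must satisfy a unit relation: otherwise the images of the
  polynomials vanishing at \<open>x\<close> form a proper ideal of \<open>'k[T]\<close>, and a common root of them is a
  possible value at \<open>x\<close>.  The elements \<open>x\<close> and \<open>inverse x\<close> cannot both satisfy such relations.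
\<close>

theorem place_extension:
  fixes G0 :: "('f::field \<times> 'k::alg_closed_field) set"
  assumes "partial_hom G0" and surj: "\<And>a. \<exists>x. (x, a) \<in> G0"
  obtains G where "G0 \<subseteq> G" "partial_hom G" "\<forall>x. x \<in> Domain G \<or> inverse x \<in> Domain G"
proof -
  define A where "A = {G. partial_hom G \<and> G0 \<subseteq> G}"
  have "\<exists>M\<in>A. \<forall>X\<in>A. M \<subseteq> X \<longrightarrow> X = M"
  proof (rule subset_Zorn_nonempty)
    show "A \<noteq> {}" using assms(1) by (auto simp: A_def)
    fix C assume C: "C \<noteq> {}" "subset.chain A C"
    then have in_A: "\<And>X. X \<in> C \<Longrightarrow> partial_hom X \<and> G0 \<subseteq> X" unfolding subset_chain_def A_def by blast
    have join: "\<exists>X\<in>C. u \<in> X \<and> w \<in> X" if "u \<in> \<Union>C" "w \<in> \<Union>C" for u w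
    proof -
      from that obtain X Y where XY: "X \<in> C" "Y \<in> C" "u \<in> X" "w \<in> Y" by blast
      then have "X \<subseteq> Y \<or> Y \<subseteq> X" using C(2) unfolding subset_chain_def by blast
      then show ?thesis using XY by blast
    qed
    have "partial_hom (\<Union>C)"
    proof (rule partial_homI)
      show "(0, 0) \<in> \<Union>C" "(1, 1) \<in> \<Union>C" using C(1) in_A partial_homD(1,2) by blast+
      show "(x + y, a + b) \<in> \<Union>C" "(x * y, a * b) \<in> \<Union>C" if "(x, a) \<in> \<Union>C" "(y, b) \<in> \<Union>C" for x a y b
        using join[OF that] in_A partial_homD(3,4) by blast+
      show "(- x, - a) \<in> \<Union>C" if "(x, a) \<in> \<Union>C" for x a
        using that in_A partial_homD(5) by blast
      show "a = 0" if "(0, a) \<in> \<Union>C" for a using that in_A partial_homD(6) by blast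
    qed
    then show "\<Union>C \<in> A" using C(1) in_A by (auto simp: A_def)
  qed
  then obtain G where G: "partial_hom G" "G0 \<subseteq> G" and max: "\<And>X. partial_hom X \<Longrightarrow> G0 \<subseteq> X \<Longrightarrow> G \<subseteq> X \<Longrightarrow> X = G"
    by (auto simp: A_def)
  note ring = coeff_rel_ring[OF G(1)]
  have surj': "\<exists>x. (x, a) \<in> G" for a using surj G(2) by blast
  have unit: "\<exists>n. unit_relation G x n" if "x \<notin> Domain G" for x
  proof -
    define J where "J = {Q. \<exists>P. coeff_rel G P Q \<and> poly P x = 0}"
    have "1 \<in> J"
    proof (rule ccontr)
      assume 1: "1 \<notin> J"
      have 0: "0 \<in> J" using ring(1) by (auto simp: J_def)
      have add: "Q + Q' \<in> J" if "Q \<in> J" "Q' \<in> J" for Q Q'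
      proof -
        from that obtain P P' where "coeff_rel G P Q" "poly P x = 0" "coeff_rel G P' Q'" "poly P' x = 0"
          by (auto simp: J_def)
        then have "coeff_rel G (P + P') (Q + Q')" "poly (P + P') x = 0" using ring(3) by auto
        then show ?thesis unfolding J_def by blast
      qed
      have mult: "Q' * Q \<in> J" if "Q \<in> J" for Q Q'
      proof -
        from that coeff_rel_lift[OF G(1) surj', of Q'] obtain P P' where "coeff_rel G P Q" "poly P x = 0" "coeff_rel G P' Q'"
          by (auto simp: J_def)
        then have "coeff_rel G (P' * P) (Q' * Q)" "poly (P' * P) x = 0" using ring(4) by auto
        then show ?thesis unfolding J_def by blast
      qed
      from common_root[OF 0 1 add mult] obtain \<alpha> where \<alpha>: "\<And>Q. Q \<in> J \<Longrightarrow> poly Q \<alpha> = 0" by blast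
      have root: "poly Q \<alpha> = 0" if "coeff_rel G P Q" "poly P x = 0" for P Q
        using that \<alpha> by (auto simp: J_def)
      have ext: "partial_hom (root_extension G x \<alpha>)" "G \<subseteq> root_extension G x \<alpha>" "(x, \<alpha>) \<in> root_extension G x \<alpha>"
        using partial_hom_root_extension[OF G(1), of x \<alpha>] root by blast+
      have "root_extension G x \<alpha> = G" using max[OF ext(1)] ext(2) G(2) by blast
      then show False using ext(3) that by blast
    qed
    then obtain P where P: "coeff_rel G P 1" "poly P x = 0" by (auto simp: J_def)
    have "unit_relation G x (degree P)"
      unfolding unit_relation_def
    proof (intro exI[of _ "coeff P"] conjI ballI)
      show "(coeff P 0, 1) \<in> G" using P(1) by (auto simp: coeff_rel_def dest: spec[of _ 0])
      show "(coeff P i, 0) \<in> G" if "i \<in> {1..degree P}" for i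
        using P(1) that by (auto simp: coeff_rel_def coeff_1 dest: spec[of _ i])
      show "(\<Sum>i\<le>degree P. coeff P i * x ^ i) = 0" using P(2) by (simp add: poly_altdef)
    qed
    then show ?thesis by blast
  qed
  have "x \<in> Domain G \<or> inverse x \<in> Domain G" for x
  proof (cases "x = 0")
    case True
    then show ?thesis using partial_homD(1)[OF G(1)] by blast
  next
    case False
    then show ?thesis using unit[of x] unit[of "inverse x"] not_both_unit_relations[OF G(1) False] by blast
  qed
  then show ?thesis using that[of G] G by blast
qed

section \<open>Dual vectors\<close>

text \<open>
  Linear algebra over the field \<open>'a / Z\<close>, where \<open>Z\<close> is a maximal ideal, carried out with representatives
  in \<open>'a\<close>.  It is needed for \<open>\<int> / p\<close> with \<open>p\<close> arbitrarily large, which is not the carrier of a type, and for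
  fields, where \<open>Z = {0}\<close>.
\<close>

locale residue_field =
  fixes Z :: "'a::comm_ring_1 set"
  assumes zero: "0 \<in> Z" and add: "x \<in> Z \<Longrightarrow> y \<in> Z \<Longrightarrow> x + y \<in> Z" and mult: "x \<in> Z \<Longrightarrow> c * x \<in> Z"
    and one: "1 \<notin> Z" and inv: "x \<notin> Z \<Longrightarrow> \<exists>y. y * x - 1 \<in> Z"
begin

lemma uminus: "x \<in> Z \<Longrightarrow> - x \<in> Z"
  using mult[of x "- 1"] by simp

lemma diff: "x \<in> Z \<Longrightarrow> y \<in> Z \<Longrightarrow> x - y \<in> Z"
  using add[of x "- y"] uminus[of y] by simp

lemma sum: "(\<And>i. i \<in> A \<Longrightarrow> f i \<in> Z) \<Longrightarrow> sum f A \<in> Z"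
  by (induction A rule: infinite_finite_induct) (auto intro: zero add)

definition independent :: "'i set \<Rightarrow> 'h set \<Rightarrow> ('i \<Rightarrow> 'h \<Rightarrow> 'a) \<Rightarrow> bool" where
  "independent A H u \<longleftrightarrow> (\<forall>c. (\<forall>h\<in>H. (\<Sum>a\<in>A. c a * u a h) \<in> Z) \<longrightarrow> (\<forall>a\<in>A. c a \<in> Z))"

text \<open>
  By induction on the set of vectors.  For a further vector \<open>u b\<close>, its component outside
  the span of the \<open>u a\<close> has a nonzero coordinate \<open>k\<close>; the functional \<open>f\<close> is the coordinate \<open>k\<close> corrected so as to
  vanish on the \<open>u a\<close> and scaled to have value \<open>1\<close> at \<open>u b\<close>.
\<close>

lemma dual_vectors:
  assumes "finite A" "finite H" "independent A H u"
  shows "\<exists>e. \<forall>a\<in>A. \<forall>b\<in>A. (\<Sum>h\<in>H. e a h * u b h) - of_bool (a = b) \<in> Z"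
  using assms(1,3)
proof (induction A rule: finite_induct)
  case empty
  then show ?case by simp
next
  case (insert b A)
  have "independent A H u"
    unfolding independent_def
  proof (intro allI impI)
    fix c assume c: "\<forall>h\<in>H. (\<Sum>a\<in>A. c a * u a h) \<in> Z"
    have "(\<Sum>a\<in>insert b A. (c(b := 0)) a * u a h) = (\<Sum>a\<in>A. c a * u a h)" for h
      using insert.hyps by (auto intro!: sum.cong)
    with c have "\<forall>h\<in>H. (\<Sum>a\<in>insert b A. (c(b := 0)) a * u a h) \<in> Z" by simp
    then have "\<forall>a\<in>insert b A. (c(b := 0)) a \<in> Z" using insert.prems unfolding independent_def by blast
    then show "\<forall>a\<in>A. c a \<in> Z" using insert.hyps by (metis fun_upd_other insertI2)
  qed
  from insert.IH[OF this] obtain e where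
    e: "\<And>a a'. a \<in> A \<Longrightarrow> a' \<in> A \<Longrightarrow> (\<Sum>h\<in>H. e a h * u a' h) - of_bool (a = a') \<in> Z" by blast
  define s where "s a = (\<Sum>h\<in>H. e a h * u b h)" for a
  have "\<exists>k\<in>H. u b k - (\<Sum>a\<in>A. s a * u a k) \<notin> Z"
  proof (rule ccontr)
    assume *: "\<not> (\<exists>k\<in>H. u b k - (\<Sum>a\<in>A. s a * u a k) \<notin> Z)"
    have "(\<Sum>a\<in>insert b A. (if a = b then 1 else - s a) * u a h) = u b h - (\<Sum>a\<in>A. s a * u a h)" for h
    proof -
      have "(\<Sum>a\<in>A. (if a = b then 1 else - s a) * u a h) = (\<Sum>a\<in>A. - (s a * u a h))"
        by (rule sum.cong) (use insert.hyps in auto)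
      then show ?thesis using insert.hyps by (simp add: sum_negf)
    qed
    with * have "\<forall>h\<in>H. (\<Sum>a\<in>insert b A. (if a = b then 1 else - s a) * u a h) \<in> Z" by auto
    with insert.prems[unfolded independent_def, rule_format, of "\<lambda>a. if a = b then 1 else - s a" b]
    show False using one by simp
  qed
  then obtain k where k: "k \<in> H" "u b k - (\<Sum>a\<in>A. s a * u a k) \<notin> Z" by blast
  define w where "w = u b k - (\<Sum>a\<in>A. s a * u a k)"
  obtain z where z: "z * w - 1 \<in> Z" using inv[OF k(2)] by (auto simp: w_def)
  define f where "f h = z * (of_bool (h = k) - (\<Sum>a\<in>A. u a k * e a h))" for h
  have f_sum: "(\<Sum>h\<in>H. f h * y h) = z * (y k - (\<Sum>a\<in>A. u a k * (\<Sum>h\<in>H. e a h * y h)))" for y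
  proof -
    have "(\<Sum>h\<in>H. f h * y h) = z * ((\<Sum>h\<in>H. of_bool (h = k) * y h) - (\<Sum>h\<in>H. \<Sum>a\<in>A. u a k * (e a h * y h)))"
      by (simp add: f_def sum_distrib_left sum_distrib_right left_diff_distrib right_diff_distrib sum_subtractf mult.assoc)
    also have "(\<Sum>h\<in>H. of_bool (h = k) * y h) = y k"
      using k(1) assms(2) by (simp add: of_bool_def if_distrib[of "\<lambda>x. x * _"] sum.delta cong: if_cong)
    also have "(\<Sum>h\<in>H. \<Sum>a\<in>A. u a k * (e a h * y h)) = (\<Sum>a\<in>A. u a k * (\<Sum>h\<in>H. e a h * y h))"
      by (subst sum.swap) (simp add: sum_distrib_left)
    finally show ?thesis .
  qed
  have f_b: "(\<Sum>h\<in>H. f h * u b h) - 1 \<in> Z"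
    using z by (simp add: f_sum s_def[symmetric] w_def mult.commute)
  have f_A: "(\<Sum>h\<in>H. f h * u a' h) \<in> Z" if "a' \<in> A" for a'
  proof -
    have "u a' k = (\<Sum>a\<in>A. u a k * of_bool (a = a'))"
      using that insert.hyps(1) by (simp add: of_bool_def if_distrib[of "\<lambda>x. _ * x"] sum.delta' cong: if_cong)
    then have "(\<Sum>h\<in>H. f h * u a' h) = z * (\<Sum>a\<in>A. - u a k * ((\<Sum>h\<in>H. e a h * u a' h) - of_bool (a = a')))"
      by (simp add: f_sum right_diff_distrib sum_subtractf sum_negf)
    moreover have "(\<Sum>a\<in>A. - u a k * ((\<Sum>h\<in>H. e a h * u a' h) - of_bool (a = a'))) \<in> Z"
      by (intro sum mult e that)
    ultimately show ?thesis by (simp only: mult)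
  qed
  define e' where "e' a h = (if a = b then f h else e a h - s a * f h)" for a h
  have e'_sum: "(\<Sum>h\<in>H. e' a h * y h) = (\<Sum>h\<in>H. e a h * y h) - s a * (\<Sum>h\<in>H. f h * y h)" if "a \<in> A" for a y
  proof -
    have "e' a h * y h = e a h * y h - s a * (f h * y h)" for h
      using that insert.hyps by (auto simp: e'_def left_diff_distrib mult.assoc)
    then show ?thesis by (simp add: sum_subtractf sum_distrib_left)
  qed
  have e'_b: "(\<Sum>h\<in>H. e' b h * y h) = (\<Sum>h\<in>H. f h * y h)" for y by (simp add: e'_def)
  show ?case
  proof (intro exI[of _ e'] ballI)
    fix a a' assume a: "a \<in> insert b A" and a': "a' \<in> insert b A"
    consider "a = b" "a' = b" | "a = b" "a' \<in> A" | "a \<in> A" "a' = b" | "a \<in> A" "a' \<in> A" using a a' by blast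
    then show "(\<Sum>h\<in>H. e' a h * u a' h) - of_bool (a = a') \<in> Z"
    proof cases
      case 1 then show ?thesis using f_b by (simp add: e'_b)
    next
      case 2 then show ?thesis using f_A insert.hyps by (auto simp: e'_b)
    next
      case 3
      have "(\<Sum>h\<in>H. e' a h * u b h) = - s a * ((\<Sum>h\<in>H. f h * u b h) - 1)"
        using 3 by (simp add: e'_sum s_def[symmetric] algebra_simps)
      then show ?thesis using 3 insert.hyps mult[OF f_b, of "- s a"] by auto
    next
      case 4
      have "(\<Sum>h\<in>H. e' a h * u a' h) - of_bool (a = a') =
          ((\<Sum>h\<in>H. e a h * u a' h) - of_bool (a = a')) - s a * (\<Sum>h\<in>H. f h * u a' h)"
        using 4 by (simp add: e'_sum)
      also have "\<dots> \<in> Z" by (rule diff[OF e[OF 4] mult[OF f_A[OF 4(2)]]])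
      finally show ?thesis .
    qed
  qed
qed

lemma maximal_independent:
  assumes "finite V" "A0 \<subseteq> V" "independent A0 H u"
  obtains A where "A0 \<subseteq> A" "A \<subseteq> V" "independent A H u"
    "\<forall>l\<in>V. \<exists>c. \<forall>h\<in>H. u l h - (\<Sum>a\<in>A. c a * u a h) \<in> Z"
proof -
  have "finite {A. A0 \<subseteq> A \<and> A \<subseteq> V \<and> independent A H u}" using assms(1) by simp
  moreover have "{A. A0 \<subseteq> A \<and> A \<subseteq> V \<and> independent A H u} \<noteq> {}" using assms by blast
  ultimately obtain A where A: "A0 \<subseteq> A" "A \<subseteq> V" "independent A H u"
    and max: "\<And>B. A0 \<subseteq> B \<Longrightarrow> B \<subseteq> V \<Longrightarrow> independent B H u \<Longrightarrow> A \<subseteq> B \<Longrightarrow> A = B"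
    using finite_has_maximal[of "{A. A0 \<subseteq> A \<and> A \<subseteq> V \<and> independent A H u}"] by auto
  have fin: "finite A" using A(2) assms(1) finite_subset by blast
  have "\<exists>c. \<forall>h\<in>H. u l h - (\<Sum>a\<in>A. c a * u a h) \<in> Z" if l: "l \<in> V" for l
  proof (cases "l \<in> A")
    case True
    have "(\<Sum>a\<in>A. of_bool (a = l) * u a h) = u l h" for h
      using True fin by (simp add: of_bool_def if_distrib[of "\<lambda>x. x * _"] sum.delta cong: if_cong)
    then show ?thesis by (intro exI[of _ "\<lambda>a. of_bool (a = l)"]) (simp add: zero)
  next
    case False
    then have "\<not> independent (insert l A) H u" using max[of "insert l A"] A l by blast
    then obtain c where c: "\<And>h. h \<in> H \<Longrightarrow> (\<Sum>a\<in>insert l A. c a * u a h) \<in> Z" "\<exists>a\<in>insert l A. c a \<notin> Z"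
      unfolding independent_def by blast
    have c_sum: "(\<Sum>a\<in>insert l A. c a * u a h) = c l * u l h + (\<Sum>a\<in>A. c a * u a h)" for h
      using False fin by simp
    have "c l \<notin> Z"
    proof
      assume cl: "c l \<in> Z"
      have "(\<Sum>a\<in>A. c a * u a h) \<in> Z" if "h \<in> H" for h
        using diff[OF c(1)[OF that] mult[OF cl, of "u l h"]] by (simp add: c_sum mult.commute)
      then have "\<forall>a\<in>A. c a \<in> Z" using A(3) unfolding independent_def by blast
      with cl c(2) show False by blast
    qed
    then obtain z where z: "z * c l - 1 \<in> Z" using inv by blast
    have "u l h - (\<Sum>a\<in>A. (- z * c a) * u a h) \<in> Z" if "h \<in> H" for h
    proof -
      have "u l h - (\<Sum>a\<in>A. (- z * c a) * u a h) = z * (\<Sum>a\<in>insert l A. c a * u a h) - u l h * (z * c l - 1)"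
        by (simp add: c_sum sum_distrib_left sum_negf algebra_simps)
      then show ?thesis using diff[OF mult[OF c(1)[OF that]] mult[OF z]] by metis
    qed
    then show ?thesis by (intro exI[of _ "\<lambda>a. - z * c a"]) blast
  qed
  then show ?thesis using that A by blast
qed

end

lemma residue_field_prime:
  assumes "prime (p :: int)" shows "residue_field {x. p dvd x}"
proof
  fix x :: int assume "x \<notin> {x. p dvd x}"
  then have "coprime x p" using assms by (simp add: prime_imp_coprime coprime_commute)
  then obtain y where "[x * y = 1] (mod p)" using cong_solve_coprime_int by blast
  then show "\<exists>y. y * x - 1 \<in> {x. p dvd x}" by (auto simp: cong_iff_dvd_diff mult.commute)
qed (use assms in \<open>auto simp: not_prime_unit\<close>)

lemma residue_field_0: "residue_field {0 :: 'a::field}"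
proof
  show "x \<notin> {0} \<Longrightarrow> \<exists>y. y * x - 1 \<in> {0}" for x :: 'a
    by (intro exI[of _ "inverse x"]) auto
qed auto

lemma eq_of_dvd_diff:
  fixes x y :: int
  assumes "x \<in> {0..<p}" "y \<in> {0..<p}" "p dvd x - y" shows "x = y"
  using assms by (metis atLeastLessThan_iff mod_eq_dvd_iff mod_pos_pos_trivial)

text \<open>
  Adding all combinations of a dual family to the solutions of the equations gives pairwise different vectors.
\<close>

lemma card_kernel:
  fixes u :: "'i \<Rightarrow> 'h \<Rightarrow> int" and p :: nat
  assumes p: "prime p" and fin: "finite A" "finite H"
    and ind: "residue_field.independent {x. int p dvd x} A H u"
  shows "card {\<eta> \<in> H \<rightarrow>\<^sub>E {0..<int p}. \<forall>a\<in>A. int p dvd (\<Sum>h\<in>H. \<eta> h * u a h)} * p ^ card A \<le> p ^ card H"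
proof -
  interpret residue_field "{x. int p dvd x}" using p by (simp add: residue_field_prime)
  obtain e where e: "\<And>a b. a \<in> A \<Longrightarrow> b \<in> A \<Longrightarrow> int p dvd (\<Sum>h\<in>H. e a h * u b h) - of_bool (a = b)"
    using dual_vectors[OF fin ind] by auto
  define K where "K = {\<eta> \<in> H \<rightarrow>\<^sub>E {0..<int p}. \<forall>a\<in>A. int p dvd (\<Sum>h\<in>H. \<eta> h * u a h)}"
  define F where "F = (\<lambda>(c, \<eta>). \<lambda>h\<in>H. (\<eta> h + (\<Sum>a\<in>A. c a * e a h)) mod int p)"
  have p0: "0 < int p" using p prime_gt_0_nat by auto
  have pair: "int p dvd (\<Sum>h\<in>H. F (c, \<eta>) h * u b h) - c b" if "\<eta> \<in> K" "b \<in> A" for c \<eta> b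
  proof -
    have "(\<Sum>h\<in>H. F (c, \<eta>) h * u b h) - (\<Sum>h\<in>H. (\<eta> h + (\<Sum>a\<in>A. c a * e a h)) * u b h)
        = (\<Sum>h\<in>H. (F (c, \<eta>) h - (\<eta> h + (\<Sum>a\<in>A. c a * e a h))) * u b h)"
      by (simp add: left_diff_distrib sum_subtractf)
    also have "int p dvd \<dots>"
    proof (intro dvd_sum dvd_mult2)
      fix h assume "h \<in> H"
      have "int p dvd x mod int p - x" for x by (simp add: mod_eq_dvd_iff[symmetric])
      then show "int p dvd F (c, \<eta>) h - (\<eta> h + (\<Sum>a\<in>A. c a * e a h))"
        using \<open>h \<in> H\<close> by (simp add: F_def)
    qed
    finally have 1: "int p dvd (\<Sum>h\<in>H. F (c, \<eta>) h * u b h) - (\<Sum>h\<in>H. (\<eta> h + (\<Sum>a\<in>A. c a * e a h)) * u b h)" .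
    have "(\<Sum>h\<in>H. (\<Sum>a\<in>A. c a * e a h) * u b h) = (\<Sum>a\<in>A. c a * (\<Sum>h\<in>H. e a h * u b h))"
      by (simp add: sum_distrib_left sum_distrib_right mult.assoc sum.swap[of _ A H])
    also have "\<dots> = (\<Sum>a\<in>A. c a * ((\<Sum>h\<in>H. e a h * u b h) - of_bool (a = b))) + c b"
      using that fin by (simp add: right_diff_distrib sum_subtractf of_bool_def if_distrib[of "\<lambda>x. _ * x"] sum.delta' cong: if_cong)
    finally have 2: "(\<Sum>h\<in>H. (\<eta> h + (\<Sum>a\<in>A. c a * e a h)) * u b h) - c b =
        (\<Sum>h\<in>H. \<eta> h * u b h) + (\<Sum>a\<in>A. c a * ((\<Sum>h\<in>H. e a h * u b h) - of_bool (a = b)))"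
      by (simp add: distrib_right sum.distrib)
    have "int p dvd (\<Sum>h\<in>H. (\<eta> h + (\<Sum>a\<in>A. c a * e a h)) * u b h) - c b"
      unfolding 2
    proof (rule dvd_add)
      show "int p dvd (\<Sum>h\<in>H. \<eta> h * u b h)" using that by (auto simp: K_def)
      show "int p dvd (\<Sum>a\<in>A. c a * ((\<Sum>h\<in>H. e a h * u b h) - of_bool (a = b)))"
        by (intro dvd_sum dvd_mult) (use e that in blast)
    qed
    from dvd_add[OF 1 this] show ?thesis by simp
  qed
  have "inj_on F ((A \<rightarrow>\<^sub>E {0..<int p}) \<times> K)"
  proof (rule inj_onI, clarify)
    fix c \<eta> c' \<eta>' assume c: "c \<in> A \<rightarrow>\<^sub>E {0..<int p}" "c' \<in> A \<rightarrow>\<^sub>E {0..<int p}"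
      and \<eta>: "\<eta> \<in> K" "\<eta>' \<in> K" and eq: "F (c, \<eta>) = F (c', \<eta>')"
    have "c b = c' b" if "b \<in> A" for b
    proof (rule eq_of_dvd_diff[where p = "int p"])
      show "int p dvd c b - c' b"
        using dvd_diff[OF pair[OF \<eta>(2) that, of c'] pair[OF \<eta>(1) that, of c]] by (simp add: eq)
    qed (use that c in \<open>auto dest: PiE_mem\<close>)
    then have "c = c'" using c by (intro PiE_ext)
    moreover have "\<eta> h = \<eta>' h" if "h \<in> H" for h
    proof (rule eq_of_dvd_diff[where p = "int p"])
      have "F (c, \<eta>) h = F (c', \<eta>') h" by (simp add: eq)
      then show "int p dvd \<eta> h - \<eta>' h" using that \<open>c = c'\<close> by (simp add: F_def mod_eq_dvd_iff)
    qed (use that \<eta> in \<open>auto simp: K_def dest: PiE_mem\<close>)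
    then have "\<eta> = \<eta>'" using \<eta> by (intro PiE_ext[where k = H and s = "\<lambda>_. {0..<int p}"]) (auto simp: K_def)
    ultimately show "c = c' \<and> \<eta> = \<eta>'" by blast
  qed
  moreover have "F ` ((A \<rightarrow>\<^sub>E {0..<int p}) \<times> K) \<subseteq> H \<rightarrow>\<^sub>E {0..<int p}"
    using p0 by (auto simp: F_def)
  moreover have "finite (H \<rightarrow>\<^sub>E {0..<int p})" using fin by (simp add: finite_PiE)
  ultimately have "card ((A \<rightarrow>\<^sub>E {0..<int p}) \<times> K) \<le> card (H \<rightarrow>\<^sub>E {0..<int p})"
    using card_inj_on_le by blast
  then show ?thesis using fin by (simp add: K_def card_cartesian_product card_PiE mult.commute)
qed

section \<open>Monomials\<close>

definition monomials :: "nat set \<Rightarrow> nat \<Rightarrow> monomial set" where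
  "monomials A d = {m. keys m \<subseteq> A \<and> mdeg m = d}"

lemma mdeg_single [simp]: "mdeg (single i e) = e"
  by (cases "e = 0") (simp_all add: mdeg_def)

lemma bij_betw_monomials:
  assumes "finite A"
  shows "bij_betw (\<lambda>m. Abs_multiset (lookup m)) (monomials A d) (multisets_of_size A d)"
proof -
  have count: "count (Abs_multiset (lookup m)) = lookup m" for m :: monomial
    using finite_lookup[of m] by (intro count_Abs_multiset) simp
  have set: "set_mset (Abs_multiset (lookup m)) = keys m" for m :: monomial
    by (auto simp: set_mset_def count in_keys_iff)
  show ?thesis
  proof (rule bij_betw_byWitness[where f' = "\<lambda>M. Abs_poly_mapping (count M)"])
    show "\<forall>m\<in>monomials A d. Abs_poly_mapping (count (Abs_multiset (lookup m))) = m"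
      by (simp add: count lookup_inverse)
    have lookup: "lookup (Abs_poly_mapping (count M)) = count M" for M :: "nat multiset"
      using finite_set_mset[of M, unfolded set_mset_def] by simp
    show "\<forall>M\<in>multisets_of_size A d. Abs_multiset (lookup (Abs_poly_mapping (count M))) = M"
      by (simp add: lookup count_inverse)
    show "(\<lambda>m. Abs_multiset (lookup m)) ` monomials A d \<subseteq> multisets_of_size A d"
      by (auto simp: monomials_def multisets_of_size_def set size_multiset_overloaded_eq mdeg_def count)
    have keys: "keys (Abs_poly_mapping (count M)) = set_mset M" for M :: "nat multiset"
      by (auto simp: in_keys_iff lookup)
    show "(\<lambda>M. Abs_poly_mapping (count M)) ` multisets_of_size A d \<subseteq> monomials A d"
      by (auto simp: monomials_def multisets_of_size_def keys size_multiset_overloaded_eq mdeg_def lookup)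
  qed
qed

lemma finite_monomials: "finite A \<Longrightarrow> finite (monomials A d)"
  using bij_betw_monomials[of A d] bij_betw_finite finite_multisets_of_size by blast

lemma card_monomials: "finite A \<Longrightarrow> card (monomials A d) = (card A + d - 1) choose d"
  using bij_betw_same_card[OF bij_betw_monomials[of A d]] by (simp add: card_multisets_of_size)

lemma add_single_in_monomials:
  assumes "m \<in> monomials A d" "l \<in> A"
  shows "m + single l (Suc 0) \<in> monomials A (Suc d)"
  using assms Poly_Mapping.keys_add[of m "single l (Suc 0)"] by (auto simp: monomials_def mdeg_add)

lemma monomials_split:
  assumes "m \<in> monomials A d" "lookup m l \<noteq> 0"
  obtains m' where "m = m' + single l (Suc 0)" "m' \<in> monomials A (d - 1)" "l \<in> A" "d \<noteq> 0"
proof -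
  define m' where "m' = m - single l (Suc 0)"
  have m: "m = m' + single l (Suc 0)"
    using assms(2) by (intro poly_mapping_eqI) (auto simp: m'_def lookup_add lookup_minus lookup_single when_def)
  have "keys m' \<subseteq> keys m" by (auto simp: m in_keys_iff lookup_add)
  moreover have "d = Suc (mdeg m')" using assms(1) by (simp add: monomials_def m mdeg_add)
  moreover have "l \<in> A" using assms by (auto simp: monomials_def in_keys_iff)
  ultimately show ?thesis using that m assms by (auto simp: monomials_def)
qed

text \<open>
  Write \<open>D q\<close> for \<open>\<Sum>i\<in>I. (q + d i - 1) choose d i\<close>, the dimension of the
  space of systems of forms in \<open>q\<close> variables.  The inequality says that \<open>D q / q\<close> grows by at least \<open>1\<close> when \<open>q\<close>
  grows by \<open>1\<close>.  Every summand of \<open>D q / q\<close> is monotone in \<open>q\<close>, and a summand with \<open>d i \<ge> 3\<close> grows by at least \<open>1\<close>; for \<open>d i = 2\<close> the growth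
  would only be \<open>1/2\<close>.  This is where a degree at least \<open>3\<close> enters.
\<close>

lemma dimension_bound_step:
  fixes d :: "'i \<Rightarrow> nat"
  assumes "finite I" "i0 \<in> I" "3 \<le> d i0" "\<And>i. i \<in> I \<Longrightarrow> 0 < d i" "0 < q"
  shows "(q + 1) * (\<Sum>i\<in>I. (q + d i - 1) choose d i) + q * (q + 1) \<le> q * (\<Sum>i\<in>I. (q + d i) choose d i)"
proof -
  have rec: "q * ((q + e) choose e) = (q + e) * ((q + e - 1) choose e)" for e
  proof -
    have "((q + e) choose e) * q = (q + e) * ((q + e - 1) choose e)"
      using binomial_absorb_comp[of "q + e" e] by (simp add: mult.commute)
    then show ?thesis by (simp add: mult.commute)
  qed
  have le: "(q + 1) * ((q + d i - 1) choose d i) \<le> q * ((q + d i) choose d i)" if "i \<in> I" for i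
    using assms(4)[OF that] unfolding rec by (intro mult_right_mono) auto
  have "(q + 1) * ((q + d i0 - 1) choose d i0) + q * (q + 1) \<le> q * ((q + d i0) choose d i0)"
  proof -
    let ?b = "(q + d i0 - 1) choose d i0"
    have "?b = (q + d i0 - 1) choose (q - 1)"
      using assms(5) by (subst binomial_symmetric) auto
    also have "\<dots> \<ge> (q + 2) choose (q - 1)"
      using assms(3,5) by (intro binomial_right_mono) auto
    also have "(q + 2) choose (q - 1) = (q + 2) choose 3"
      using assms(5) by (subst binomial_symmetric) (auto simp: numeral_3_eq_3)
    finally have b: "(q + 2) choose 3 \<le> ?b" .
    have "6 * ((q + 2) choose 3) = (q + 2) * (q + 1) * q"
    proof -
      have "3 * ((q + 2) choose 3) = (q + 2) * ((q + 1) choose 2)"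
        using Suc_times_binomial[of 2 "q + 1"] by (simp add: numeral_3_eq_3)
      moreover have "2 * ((q + 1) choose 2) = (q + 1) * q"
        using Suc_times_binomial[of 1 q] by (simp add: numeral_2_eq_2)
      ultimately have "2 * (3 * ((q + 2) choose 3)) = (q + 2) * ((q + 1) * q)" by (metis mult.left_commute)
      then show ?thesis by (simp add: algebra_simps)
    qed
    moreover have "3 * (q * (q + 1)) \<le> (q + 2) * (q + 1) * q" 
    proof -
      have "3 \<le> q + 2" using assms(5) by simp
      from mult_right_mono[OF this, of "q * (q + 1)"] show ?thesis by (simp add: algebra_simps)
    qed
    ultimately have "q * (q + 1) \<le> 2 * ?b" using b by linarith
    also have "\<dots> \<le> (d i0 - 1) * ?b" using assms(3) by (intro mult_right_mono) auto
    finally have "(q + 1) * ?b + q * (q + 1) \<le> (q + 1) * ?b + (d i0 - 1) * ?b" by simp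
    also have "\<dots> = (q + d i0) * ?b" 
    proof -
      have "q + d i0 = (q + 1) + (d i0 - 1)" using assms(3) by simp
      then show ?thesis by (simp only: distrib_right)
    qed
    finally show ?thesis unfolding rec .
  qed
  moreover have "(\<Sum>i\<in>I - {i0}. (q + 1) * ((q + d i - 1) choose d i)) \<le> (\<Sum>i\<in>I - {i0}. q * ((q + d i) choose d i))"
    by (intro sum_mono le) auto
  ultimately show ?thesis
    unfolding sum.remove[OF assms(1,2)] distrib_left[of _ "_ choose _"] sum_distrib_left by linarith
qed

text \<open>
  The numerical condition for all \<open>v\<close> variables implies the conditions for functionals of every lower
  rank \<open>q\<close> that the dimension count in \<open>nondegenerate_tuple_mod_p\<close> requires.
\<close>

lemma dimension_bound:
  fixes d :: "'i \<Rightarrow> nat"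
  assumes "finite I" "i0 \<in> I" "3 \<le> d i0" "\<And>i. i \<in> I \<Longrightarrow> 0 < d i"
    and "(\<Sum>i\<in>I. (v + d i - 1) choose d i) \<le> v * N" "0 < q" "q \<le> v"
  shows "(\<Sum>i\<in>I. (q + d i - 1) choose d i) + q * (v - q) \<le> q * N"
  using \<open>q \<le> v\<close> \<open>0 < q\<close>
proof (induction q rule: inc_induct)
  case base
  then show ?case using assms by simp
next
  case (step q)
  let ?D = "\<lambda>q. \<Sum>i\<in>I. (q + d i - 1) choose d i"
  have "?D (q + 1) + (q + 1) * (v - (q + 1)) \<le> (q + 1) * N" using step by auto
  then have "q * (?D (q + 1) + (q + 1) * (v - (q + 1))) \<le> q * ((q + 1) * N)" by (rule mult_left_mono) simp
  moreover have "(q + 1) * ?D q + q * (q + 1) \<le> q * ?D (q + 1)"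
    using dimension_bound_step[of I i0 d q] assms step by simp
  moreover have "v - q = v - (q + 1) + 1" using step by auto
  ultimately have "(q + 1) * (?D q + q * (v - q)) \<le> (q + 1) * (q * N)"
    by (simp add: algebra_simps)
  then show ?case by (simp del: mult_Suc)
qed

section \<open>General forms have no unexpected linear syzygies\<close>

type_synonym 'i basis_elt = "'i \<times> monomial"

text \<open>
  Let \<open>S\<^sub>e\<close> be the forms of degree \<open>e\<close> in the variables \<open>V\<close>.  The aim is to find \<open>m\<close> elements \<open>\<eta>\<close> of
  \<open>\<Oplus>\<^sub>i S\<^bsub>d i - 1\<^esub>\<close> which together with \<open>h0\<close>, the power of the variable \<open>x0\<close> in component \<open>i0\<close>, satisfy
  \<open>S\<^sub>1 * \<langle>h0, \<eta>\<rangle> = \<Oplus>\<^sub>i S\<^bsub>d i\<^esub>\<close>, as soon as the dimensions permit it.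

  Over \<open>\<int> / p\<close> this is a counting argument.  A tuple \<open>\<eta>\<close> fails if and only if some nonzero linear functional
  \<open>f\<close> on \<open>\<Oplus>\<^sub>i S\<^bsub>d i\<^esub>\<close> kills all products.  Let \<open>q\<close> be the rank of the family of functionals \<open>f (x \<cdot> _)\<close>, for the
  variables \<open>x\<close>.  Then \<open>f\<close> kills the products with a given element of \<open>\<Oplus>\<^sub>i S\<^bsub>d i - 1\<^esub>\<close> under \<open>q\<close>
  independent conditions, and \<open>f\<close> is determined by a choice of \<open>q\<close> variables, the linear relations that
  express the others in terms of them modulo the kernel, and the values of \<open>f\<close> on the monomials in the \<open>q\<close> variables.
  So for each choice there are at most \<open>p ^ (m * q)\<close> such functionals, by \<open>dimension_bound\<close>, each of which is responsible for a
  proportion \<open>p ^ (- m * q)\<close> of the tuples.  Since the multiples of \<open>f\<close> are responsible for the same tuples, the proportion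
  of failing tuples is at most a constant divided by \<open>p - 1\<close>.
\<close>

locale multidegree =
  fixes I :: "'i set" and d :: "'i \<Rightarrow> nat" and V :: "nat set" and i0 :: 'i and x0 :: nat
  assumes finite_I: "finite I" and finite_V: "finite V" and i0: "i0 \<in> I" and x0: "x0 \<in> V"
    and d_pos: "\<And>i. i \<in> I \<Longrightarrow> 0 < d i" and d_i0: "3 \<le> d i0"
begin

text \<open>Basis elements of \<open>\<Oplus>\<^sub>i S\<^bsub>d i\<^esub>\<close>, for the variables \<open>A\<close>, and of \<open>\<Oplus>\<^sub>i S\<^bsub>d i - 1\<^esub>\<close>.\<close>

definition terms :: "nat set \<Rightarrow> 'i basis_elt set" where
  "terms A = Sigma I (\<lambda>i. monomials A (d i))"

definition coterms :: "'i basis_elt set" where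
  "coterms = Sigma I (\<lambda>i. monomials V (d i - 1))"

definition times_var :: "nat \<Rightarrow> 'i basis_elt \<Rightarrow> 'i basis_elt" where
  "times_var l h = (fst h, snd h + single l (Suc 0))"

definition h0 :: "'i basis_elt" where
  "h0 = (i0, single x0 (d i0 - 1))"

lemma finite_terms: "finite A \<Longrightarrow> finite (terms A)"
  by (simp add: terms_def finite_I finite_monomials)

lemma finite_coterms: "finite coterms"
  by (simp add: coterms_def finite_I finite_V finite_monomials)

lemma card_terms: "finite A \<Longrightarrow> card (terms A) = (\<Sum>i\<in>I. (card A + d i - 1) choose d i)"
  by (simp add: terms_def finite_I finite_monomials card_monomials)

lemma times_var_in_terms: "h \<in> coterms \<Longrightarrow> l \<in> V \<Longrightarrow> times_var l h \<in> terms V"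
  using add_single_in_monomials[of "snd h" V "d (fst h) - 1" l] d_pos
  by (auto simp: coterms_def terms_def times_var_def)

lemma h0_in_coterms: "h0 \<in> coterms"
  using i0 x0 by (auto simp: h0_def coterms_def monomials_def)

lemma inj_times_var_h0: "inj_on (\<lambda>l. times_var l h0) A"
  by (auto simp: inj_on_def times_var_def) (metis lookup_single_eq lookup_single_not_eq nat.distinct(1))

lemma times_var_h0_in_terms: "x0 \<in> A \<Longrightarrow> l \<in> A \<Longrightarrow> times_var l h0 \<in> terms A"
  using d_i0 i0 add_single_in_monomials[of "single x0 (d i0 - 1)" A "d i0 - 1" l]
  by (auto simp: times_var_def h0_def terms_def monomials_def)

text \<open>
  Only the relations for indices outside \<open>A\<close> are kept, so that \<open>c\<close> consists of the parameters that are counted below.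
\<close>

definition spanned_by :: "int \<Rightarrow> nat set \<Rightarrow> ('i basis_elt \<Rightarrow> int) \<Rightarrow> (nat \<Rightarrow> nat \<Rightarrow> int) \<Rightarrow> bool" where
  "spanned_by p A g c \<longleftrightarrow> (\<forall>l\<in>V - A. \<forall>h\<in>coterms.
     p dvd g (times_var l h) - (\<Sum>a\<in>A. c l a * g (times_var a h)))"

text \<open>
  Each relation replaces one variable outside \<open>A\<close> in a monomial by a combination of the variables in \<open>A\<close>.
\<close>

lemma spanned_by_unique:
  assumes A: "A \<subseteq> V" and span: "spanned_by p A f c" "spanned_by p A g c"
    and eq: "\<And>\<tau>. \<tau> \<in> terms A \<Longrightarrow> p dvd f \<tau> - g \<tau>"
    and \<tau>: "\<tau> \<in> terms V"
  shows "p dvd f \<tau> - g \<tau>"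
proof -
  define w where "w m = (\<Sum>l\<in>V - A. lookup m l)" for m :: monomial
  have "i \<in> I \<Longrightarrow> m \<in> monomials V (d i) \<Longrightarrow> p dvd f (i, m) - g (i, m)" for i m
  proof (induction "w m" arbitrary: m rule: less_induct)
    case less
    show ?case
    proof (cases "\<exists>l\<in>V - A. lookup m l \<noteq> 0")
      case False
      then have "keys m \<subseteq> A" using less.prems by (auto simp: monomials_def in_keys_iff)
      then show ?thesis using less.prems by (intro eq) (auto simp: terms_def monomials_def)
    next
      case True
      then obtain l where l: "l \<in> V - A" "lookup m l \<noteq> 0" by blast
      from monomials_split[OF less.prems(2) l(2)] obtain m' where
        m': "m = m' + single l (Suc 0)" "m' \<in> monomials V (d i - 1)" by metis
      have h: "(i, m') \<in> coterms" using m' less.prems(1) by (simp add: coterms_def)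
      have m: "(i, m) = times_var l (i, m')" by (simp add: times_var_def m')
      have step: "p dvd f (times_var a (i, m')) - g (times_var a (i, m'))" if a: "a \<in> A" for a
      proof -
        have "w (m' + single a (Suc 0)) = w m'"
          unfolding w_def by (rule sum.cong) (use a in \<open>auto simp: lookup_add lookup_single when_def\<close>)
        moreover have "w m = w m' + 1"
          using l(1) finite_V by (simp add: w_def m' lookup_add sum.distrib lookup_single when_def sum.delta)
        ultimately have "w (m' + single a (Suc 0)) < w m" by simp
        moreover have "m' + single a (Suc 0) \<in> monomials V (d i)"
          using times_var_in_terms[OF h, of a] a A by (auto simp: terms_def times_var_def)
        ultimately show ?thesis using less.hyps less.prems(1) by (simp add: times_var_def)
      qed
      have "f (i, m) - g (i, m) = (f (times_var l (i, m')) - (\<Sum>a\<in>A. c l a * f (times_var a (i, m')))) -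
          (g (times_var l (i, m')) - (\<Sum>a\<in>A. c l a * g (times_var a (i, m')))) +
          (\<Sum>a\<in>A. c l a * (f (times_var a (i, m')) - g (times_var a (i, m'))))"
        by (simp add: m right_diff_distrib sum_subtractf)
      also have "p dvd \<dots>"
      proof (rule dvd_add[OF dvd_diff])
        show "p dvd (\<Sum>a\<in>A. c l a * (f (times_var a (i, m')) - g (times_var a (i, m'))))"
          by (intro dvd_sum dvd_mult step)
      qed (use span l(1) h in \<open>auto simp: spanned_by_def\<close>)
      finally show ?thesis .
    qed
  qed
  then show ?thesis using \<tau> by (auto simp: terms_def)
qed

definition killers :: "nat \<Rightarrow> ('i basis_elt \<Rightarrow> int) set" where
  "killers p = {f \<in> terms V \<rightarrow>\<^sub>E {0..<int p}. \<forall>l\<in>V. f (times_var l h0) = 0}"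

text \<open>
  A functional is encoded by the coefficients \<open>c\<close> of its relations and by its values on monomials in the
  variables \<open>A\<close>.  Vanishing on the multiples of \<open>h0\<close> saves \<open>card A\<close> parameters in either case: if \<open>x0 \<in> A\<close>, then
  \<open>card A\<close> of the values are zero, and otherwise the relation for \<open>x0\<close> is trivial.
\<close>

lemma card_killers_spanned:
  assumes p: "0 < p" and A: "A \<subseteq> V"
  shows "card {f \<in> killers p. \<exists>c. spanned_by (int p) A f c \<and> (x0 \<in> A \<or> (\<forall>a\<in>A. c x0 a = 0))}
    \<le> p ^ (card A * (card V - card A) + card (terms A) - card A)"
proof -
  define F where "F = {f \<in> killers p. \<exists>c. spanned_by (int p) A f c \<and> (x0 \<in> A \<or> (\<forall>a\<in>A. c x0 a = 0))}"
  define S where "S = {0..<int p}"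
  define B' where "B' = (if x0 \<in> A then V - A else V - A - {x0})"
  define T where "T = (if x0 \<in> A then terms A - (\<lambda>l. times_var l h0) ` A else terms A)"
  have finA: "finite A" using A finite_V finite_subset by blast
  have "\<forall>f\<in>F. \<exists>c. (\<forall>l. c l \<in> A \<rightarrow>\<^sub>E S) \<and> spanned_by (int p) A f c \<and> (x0 \<in> A \<or> (\<forall>a\<in>A. c x0 a = 0))"
  proof
    fix f assume "f \<in> F"
    then obtain c where c: "spanned_by (int p) A f c" "x0 \<in> A \<or> (\<forall>a\<in>A. c x0 a = 0)" by (auto simp: F_def)
    define c' where "c' l = (\<lambda>a\<in>A. c l a mod int p)" for l
    have "int p dvd f (times_var l h) - (\<Sum>a\<in>A. c' l a * f (times_var a h))" if "l \<in> V - A" "h \<in> coterms" for l h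
    proof -
      have "f (times_var l h) - (\<Sum>a\<in>A. c' l a * f (times_var a h)) =
          (f (times_var l h) - (\<Sum>a\<in>A. c l a * f (times_var a h))) + (\<Sum>a\<in>A. (c l a - c l a mod int p) * f (times_var a h))"
        by (simp add: c'_def left_diff_distrib sum_subtractf)
      also have "int p dvd \<dots>"
        using c(1) that by (intro dvd_add dvd_sum dvd_mult2) (auto simp: spanned_by_def dvd_minus_mod)
      finally show ?thesis .
    qed
    then have "spanned_by (int p) A f c'" by (simp add: spanned_by_def)
    moreover have "c' l \<in> A \<rightarrow>\<^sub>E S" for l using p by (auto simp: c'_def S_def)
    ultimately show "\<exists>c. (\<forall>l. c l \<in> A \<rightarrow>\<^sub>E S) \<and> spanned_by (int p) A f c \<and> (x0 \<in> A \<or> (\<forall>a\<in>A. c x0 a = 0))"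
      using c(2) by (intro exI[of _ c']) (auto simp: c'_def)
  qed
  then obtain c where c: "\<And>f l. f \<in> F \<Longrightarrow> c f l \<in> A \<rightarrow>\<^sub>E S" "\<And>f. f \<in> F \<Longrightarrow> spanned_by (int p) A f (c f)"
    "\<And>f. f \<in> F \<Longrightarrow> x0 \<in> A \<or> (\<forall>a\<in>A. c f x0 a = 0)" by metis
  define code where "code f = (restrict (c f) B', restrict f T)" for f
  have "inj_on code F"
  proof (rule inj_onI)
    fix f g assume f: "f \<in> F" and g: "g \<in> F" and "code f = code g"
    then have code: "restrict (c f) B' = restrict (c g) B'" "restrict f T = restrict g T" by (auto simp: code_def)
    have "c f l = c g l" if "l \<in> V - A" for l
    proof (cases "l \<in> B'")
      case True then show ?thesis using fun_cong[OF code(1), of l] by simp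
    next
      case False
      then have "l = x0" "x0 \<notin> A" using that by (auto simp: B'_def split: if_splits)
      then show ?thesis using c(1,3)[OF f] c(1,3)[OF g] by (intro PiE_ext[where k = A and s = "\<lambda>_. S"]) auto
    qed
    then have "spanned_by (int p) A f (c g)" using c(2)[OF f] by (simp add: spanned_by_def)
    have fg: "f \<in> killers p" "g \<in> killers p" using f g by (auto simp: F_def)
    have on_A: "int p dvd f \<tau> - g \<tau>" if \<tau>: "\<tau> \<in> terms A" for \<tau>
    proof (cases "\<tau> \<in> T")
      case True then show ?thesis using fun_cong[OF code(2), of \<tau>] by simp
    next
      case False
      then obtain l where "l \<in> A" "\<tau> = times_var l h0" using \<tau> by (auto simp: T_def split: if_splits)
      then show ?thesis using fg A by (auto simp: killers_def)
    qed
    have dvd: "int p dvd f \<tau> - g \<tau>" if "\<tau> \<in> terms V" for \<tau>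
      by (rule spanned_by_unique[OF A \<open>spanned_by (int p) A f (c g)\<close> c(2)[OF g] on_A that])
    show "f = g"
    proof (rule PiE_ext[where k = "terms V" and s = "\<lambda>_. S"])
      show "f \<in> terms V \<rightarrow>\<^sub>E S" "g \<in> terms V \<rightarrow>\<^sub>E S" using fg by (auto simp: killers_def S_def)
      then show "f \<tau> = g \<tau>" if "\<tau> \<in> terms V" for \<tau>
        using dvd[OF that] that by (intro eq_of_dvd_diff[of _ "int p"]) (auto simp: S_def dest: PiE_mem)
    qed
  qed
  moreover have "code ` F \<subseteq> (B' \<rightarrow>\<^sub>E (A \<rightarrow>\<^sub>E S)) \<times> (T \<rightarrow>\<^sub>E S)"
  proof (rule image_subsetI)
    fix f assume f: "f \<in> F"
    have "T \<subseteq> terms V" using A by (auto simp: T_def terms_def monomials_def)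
    moreover have "f \<in> terms V \<rightarrow>\<^sub>E S" using f by (auto simp: F_def killers_def S_def)
    ultimately have "restrict f T \<in> T \<rightarrow>\<^sub>E S" by (auto dest: PiE_mem)
    moreover have "restrict (c f) B' \<in> B' \<rightarrow>\<^sub>E (A \<rightarrow>\<^sub>E S)" using c(1)[OF f] by auto
    ultimately show "code f \<in> (B' \<rightarrow>\<^sub>E (A \<rightarrow>\<^sub>E S)) \<times> (T \<rightarrow>\<^sub>E S)" by (simp add: code_def)
  qed
  moreover have fin: "finite B'" "finite T" "finite S" using finite_V finite_terms[OF finA] by (auto simp: B'_def T_def S_def)
  ultimately have "card F \<le> card ((B' \<rightarrow>\<^sub>E (A \<rightarrow>\<^sub>E S)) \<times> (T \<rightarrow>\<^sub>E S))"
    by (intro card_inj_on_le) (auto intro!: finite_PiE simp: finA)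
  also have "\<dots> = p ^ (card A * card B' + card T)"
    using fin finA by (simp add: card_cartesian_product card_PiE S_def power_add power_mult)
  also have "card A * card B' + card T = card A * (card V - card A) + card (terms A) - card A"
  proof (cases "x0 \<in> A")
    case True
    have "(\<lambda>l. times_var l h0) ` A \<subseteq> terms A" using times_var_h0_in_terms True by blast
    moreover have "card ((\<lambda>l. times_var l h0) ` A) = card A" by (rule card_image[OF inj_times_var_h0])
    ultimately have "card T = card (terms A) - card A" "card A \<le> card (terms A)"
      using True finite_terms[OF finA] card_mono[of "terms A" "(\<lambda>l. times_var l h0) ` A"]
      by (auto simp: T_def card_Diff_subset finite_subset)
    then show ?thesis using True A finA by (simp add: B'_def card_Diff_subset)
  next
    case False
    then have "card B' = card V - card A - 1" using A finA x0 by (simp add: B'_def card_Diff_subset)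
    moreover have "card A < card V" using False A x0 finite_V by (metis psubsetI psubset_card_mono)
    ultimately have "card A * card B' + card A = card A * (card V - card A)"
      by (metis Suc_diff_1 add.commute mult_Suc_right zero_less_diff)
    then show ?thesis using False by (simp add: T_def)
  qed
  finally show ?thesis by (simp add: F_def)
qed

definition pairing :: "('i basis_elt \<Rightarrow> int) \<Rightarrow> ('i basis_elt \<Rightarrow> int) \<Rightarrow> nat \<Rightarrow> int" where
  "pairing \<eta> f l = (\<Sum>h\<in>coterms. \<eta> h * f (times_var l h))"

text \<open>
  The set \<open>A\<close> is a maximal independent subset of the functionals \<open>f (x\<^sub>l \<cdot> _)\<close>, chosen to contain \<open>x0\<close>
  unless the functional with index \<open>x0\<close> is zero.
\<close>

lemma killer_pivots:
  assumes p: "prime p" and f: "f \<in> killers p" and nz: "\<tau> \<in> terms V" "f \<tau> \<noteq> 0"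
  obtains A where "A \<subseteq> V" "A \<noteq> {}" "residue_field.independent {x. int p dvd x} A coterms (\<lambda>a h. f (times_var a h))"
    "\<exists>c. spanned_by (int p) A f c \<and> (x0 \<in> A \<or> (\<forall>a\<in>A. c x0 a = 0))"
proof -
  interpret residue_field "{x. int p dvd x}" using p by (simp add: residue_field_prime)
  let ?u = "\<lambda>a h. f (times_var a h)"
  define Z where "Z = (\<forall>h\<in>coterms. int p dvd f (times_var x0 h))"
  define A0 where "A0 = (if Z then {} else {x0})"
  have ind: "independent A0 coterms ?u"
    using p by (auto simp: independent_def A0_def Z_def prime_dvd_mult_iff)
  have sub: "A0 \<subseteq> V" using x0 by (simp add: A0_def)
  obtain A where A: "A0 \<subseteq> A" "A \<subseteq> V" "independent A coterms ?u"
    and span: "\<forall>l\<in>V. \<exists>c. \<forall>h\<in>coterms. ?u l h - (\<Sum>a\<in>A. c a * ?u a h) \<in> {x. int p dvd x}"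
    by (rule maximal_independent[OF finite_V sub ind]) blast
  have "\<forall>l\<in>V. \<exists>c. \<forall>h\<in>coterms. int p dvd ?u l h - (\<Sum>a\<in>A. c a * ?u a h)" using span by simp
  from bchoice[OF this] obtain c where
    c: "\<And>l h. l \<in> V \<Longrightarrow> h \<in> coterms \<Longrightarrow> int p dvd ?u l h - (\<Sum>a\<in>A. c l a * ?u a h)" by blast
  define c' where "c' = (if Z then c(x0 := \<lambda>_. 0) else c)"
  have "spanned_by (int p) A f c'"
    using c by (auto simp: spanned_by_def c'_def Z_def)
  moreover have "x0 \<in> A \<or> (\<forall>a\<in>A. c' x0 a = 0)"
    using A(1) by (auto simp: c'_def A0_def)
  moreover have "A \<noteq> {}"
  proof
    assume "A = {}"
    obtain i m where \<tau>: "\<tau> = (i, m)" "i \<in> I" "m \<in> monomials V (d i)" using nz(1) by (auto simp: terms_def)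
    then have "mdeg m \<noteq> 0" using d_pos by (auto simp: monomials_def)
    then obtain l where "lookup m l \<noteq> 0" by (auto simp: mdeg_def)
    from monomials_split[OF \<tau>(3) this] obtain m' where
      "m = m' + single l (Suc 0)" "m' \<in> monomials V (d i - 1)" "l \<in> V" by metis
    then have "(i, m') \<in> coterms" "\<tau> = times_var l (i, m')" using \<tau> by (auto simp: coterms_def times_var_def)
    then have "int p dvd f \<tau>" using c[OF \<open>l \<in> V\<close>, of "(i, m')"] \<open>A = {}\<close> by simp
    moreover have "f \<tau> \<in> {0..<int p}" using f nz(1) by (auto simp: killers_def dest: PiE_mem)
    ultimately show False using nz(2) eq_of_dvd_diff[of "f \<tau>" "int p" 0] by auto
  qed
  ultimately show ?thesis using that[of A] A by blast
qed

lemma nondegenerate_tuple_mod_p: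
  assumes bound: "(\<Sum>i\<in>I. (card V + d i - 1) choose d i) \<le> card V * (m + 1)"
    and p: "prime p" "2 ^ card V + 1 < p"
  obtains \<eta> where "\<And>f \<tau>. (\<And>l. l \<in> V \<Longrightarrow> int p dvd f (times_var l h0)) \<Longrightarrow>
      (\<And>j l. j < m \<Longrightarrow> l \<in> V \<Longrightarrow> int p dvd pairing (\<eta> j) f l) \<Longrightarrow> \<tau> \<in> terms V \<Longrightarrow> int p dvd f \<tau>"
proof -
  have p0: "0 < p" using p by simp
  define S where "S = {0..<int p}"
  define H where "H = coterms \<rightarrow>\<^sub>E S"
  define T where "T = {..<m} \<rightarrow>\<^sub>E H"
  define K where "K A f = {\<eta> \<in> H. \<forall>a\<in>A. int p dvd pairing \<eta> f a}" for A f
  define P where "P = p ^ (card coterms * m)"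
  define \<Lambda> where "\<Lambda> A = {f \<in> killers p. residue_field.independent {x. int p dvd x} A coterms (\<lambda>a h. f (times_var a h)) \<and>
     (\<exists>c. spanned_by (int p) A f c \<and> (x0 \<in> A \<or> (\<forall>a\<in>A. c x0 a = 0)))}" for A
  have fin_T: "finite T" by (simp add: T_def H_def S_def finite_PiE finite_coterms)
  have card_T: "card T = P" by (simp add: T_def H_def S_def P_def card_PiE finite_coterms power_mult)
  have fin_killers: "finite (killers p)"
    by (simp add: killers_def finite_PiE finite_terms finite_V)
  have fin_\<Lambda>: "finite (\<Lambda> A)" for A using fin_killers by (simp add: \<Lambda>_def)
  have fin_K: "finite (K A f)" for A f by (simp add: K_def H_def S_def finite_PiE finite_coterms)
  have card_pairs: "card (Sigma (\<Lambda> A) (\<lambda>f. {..<m} \<rightarrow>\<^sub>E K A f)) \<le> P" if A: "A \<subseteq> V" "A \<noteq> {}" for A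
  proof -
    define q where "q = card A"
    have finA: "finite A" using A finite_V finite_subset by blast
    have q: "0 < q" "q \<le> card V" using A finA finite_V by (auto simp: q_def card_gt_0_iff card_mono)
    have "(\<Sum>i\<in>I. (q + d i - 1) choose d i) + q * (card V - q) \<le> q * (m + 1)"
      using dimension_bound[of I i0 d "card V" "m + 1" q] finite_I i0 d_i0 d_pos bound q by blast
    then have "card A * (card V - card A) + card (terms A) - card A \<le> q * m"
      using finA by (simp add: card_terms q_def)
    moreover have "card (\<Lambda> A) \<le> p ^ (card A * (card V - card A) + card (terms A) - card A)"
      by (rule order_trans[OF card_mono card_killers_spanned[OF p0 A(1)]]) (auto simp: \<Lambda>_def fin_killers)
    ultimately have \<Lambda>: "card (\<Lambda> A) \<le> p ^ (q * m)"
      using p0 by (elim order_trans, intro power_increasing) auto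
    have K: "card (K A f) ^ m * card (\<Lambda> A) \<le> P" if "f \<in> \<Lambda> A" for f
    proof -
      have "card (K A f) * p ^ q \<le> p ^ card coterms"
        using card_kernel[OF p(1) finA finite_coterms, of "\<lambda>a h. f (times_var a h)"] that
        by (simp add: K_def H_def S_def pairing_def q_def \<Lambda>_def)
      then have "(card (K A f) * p ^ q) ^ m \<le> (p ^ card coterms) ^ m" by (rule power_mono) simp
      then have "card (K A f) ^ m * p ^ (q * m) \<le> P" by (simp add: power_mult_distrib P_def power_mult)
      then show ?thesis using \<Lambda> by (meson le_trans mult_le_mono2)
    qed
    have "card (Sigma (\<Lambda> A) (\<lambda>f. {..<m} \<rightarrow>\<^sub>E K A f)) = (\<Sum>f\<in>\<Lambda> A. card (K A f) ^ m)"
      using fin_\<Lambda> fin_K by (subst card_SigmaI) (auto simp: card_PiE finite_PiE)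
    also have "card (\<Lambda> A) * \<dots> \<le> card (\<Lambda> A) * P"
      using sum_mono[of "\<Lambda> A" "\<lambda>f. card (K A f) ^ m * card (\<Lambda> A)" "\<lambda>_. P"] K
      by (simp add: sum_distrib_left mult.commute)
    finally have "card (\<Lambda> A) * card (Sigma (\<Lambda> A) (\<lambda>f. {..<m} \<rightarrow>\<^sub>E K A f)) \<le> card (\<Lambda> A) * P" .
    then show ?thesis
      using fin_\<Lambda>[of A] by (cases "\<Lambda> A = {}") auto
  qed
  define pairs where "pairs = (\<Union>A\<in>Pow V - {{}}. Sigma (\<Lambda> A) (\<lambda>f. {..<m} \<rightarrow>\<^sub>E K A f))"
  have fin_pairs: "finite pairs"
    using finite_V fin_\<Lambda> fin_K by (auto simp: pairs_def finite_PiE)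
  have "card pairs \<le> (\<Sum>A\<in>Pow V - {{}}. P)"
    unfolding pairs_def by (rule order_trans[OF card_UN_le sum_mono]) (use finite_V card_pairs in auto)
  also have "\<dots> \<le> 2 ^ card V * P"
    using finite_V card_mono[of "Pow V" "Pow V - {{}}"] by (simp add: card_Pow)
  finally have card_pairs_le: "card pairs \<le> 2 ^ card V * P" .
  define kills where "kills \<eta> f \<longleftrightarrow> f \<in> killers p \<and> (\<forall>j<m. \<forall>l\<in>V. int p dvd pairing (\<eta> j) f l) \<and> (\<exists>\<tau>\<in>terms V. f \<tau> \<noteq> 0)" for \<eta> f
  have in_pairs: "(f, \<eta>) \<in> pairs" if "\<eta> \<in> T" "kills \<eta> f" for \<eta> f
  proof -
    from that(2) obtain \<tau> where \<tau>: "f \<in> killers p" "\<tau> \<in> terms V" "f \<tau> \<noteq> 0" by (auto simp: kills_def)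
    obtain A where A: "A \<subseteq> V" "A \<noteq> {}"
      "residue_field.independent {x. int p dvd x} A coterms (\<lambda>a h. f (times_var a h))"
      "\<exists>c. spanned_by (int p) A f c \<and> (x0 \<in> A \<or> (\<forall>a\<in>A. c x0 a = 0))"
      by (rule killer_pivots[OF p(1) \<tau>])
    then have "f \<in> \<Lambda> A" using \<tau>(1) by (simp add: \<Lambda>_def)
    moreover from A(1) have "\<eta> \<in> {..<m} \<rightarrow>\<^sub>E K A f"
      using that by (auto simp: T_def K_def kills_def PiE_iff)
    ultimately show ?thesis unfolding pairs_def using A(1,2) by blast
  qed
  define bad where "bad = {\<eta> \<in> T. \<exists>f. kills \<eta> f}"
  have "\<forall>\<eta>\<in>bad. \<exists>f. kills \<eta> f" by (simp add: bad_def)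
  from bchoice[OF this] obtain w where w: "\<And>\<eta>. \<eta> \<in> bad \<Longrightarrow> kills \<eta> (w \<eta>)" by blast
  \<comment> \<open>Each failing tuple is paired with the \<open>p - 1\<close> nonzero multiples of one functional.\<close>
  define sc where "sc = (\<lambda>(\<eta>, c). (\<lambda>\<tau>\<in>terms V. (c * w \<eta> \<tau>) mod int p, \<eta>))"
  have "inj_on sc (bad \<times> {1..<int p})"
  proof (rule inj_onI, clarify)
    fix \<eta> c \<eta>' c' assume \<eta>: "\<eta> \<in> bad" and c: "c \<in> {1..<int p}" "c' \<in> {1..<int p}" and eq: "sc (\<eta>, c) = sc (\<eta>', c')"
    from eq have [simp]: "\<eta>' = \<eta>" by (simp add: sc_def)
    from w[OF \<eta>] obtain \<tau> where \<tau>: "\<tau> \<in> terms V" "w \<eta> \<tau> \<noteq> 0" "w \<eta> \<in> killers p" by (auto simp: kills_def)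
    then have "w \<eta> \<tau> \<in> {0..<int p}" by (auto simp: killers_def dest: PiE_mem)
    then have "\<not> int p dvd w \<eta> \<tau>" using \<tau>(2) eq_of_dvd_diff[of "w \<eta> \<tau>" "int p" 0] by auto
    moreover have "(c * w \<eta> \<tau>) mod int p = (c' * w \<eta> \<tau>) mod int p"
      using eq \<tau>(1) by (auto simp: sc_def dest: fun_cong[of _ _ \<tau>])
    then have "int p dvd (c - c') * w \<eta> \<tau>" by (simp add: mod_eq_dvd_iff left_diff_distrib)
    ultimately have "int p dvd c - c'" using p(1) by (simp add: prime_dvd_mult_iff)
    then have "c = c'" using c by (intro eq_of_dvd_diff[of c "int p"]) auto
    then show "\<eta> = \<eta>' \<and> c = c'" by simp
  qed
  moreover have "sc ` (bad \<times> {1..<int p}) \<subseteq> pairs"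
  proof (rule image_subsetI, clarify)
    fix \<eta> c assume \<eta>: "\<eta> \<in> bad" and c: "c \<in> {1..<int p}"
    have \<eta>T: "\<eta> \<in> T" using \<eta> by (simp add: bad_def)
    define f where "f = (\<lambda>\<tau>\<in>terms V. (c * w \<eta> \<tau>) mod int p)"
    note wk = w[OF \<eta>, unfolded kills_def]
    have diff: "int p dvd f \<tau> - c * w \<eta> \<tau>" if "\<tau> \<in> terms V" for \<tau>
      using that by (simp add: f_def mod_eq_dvd_iff[symmetric])
    have "f \<in> killers p"
      using wk p0 times_var_in_terms[OF h0_in_coterms] by (auto simp: killers_def f_def)
    moreover have "int p dvd pairing (\<eta> j) f l" if "j < m" "l \<in> V" for j l
    proof -
      have "pairing (\<eta> j) f l = (\<Sum>h\<in>coterms. \<eta> j h * (f (times_var l h) - c * w \<eta> (times_var l h))) + c * pairing (\<eta> j) (w \<eta>) l"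
        by (simp add: pairing_def sum_distrib_left right_diff_distrib sum_subtractf mult_ac)
      also have "int p dvd \<dots>"
        using wk that by (intro dvd_add dvd_sum dvd_mult diff times_var_in_terms) auto
      finally show ?thesis .
    qed
    moreover obtain \<tau> where \<tau>: "\<tau> \<in> terms V" "w \<eta> \<tau> \<noteq> 0" using wk by blast
    have "f \<tau> \<noteq> 0"
    proof
      assume "f \<tau> = 0"
      then have "int p dvd c * w \<eta> \<tau>" using diff[OF \<tau>(1)] by simp
      moreover have "\<not> int p dvd c" using c by (auto dest: zdvd_imp_le)
      ultimately have "int p dvd w \<eta> \<tau>" using p(1) by (simp add: prime_dvd_mult_iff)
      moreover have "w \<eta> \<tau> \<in> {0..<int p}" using wk \<tau>(1) by (auto simp: killers_def dest: PiE_mem)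
      ultimately show False using \<tau>(2) eq_of_dvd_diff[of "w \<eta> \<tau>" "int p" 0] by auto
    qed
    ultimately have "kills \<eta> f" using \<tau>(1) by (auto simp: kills_def)
    from in_pairs[OF \<eta>T this] show "sc (\<eta>, c) \<in> pairs" by (simp add: sc_def f_def)
  qed
  ultimately have "card (bad \<times> {1..<int p}) \<le> card pairs"
    using card_inj_on_le fin_pairs by blast
  then have le: "card bad * (p - 1) \<le> 2 ^ card V * P"
  proof -
    have "nat (int p - 1) = p - 1" by simp
    then show ?thesis using \<open>card (bad \<times> {1..<int p}) \<le> card pairs\<close> card_pairs_le
      by (simp add: card_cartesian_product)
  qed
  have "P > 0" using p0 by (simp add: P_def)
  have "card bad < P"
  proof (rule ccontr)
    assume "\<not> card bad < P"
    then have "P * (p - 1) \<le> 2 ^ card V * P" using le by (meson le_trans mult_le_mono1 not_less)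
    then have "p - 1 \<le> 2 ^ card V" using \<open>P > 0\<close> by (simp add: mult.commute)
    then show False using p(2) by simp
  qed
  then have "bad \<noteq> T" using card_T by auto
  then obtain \<eta> where \<eta>: "\<eta> \<in> T" "\<And>f. \<not> kills \<eta> f" by (auto simp: bad_def)
  have "int p dvd f \<tau>" if f: "\<And>l. l \<in> V \<Longrightarrow> int p dvd f (times_var l h0)"
    "\<And>j l. j < m \<Longrightarrow> l \<in> V \<Longrightarrow> int p dvd pairing (\<eta> j) f l" and \<tau>: "\<tau> \<in> terms V" for f \<tau>
  proof (rule ccontr)
    assume nz: "\<not> int p dvd f \<tau>"
    define g where "g = (\<lambda>\<tau>\<in>terms V. f \<tau> mod int p)"
    have diff: "int p dvd g \<tau> - f \<tau>" if "\<tau> \<in> terms V" for \<tau>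
      using that by (simp add: g_def mod_eq_dvd_iff[symmetric])
    have "int p dvd pairing (\<eta> j) g l" if "j < m" "l \<in> V" for j l
    proof -
      have "pairing (\<eta> j) g l = (\<Sum>h\<in>coterms. \<eta> j h * (g (times_var l h) - f (times_var l h))) + pairing (\<eta> j) f l"
        by (simp add: pairing_def right_diff_distrib sum_subtractf)
      also have "int p dvd \<dots>"
        using that by (intro dvd_add dvd_sum dvd_mult diff times_var_in_terms f) auto
      finally show ?thesis .
    qed
    moreover have "g \<in> killers p"
      using p0 times_var_in_terms[OF h0_in_coterms] f(1) by (auto simp: killers_def g_def)
    moreover have "g \<tau> \<noteq> 0" using \<tau> nz by (auto simp: g_def)
    ultimately have "kills \<eta> g" using \<tau> by (auto simp: kills_def)
    then show False using \<eta>(2) by blast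
  qed
  then show ?thesis using that by blast
qed

end

lemma common_denominator:
  fixes c :: "'x \<Rightarrow> rat"
  assumes "finite A"
  shows "\<exists>N::int. N > 0 \<and> (\<forall>x\<in>A. \<exists>z. of_int N * c x = of_int z)"
  using assms
proof (induction A rule: finite_induct)
  case empty
  then show ?case by (intro exI[of _ 1]) simp
next
  case (insert x A)
  then obtain N where N: "N > 0" "\<forall>x\<in>A. \<exists>z. of_int N * c x = of_int z" by blast
  obtain a b where ab: "quotient_of (c x) = (a, b)" by fastforce
  then have b: "b > 0" "of_int b * c x = of_int a"
    using quotient_of_denom_pos[OF ab] quotient_of_div[OF ab] by auto
  show ?case
  proof (rule exI[of _ "b * N"], intro conjI ballI)
    show "b * N > 0" using b N by simp
    fix y assume y: "y \<in> insert x A"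
    show "\<exists>z. of_int (b * N) * c y = of_int z"
    proof (cases "y = x")
      case True
      then have "of_int (b * N) * c y = of_int (N * a)" using b(2) by (simp add: mult_ac)
      then show ?thesis by blast
    next
      case False
      then obtain z where "of_int N * c y = of_int z" using N y by blast
      then have "of_int (b * N) * c y = of_int (b * z)" by (simp add: mult_ac)
      then show ?thesis by blast
    qed
  qed
qed

lemma zero_if_all_powers_dvd:
  fixes x p :: int
  assumes "p > 1" "\<And>k. p ^ k dvd x" shows "x = 0"
proof (rule ccontr)
  assume "x \<noteq> 0"
  have "int k < p ^ k" for k
  proof (induction k)
    case (Suc k)
    have "2 * p ^ k \<le> p * p ^ k" using assms(1) by (intro mult_right_mono) auto
    moreover have "1 \<le> p ^ k" using assms(1) by simp
    ultimately have "1 + int k < p * p ^ k" using Suc by linarith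
    then show ?case by simp
  qed simp
  then have "\<bar>x\<bar> < p ^ nat \<bar>x\<bar>" by (metis abs_ge_zero int_nat_eq)
  then show False using assms(2)[of "nat \<bar>x\<bar>"] \<open>x \<noteq> 0\<close> by (meson dvd_imp_le_int not_le abs_le_D1 order_trans abs_ge_self)
qed

context multidegree
begin

definition column :: "(nat \<Rightarrow> 'i basis_elt \<Rightarrow> int) \<Rightarrow> 'i basis_elt \<Rightarrow> nat \<Rightarrow> nat \<Rightarrow> int" where
  "column \<eta> \<tau> j l = (\<Sum>h\<in>coterms. \<eta> j h * of_bool (\<tau> = times_var l h))"

lemma sum_column:
  assumes "l \<in> V"
  shows "(\<Sum>\<tau>\<in>terms V. f \<tau> * column \<eta> \<tau> j l) = pairing (\<eta> j) f l"
proof -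
  have "(\<Sum>\<tau>\<in>terms V. f \<tau> * column \<eta> \<tau> j l) = (\<Sum>h\<in>coterms. \<Sum>\<tau>\<in>terms V. f \<tau> * (\<eta> j h * of_bool (\<tau> = times_var l h)))"
    unfolding column_def sum_distrib_left by (rule sum.swap)
  also have "\<dots> = (\<Sum>h\<in>coterms. \<eta> j h * f (times_var l h))"
  proof (rule sum.cong[OF refl])
    fix h assume "h \<in> coterms"
    then have "times_var l h \<in> terms V" using times_var_in_terms assms by blast
    then have "(\<Sum>\<tau>\<in>terms V. if \<tau> = times_var l h then f \<tau> * \<eta> j h else 0) = f (times_var l h) * \<eta> j h"
      using finite_terms[OF finite_V] by (simp add: sum.delta)
    moreover have "f \<tau> * (\<eta> j h * of_bool (\<tau> = times_var l h)) = (if \<tau> = times_var l h then f \<tau> * \<eta> j h else 0)" for \<tau>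
      by simp
    ultimately show "(\<Sum>\<tau>\<in>terms V. f \<tau> * (\<eta> j h * of_bool (\<tau> = times_var l h))) = \<eta> j h * f (times_var l h)"
      by (simp add: mult.commute)
  qed
  finally show ?thesis by (simp add: pairing_def)
qed

text \<open>
  Passage from \<open>\<int> / p\<close> to characteristic zero.  The products span modulo \<open>p\<close>, so an integral functional that kills
  them is divisible by every power of \<open>p\<close>; hence there is no nonzero functional over \<open>\<int>\<close>, nor over \<open>\<rat>\<close>, and
  a dual family over \<open>\<rat>\<close> solves the linear system over every field of characteristic zero.
\<close>

lemma nondegenerate_tuple:
  assumes bound: "(\<Sum>i\<in>I. (card V + d i - 1) choose d i) \<le> card V * (m + 1)"
  obtains \<eta> where "\<eta> 0 = (\<lambda>h. of_bool (h = h0))"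
    "\<forall>E. \<exists>C. \<forall>\<tau>\<in>terms V. (\<Sum>j\<le>m. \<Sum>l\<in>V. C j l * of_int (column \<eta> \<tau> j l)) = (E \<tau> :: 'k::field_char_0)"
proof -
  obtain p :: nat where p: "prime p" "2 ^ card V + 1 < p" using bigger_prime by blast
  obtain \<eta>1 where \<eta>1: "\<And>f \<tau>. (\<And>l. l \<in> V \<Longrightarrow> int p dvd f (times_var l h0)) \<Longrightarrow>
      (\<And>j l. j < m \<Longrightarrow> l \<in> V \<Longrightarrow> int p dvd pairing (\<eta>1 j) f l) \<Longrightarrow> \<tau> \<in> terms V \<Longrightarrow> int p dvd f \<tau>"
    by (rule nondegenerate_tuple_mod_p[OF bound p]) blast
  define \<eta> where "\<eta> j = (case j of 0 \<Rightarrow> (\<lambda>h. of_bool (h = h0)) | Suc j \<Rightarrow> \<eta>1 j)" for j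
  have \<eta>0: "pairing (\<eta> 0) f l = f (times_var l h0)" for f l
  proof -
    have "pairing (\<eta> 0) f l = (\<Sum>h\<in>coterms. if h = h0 then f (times_var l h) else 0)"
      unfolding pairing_def by (rule sum.cong) (auto simp: \<eta>_def)
    then show ?thesis using h0_in_coterms finite_coterms by (simp add: sum.delta)
  qed
  have mod_p: "int p dvd f \<tau>" if "\<And>j l. j \<le> m \<Longrightarrow> l \<in> V \<Longrightarrow> int p dvd pairing (\<eta> j) f l" "\<tau> \<in> terms V" for f \<tau>
  proof (rule \<eta>1)
    show "int p dvd f (times_var l h0)" if "l \<in> V" for l
      using \<open>\<And>j l. j \<le> m \<Longrightarrow> l \<in> V \<Longrightarrow> int p dvd pairing (\<eta> j) f l\<close>[of 0 l] that by (simp add: \<eta>0)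
    show "int p dvd pairing (\<eta>1 j) f l" if "j < m" "l \<in> V" for j l
      using \<open>\<And>j l. j \<le> m \<Longrightarrow> l \<in> V \<Longrightarrow> int p dvd pairing (\<eta> j) f l\<close>[of "Suc j" l] that by (simp add: \<eta>_def)
  qed fact
  have over_int: "f \<tau> = 0" if f: "\<And>j l. j \<le> m \<Longrightarrow> l \<in> V \<Longrightarrow> pairing (\<eta> j) f l = 0" and "\<tau> \<in> terms V" for f \<tau>
  proof (rule zero_if_all_powers_dvd[of "int p"])
    have "\<forall>\<tau>\<in>terms V. int p ^ k dvd f \<tau>" for k
    proof (induction k)
      case (Suc k)
      define g where "g \<tau> = f \<tau> div int p ^ k" for \<tau>
      have g: "f \<tau> = int p ^ k * g \<tau>" if "\<tau> \<in> terms V" for \<tau> using Suc that by (simp add: g_def)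
      have "int p ^ k * pairing (\<eta> j) g l = pairing (\<eta> j) f l" if "l \<in> V" for j l
        unfolding pairing_def sum_distrib_left
        by (rule sum.cong) (use that in \<open>auto simp: g times_var_in_terms mult_ac\<close>)
      then have "pairing (\<eta> j) g l = 0" if "j \<le> m" "l \<in> V" for j l
        using f[OF that] that p(2) by (metis mult_eq_0_iff not_less_zero of_nat_eq_0_iff power_eq_0_iff)
      then have "int p dvd g \<tau>" if "\<tau> \<in> terms V" for \<tau> using mod_p that by simp
      then show ?case using g by (auto simp: mult.commute intro: mult_dvd_mono)
    qed simp
    then show "int p ^ k dvd f \<tau>" for k using that by blast
    show "1 < int p" using p by simp
  qed
  define J where "J = {..m} \<times> V"
  define u where "u \<tau> = (\<lambda>(j, l). of_int (column \<eta> \<tau> j l) :: rat)" for \<tau>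
  interpret rat: residue_field "{0::rat}" by (rule residue_field_0)
  have "rat.independent (terms V) J u"
    unfolding rat.independent_def
  proof (intro allI impI ballI)
    fix c :: "'i basis_elt \<Rightarrow> rat" and \<tau>
    assume c: "\<forall>h\<in>J. (\<Sum>\<tau>\<in>terms V. c \<tau> * u \<tau> h) \<in> {0}" and \<tau>: "\<tau> \<in> terms V"
    from common_denominator[OF finite_terms[OF finite_V], of c] obtain N where
      N: "N > 0" "\<forall>\<tau>\<in>terms V. \<exists>z. of_int N * c \<tau> = of_int z" by blast
    from bchoice[OF N(2)] obtain f where f: "\<And>\<tau>. \<tau> \<in> terms V \<Longrightarrow> of_int N * c \<tau> = of_int (f \<tau>)" by blast
    have "pairing (\<eta> j) f l = 0" if "j \<le> m" "l \<in> V" for j l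
    proof -
      have "of_int (pairing (\<eta> j) f l) = (\<Sum>\<tau>\<in>terms V. of_int (f \<tau>) * u \<tau> (j, l))"
        by (simp add: sum_column[OF that(2), symmetric] u_def)
      also have "\<dots> = of_int N * (\<Sum>\<tau>\<in>terms V. c \<tau> * u \<tau> (j, l))"
        unfolding sum_distrib_left by (rule sum.cong) (simp_all add: f[symmetric] mult.assoc)
      also have "\<dots> = 0" using c that by (auto simp: J_def)
      finally show ?thesis by simp
    qed
    then have "f \<tau> = 0" using over_int \<tau> by blast
    then show "c \<tau> \<in> {0}" using f[OF \<tau>] N(1) by simp
  qed
  from rat.dual_vectors[OF finite_terms[OF finite_V] _ this] obtain e where
    e: "\<And>\<tau> \<tau>'. \<tau> \<in> terms V \<Longrightarrow> \<tau>' \<in> terms V \<Longrightarrow> (\<Sum>h\<in>J. e \<tau> h * u \<tau>' h) = of_bool (\<tau> = \<tau>')"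
    using finite_V by (auto simp: J_def)
  have "\<exists>C. \<forall>\<tau>\<in>terms V. (\<Sum>j\<le>m. \<Sum>l\<in>V. C j l * of_int (column \<eta> \<tau> j l)) = (E \<tau> :: 'k)" for E
  proof (intro exI ballI)
    fix \<tau> assume \<tau>: "\<tau> \<in> terms V"
    define C where "C j l = (\<Sum>\<tau>\<in>terms V. E \<tau> * of_rat (e \<tau> (j, l)))" for j l
    have "(\<Sum>j\<le>m. \<Sum>l\<in>V. C j l * of_int (column \<eta> \<tau> j l)) =
        (\<Sum>h\<in>J. C (fst h) (snd h) * of_int (column \<eta> \<tau> (fst h) (snd h)))"
      by (simp add: J_def sum.cartesian_product split_beta)
    also have "\<dots> = (\<Sum>h\<in>J. \<Sum>\<tau>'\<in>terms V. E \<tau>' * of_rat (e \<tau>' h * u \<tau> h))"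
      by (rule sum.cong) (auto simp: C_def u_def sum_distrib_right of_rat_mult mult.assoc)
    also have "\<dots> = (\<Sum>\<tau>'\<in>terms V. E \<tau>' * of_rat (\<Sum>h\<in>J. e \<tau>' h * u \<tau> h))"
      by (subst sum.swap) (simp add: of_rat_sum sum_distrib_left)
    also have "\<dots> = (\<Sum>\<tau>'\<in>terms V. if \<tau>' = \<tau> then E \<tau>' else 0)"
      by (rule sum.cong) (auto simp: e \<tau>)
    also have "\<dots> = E \<tau>" using \<tau> finite_terms[OF finite_V] by simp
    finally show "(\<Sum>j\<le>m. \<Sum>l\<in>V. (\<lambda>j l. \<Sum>\<tau>\<in>terms V. E \<tau> * of_rat (e \<tau> (j, l))) j l * of_int (column \<eta> \<tau> j l)) = E \<tau>"
      by (simp add: C_def)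
  qed
  then show ?thesis by (intro that[of \<eta>]) (auto simp: \<eta>_def)
qed

end

lemma lookup_var_mult:
  assumes "finite A"
  shows "lookup (var l * (\<Sum>\<beta>\<in>A. single \<beta> (c \<beta>))) \<mu> =
    (\<Sum>\<beta>\<in>A. c \<beta> * of_bool (\<mu> = \<beta> + single l (Suc 0)))"
  unfolding var_def sum_distrib_left mult_single lookup_sum
  by (rule sum.cong) (auto simp: lookup_single when_def add.commute)

lemma lookup_const_poly_mult: "lookup (const_poly c * p) \<mu> = c * lookup p \<mu>"
proof -
  have "const_poly c * p = (\<Sum>m\<in>keys p. single m (c * lookup p m))"
    by (subst sum_monomials[of p, symmetric]) (simp add: const_poly_def sum_distrib_left mult_single)
  also have "lookup \<dots> \<mu> = c * lookup p \<mu>"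
    by (auto simp: lookup_sum lookup_single when_def in_keys_iff)
  finally show ?thesis .
qed

lemma forms_0: "0 \<in> forms n e"
  by (simp add: forms_def polys_def)

lemma forms_add: "p \<in> forms n e \<Longrightarrow> q \<in> forms n e \<Longrightarrow> p + q \<in> forms n e"
  using polys_add Poly_Mapping.keys_add[of p q] unfolding forms_def by blast

lemma forms_sum: "(\<And>i. i \<in> A \<Longrightarrow> f i \<in> forms n e) \<Longrightarrow> sum f A \<in> forms n e"
  by (induction A rule: infinite_finite_induct) (auto simp: forms_0 forms_add)

lemma const_poly_in_forms: "const_poly c \<in> forms n 0"
  by (simp add: const_poly_def forms_def polys_def mdeg_def)

lemma forms_const_mult: "p \<in> forms n e \<Longrightarrow> const_poly c * p \<in> forms n e"
  using forms_mult[OF const_poly_in_forms[of c n], of p e] by simp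

lemma single_in_forms: "m \<in> monomials {..n} e \<Longrightarrow> single m c \<in> forms n e"
  by (simp add: forms_def polys_def monomials_def)

lemma forms_lookup_eq_0: "p \<in> forms n e \<Longrightarrow> m \<notin> monomials {..n} e \<Longrightarrow> lookup p m = 0"
  by (auto simp: forms_def polys_def monomials_def in_keys_iff)

text \<open>The result in terms of polynomials; \<open>w\<close> is the index of the last variable, and \<open>x0 = w\<close>.\<close>

theorem general_forms:
  fixes I :: "'i set" and d :: "'i \<Rightarrow> nat"
  assumes "finite I" "i0 \<in> I" "\<And>i. i \<in> I \<Longrightarrow> 0 < d i" "3 \<le> d i0"
    and bound: "(\<Sum>i\<in>I. (w + d i) choose d i) \<le> (w + 1) * (m + 1)"
  obtains H :: "nat \<Rightarrow> 'i \<Rightarrow> 'k::field_char_0 mpoly" where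
    "\<forall>i\<in>I. H 0 i = (if i = i0 then var w ^ (d i0 - 1) else 0)"
    "\<forall>j. \<forall>i\<in>I. H j i \<in> forms w (d i - 1)"
    "\<forall>E. (\<forall>i\<in>I. E i \<in> forms w (d i)) \<longrightarrow>
       (\<exists>C. \<forall>i\<in>I. (\<Sum>j\<le>m. \<Sum>l\<le>w. const_poly (C j l) * (var l * H j i)) = E i)"
proof -
  interpret multidegree I d "{..w}" i0 w by unfold_locales (use assms in auto)
  have "(\<Sum>i\<in>I. (card {..w} + d i - 1) choose d i) \<le> card {..w} * (m + 1)" using bound by simp
  then obtain \<eta> where \<eta>: "\<eta> 0 = (\<lambda>h. of_bool (h = h0))"
    "\<forall>E. \<exists>C. \<forall>\<tau>\<in>terms {..w}. (\<Sum>j\<le>m. \<Sum>l\<le>w. C j l * of_int (column \<eta> \<tau> j l)) = (E \<tau> :: 'k)"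
    by (rule nondegenerate_tuple)
  define H :: "nat \<Rightarrow> 'i \<Rightarrow> 'k mpoly" where
    "H j i = (\<Sum>\<beta>\<in>monomials {..w} (d i - 1). single \<beta> (of_int (\<eta> j (i, \<beta>))))" for j i
  have H: "H j i \<in> forms w (d i - 1)" if "i \<in> I" for j i
    unfolding H_def by (intro forms_sum single_in_forms)
  have col: "of_int (column \<eta> (i, \<mu>) j l) = lookup (var l * H j i) \<mu>" if "i \<in> I" for i \<mu> j l
  proof -
    have "column \<eta> (i, \<mu>) j l = (\<Sum>i'\<in>I. \<Sum>\<beta>\<in>monomials {..w} (d i' - 1). \<eta> j (i', \<beta>) * of_bool ((i, \<mu>) = times_var l (i', \<beta>)))"
      unfolding column_def coterms_def by (subst sum.Sigma) (auto simp: finite_I finite_monomials)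
    also have "\<dots> = (\<Sum>i'\<in>I. if i' = i then (\<Sum>\<beta>\<in>monomials {..w} (d i - 1). \<eta> j (i, \<beta>) * of_bool (\<mu> = \<beta> + single l (Suc 0))) else 0)"
      by (rule sum.cong) (auto simp: times_var_def)
    also have "\<dots> = (\<Sum>\<beta>\<in>monomials {..w} (d i - 1). \<eta> j (i, \<beta>) * of_bool (\<mu> = \<beta> + single l (Suc 0)))"
      using that finite_I by simp
    finally show ?thesis unfolding H_def by (simp add: lookup_var_mult finite_monomials)
  qed
  show ?thesis
  proof (rule that[of H])
    have "H 0 i = (if i = i0 then var w ^ (d i0 - 1) else 0)" if i: "i \<in> I" for i
    proof (cases "i = i0")
      case True
      have "var w ^ e = single (single w e) (1::'k)" for e
        by (induction e) (auto simp: var_def mult_single simp flip: single_add)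
      moreover have "H 0 i0 = (\<Sum>\<beta>\<in>monomials {..w} (d i0 - 1). if \<beta> = single w (d i0 - 1) then single \<beta> 1 else 0)"
        unfolding H_def by (rule sum.cong) (auto simp: \<eta>(1) h0_def)
      moreover have "single w (d i0 - 1) \<in> monomials {..w} (d i0 - 1)" by (auto simp: monomials_def)
      ultimately show ?thesis using True by (simp add: finite_monomials)
    next
      case False
      then show ?thesis by (simp add: H_def \<eta>(1) h0_def)
    qed
    then show "\<forall>i\<in>I. H 0 i = (if i = i0 then var w ^ (d i0 - 1) else 0)" by blast
    show "\<forall>j. \<forall>i\<in>I. H j i \<in> forms w (d i - 1)" using H by blast
    show "\<forall>E. (\<forall>i\<in>I. E i \<in> forms w (d i)) \<longrightarrow>
       (\<exists>C. \<forall>i\<in>I. (\<Sum>j\<le>m. \<Sum>l\<le>w. const_poly (C j l) * (var l * H j i)) = E i)"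
    proof (intro allI impI)
      fix E :: "'i \<Rightarrow> 'k mpoly" assume E': "\<forall>i\<in>I. E i \<in> forms w (d i)"
      then have E: "\<And>i. i \<in> I \<Longrightarrow> E i \<in> forms w (d i)" by blast
      from \<eta>(2)[THEN spec, of "\<lambda>(i, \<mu>). lookup (E i) \<mu>"] obtain C where
        C: "\<And>i \<mu>. (i, \<mu>) \<in> terms {..w} \<Longrightarrow> (\<Sum>j\<le>m. \<Sum>l\<le>w. C j l * of_int (column \<eta> (i, \<mu>) j l)) = lookup (E i) \<mu>"
        by fastforce
      have "(\<Sum>j\<le>m. \<Sum>l\<le>w. const_poly (C j l) * (var l * H j i)) = E i" if i: "i \<in> I" for i
      proof (rule poly_mapping_eqI)
        fix \<mu>
        let ?S = "\<Sum>j\<le>m. \<Sum>l\<le>w. const_poly (C j l) * (var l * H j i)"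
        have "var l * H j i \<in> forms w (d i)" if "l \<le> w" for l j
          using forms_mult[OF var_in_forms[OF that] H[OF i, of j]] assms(3)[OF i] by simp
        then have S: "?S \<in> forms w (d i)" by (intro forms_sum forms_const_mult) auto
        show "lookup ?S \<mu> = lookup (E i) \<mu>"
        proof (cases "\<mu> \<in> monomials {..w} (d i)")
          case True
          have "lookup ?S \<mu> = (\<Sum>j\<le>m. \<Sum>l\<le>w. C j l * of_int (column \<eta> (i, \<mu>) j l))"
            by (simp add: lookup_sum lookup_const_poly_mult col[OF i])
          then show ?thesis using C[of i \<mu>] True i by (simp add: terms_def)
        next
          case False
          then show ?thesis using forms_lookup_eq_0[OF S] forms_lookup_eq_0[OF E[OF i]] by simp
        qed
      qed
      then show "\<exists>C. \<forall>i\<in>I. (\<Sum>j\<le>m. \<Sum>l\<le>w. const_poly (C j l) * (var l * H j i)) = E i" by blast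
    qed
  qed
qed

section \<open>Deforming a fat plane over formal power series\<close>

unbundle fps_syntax

lemma fps_const_sum: "fps_const (\<Sum>x\<in>A. f x) = (\<Sum>x\<in>A. fps_const (f x))"
  by (induction A rule: infinite_finite_induct) (simp_all flip: fps_const_add)

lemma fps_X_power_dvd_iff: "fps_X ^ N dvd u \<longleftrightarrow> (\<forall>k<N. u $ k = 0)" for u :: "'a::comm_ring_1 fps"
proof
  assume "fps_X ^ N dvd u"
  then show "\<forall>k<N. u $ k = 0" by (auto simp: dvd_def fps_X_power_mult_nth)
next
  assume "\<forall>k<N. u $ k = 0"
  then have "u = fps_X ^ N * fps_shift N u" by (intro fps_ext) (simp add: fps_X_power_mult_nth)
  then show "fps_X ^ N dvd u" by (metis dvd_triv_left)
qed

lemma coeff_hom_fps_const: "coeff_hom fps_const"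
  by unfold_locales (auto simp: fps_const_add fps_const_mult)

interpretation fps: coeff_hom fps_const by (rule coeff_hom_fps_const)
lemmas idh_peval = coeff_hom.peval_add[OF coeff_hom_id] coeff_hom.peval_mult[OF coeff_hom_id]
  coeff_hom.peval_sum[OF coeff_hom_id] coeff_hom.peval_uminus[OF coeff_hom_id]
  coeff_hom.peval_power[OF coeff_hom_id] coeff_hom.peval_const[OF coeff_hom_id]
  coeff_hom.peval_0[OF coeff_hom_id] peval_var[OF coeff_hom_id]
lemmas fps_peval = fps.peval_add fps.peval_mult fps.peval_sum fps.peval_power peval_var[OF coeff_hom_fps_const]

lemma dvd_mult_diff:
  fixes t :: "'a::comm_ring_1"
  assumes "t dvd x - x'" "t dvd y - y'" shows "t dvd x * y - x' * y'"
proof -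
  have "x * y - x' * y' = (x - x') * y + x' * (y - y')" by (simp add: algebra_simps)
  then show ?thesis using assms by (metis dvd_add dvd_mult dvd_mult2)
qed

lemma peval_cong_mod:
  fixes p :: "'k::field mpoly" and t :: "'a::comm_ring_1"
  assumes "p \<in> polys n" "\<And>i. i \<le> n \<Longrightarrow> t dvd a i - b i"
  shows "t dvd peval \<iota> a p - peval \<iota> b p"
proof (rule peval_rel[where R = "\<lambda>x y. t dvd x - y" and n = n])
  show "t dvd x + y - (x' + y')" if "t dvd x - x'" "t dvd y - y'" for x y x' y'
    using dvd_add[OF that] by (simp only: add_diff_add)
  show "t dvd x * y - x' * y'" if "t dvd x - x'" "t dvd y - y'" for x y x' y'
    using that by (rule dvd_mult_diff)
  show "p \<in> polys n" by fact
  show "t dvd a i - b i" if "i \<le> n" for i using that by (rule assms(2))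
qed simp_all

lemma peval_nth_0:
  fixes p :: "'k::field mpoly"
  assumes "p \<in> polys n" "\<And>i. i \<le> n \<Longrightarrow> a i $ 0 = b i"
  shows "peval fps_const a p $ 0 = value_at b p"
  by (rule peval_rel[where R = "\<lambda>x y. x $ 0 = y" and n = n]) (use assms in auto)

lemma power_add_first_order: "\<exists>q. (x + z) ^ e = x ^ e + of_nat e * x ^ (e - 1) * z + z ^ 2 * q" for x z :: "'a::comm_ring_1"
proof (induction e)
  case 0
  then show ?case by (intro exI[of _ 0]) simp
next
  case (Suc e)
  then obtain q where q: "(x + z) ^ e = x ^ e + of_nat e * x ^ (e - 1) * z + z ^ 2 * q" by blast
  show ?case
  proof (cases e)
    case 0
    then show ?thesis by (intro exI[of _ 0]) simp
  next
    case (Suc e')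
    have "(x + z) ^ Suc e = x ^ Suc e + of_nat (Suc e) * x ^ (Suc e - 1) * z + z ^ 2 * (of_nat e * x ^ (e - 1) + (x + z) * q)"
      unfolding power_Suc q by (simp add: Suc algebra_simps power2_eq_square)
    then show ?thesis by blast
  qed
qed

text \<open>
  The coefficients of a residual along a power series family are homogeneous polynomial functions of
  the point \<open>y\<close>; only this makes the linear systems of the deformation solvable simultaneously for all \<open>y\<close>.
\<close>

definition hom_family :: "nat \<Rightarrow> nat \<Rightarrow> ((nat \<Rightarrow> 'k::field) \<Rightarrow> 'k fps) \<Rightarrow> bool" where
  "hom_family w e u \<longleftrightarrow> (\<forall>k. \<exists>q\<in>forms w e. \<forall>y. u y $ k = value_at y q)"

lemma hom_family_add:
  assumes "hom_family w e u" "hom_family w e v"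
  shows "hom_family w e (\<lambda>y. u y + v y)"
  unfolding hom_family_def
proof
  fix k
  from assms obtain q q' where "q \<in> forms w e" "\<And>y. u y $ k = value_at y q"
    "q' \<in> forms w e" "\<And>y. v y $ k = value_at y q'" unfolding hom_family_def by metis
  then show "\<exists>q\<in>forms w e. \<forall>y. (u y + v y) $ k = value_at y q"
    by (intro bexI[of _ "q + q'"]) (auto simp: idh_peval forms_add)
qed

lemma hom_family_mult:
  assumes "hom_family w e u" "hom_family w e' v"
  shows "hom_family w (e + e') (\<lambda>y. u y * v y)"
  unfolding hom_family_def
proof
  fix k
  from assms obtain q q' where q: "\<And>k. q k \<in> forms w e" "\<And>k y. u y $ k = value_at y (q k)"
    "\<And>k. q' k \<in> forms w e'" "\<And>k y. v y $ k = value_at y (q' k)" unfolding hom_family_def by metis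
  show "\<exists>q\<in>forms w (e + e'). \<forall>y. (u y * v y) $ k = value_at y q"
  proof (intro bexI allI)
    show "(u y * v y) $ k = value_at y (\<Sum>i=0..k. q i * q' (k - i))" for y
      by (simp add: fps_mult_nth q idh_peval )
    show "(\<Sum>i=0..k. q i * q' (k - i)) \<in> forms w (e + e')"
      by (intro forms_sum forms_mult q)
  qed
qed

lemma hom_family_const: "hom_family w 0 (\<lambda>_. a)"
  unfolding hom_family_def
  by (intro allI bexI[of _ "const_poly (a $ _)"]) (auto simp: const_poly_in_forms idh_peval)

lemma hom_family_0: "hom_family w e (\<lambda>_. 0)"
  unfolding hom_family_def by (intro allI bexI[of _ 0]) (auto simp: forms_0 idh_peval)

lemma hom_family_cmult:
  "hom_family w e u \<Longrightarrow> hom_family w e (\<lambda>y. a * u y)"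
  using hom_family_mult[OF hom_family_const[of w a], of e u] by simp

lemma hom_family_sum:
  "(\<And>i. i \<in> A \<Longrightarrow> hom_family w e (u i)) \<Longrightarrow> hom_family w e (\<lambda>y. \<Sum>i\<in>A. u i y)"
  by (induction A rule: infinite_finite_induct) (auto simp: hom_family_0 hom_family_add)

lemma hom_family_power:
  "hom_family w e u \<Longrightarrow> hom_family w (e * k) (\<lambda>y. u y ^ k)"
  by (induction k) (use hom_family_const[of w 1] in \<open>auto simp: hom_family_mult\<close>)

lemma hom_family_prod:
  "(\<And>i. i \<in> A \<Longrightarrow> hom_family w (e i) (u i)) \<Longrightarrow> finite A \<Longrightarrow> hom_family w (\<Sum>i\<in>A. e i) (\<lambda>y. \<Prod>i\<in>A. u i y)"
  by (rotate_tac, induction A rule: finite_induct) (use hom_family_const[of w 1] in \<open>auto simp: hom_family_mult\<close>)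

lemma hom_family_coord:
  assumes "l \<le> w" shows "hom_family w 1 (\<lambda>y. fps_const (y l))"
  unfolding hom_family_def
proof
  fix k :: nat
  show "\<exists>q\<in>forms w 1. \<forall>y. fps_const (y l) $ k = value_at y q"
  proof (cases "k = 0")
    case True
    then show ?thesis using assms by (intro bexI[of _ "var l"]) (auto simp: idh_peval)
  next
    case False
    then show ?thesis by (intro bexI[of _ 0]) (auto simp: forms_0 idh_peval)
  qed
qed

lemma hom_family_peval:
  assumes "p \<in> forms n e" "\<And>c. c \<le> n \<Longrightarrow> hom_family w 1 (\<lambda>y. a y c)"
  shows "hom_family w e (\<lambda>y. peval fps_const (a y) p)"
  unfolding peval_def power_product_def
proof (intro hom_family_sum hom_family_cmult)
  fix m assume m: "m \<in> keys p"
  have "hom_family w (\<Sum>i\<in>keys m. 1 * lookup m i)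
      (\<lambda>y. \<Prod>i\<in>keys m. a y i ^ lookup m i)"
    by (intro hom_family_prod hom_family_power assms)
      (use assms(1) m in \<open>auto simp: forms_def polys_def\<close>)
  moreover have "(\<Sum>i\<in>keys m. 1 * lookup m i) = e"
    using assms(1) m by (auto simp: forms_def mdeg_def)
  ultimately show "hom_family w e (\<lambda>y. \<Prod>i\<in>keys m. a y i ^ lookup m i)" by simp
qed

text \<open>
  The vectors \<open>graph_vector w b l\<close>, for \<open>l \<le> w\<close>, span the graph of a linear map close to the coordinate plane
  \<open>x\<^sub>c = 0\<close>, \<open>c > w\<close>.  The parameter \<open>b j l\<close> moves the coordinate \<open>w + j\<close> of the vector \<open>l\<close>; those with \<open>j = 0\<close> move
  the hyperplane \<open>x\<^sub>w = 0\<close> within the plane.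
\<close>

definition graph_vector :: "nat \<Rightarrow> (nat \<Rightarrow> nat \<Rightarrow> 'k::field fps) \<Rightarrow> nat \<Rightarrow> nat \<Rightarrow> 'k fps" where
  "graph_vector w b l c = of_bool (c = l) + (if w \<le> c then b (c - w) l else 0)"

definition graph_point :: "nat \<Rightarrow> (nat \<Rightarrow> nat \<Rightarrow> 'k::field fps) \<Rightarrow> (nat \<Rightarrow> 'k) \<Rightarrow> nat \<Rightarrow> 'k fps" where
  "graph_point w b y c = (\<Sum>l\<le>w. fps_const (y l) * graph_vector w b l c)"

lemma hom_family_graph_point: "hom_family w 1 (\<lambda>y. graph_point w b y c)"
  unfolding graph_point_def mult.commute[of "fps_const _"]
  by (intro hom_family_sum hom_family_cmult hom_family_coord) simp

lemma graph_point_eq: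
  "graph_point w b y c = (if c \<le> w then fps_const (y c) else 0) + (if w \<le> c then \<Sum>l\<le>w. fps_const (y l) * b (c - w) l else 0)"
proof -
  have "graph_point w b y c = (\<Sum>l\<le>w. if l = c then fps_const (y l) else 0) + (\<Sum>l\<le>w. fps_const (y l) * (if w \<le> c then b (c - w) l else 0))"
    unfolding graph_point_def graph_vector_def sum.distrib[symmetric] by (rule sum.cong) (auto simp: distrib_left)
  then show ?thesis by (simp add: sum.delta)
qed

text \<open>
  For suitable forms \<open>g i\<close>, a fat plane contained in all \<open>g i = 0\<close> deforms along the pencil
  \<open>(1 - X) * g i + X * f i\<close> over formal power series in \<open>X\<close>, by Newton's method.  With
  \<open>g i = [i = i0] * x\<^sub>w ^ d i0 + (\<Sum>j=1..m. x\<^bsub>w + j\<^esub> * H j i)\<close> and \<open>H\<close> from \<open>general_forms\<close>, the coordinate plane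
  solves the problem at \<open>X = 0\<close>.  The first-order change of \<open>g i\<close> under a change \<open>\<delta>\<close> of the parameters is
  \<open>\<Sum>j. \<delta> j * H j i\<close>, up to the factor \<open>d i0\<close> in the term \<open>j = 0\<close>, so every homogeneous error can be removed.
\<close>

theorem deformation:
  fixes f :: "'i \<Rightarrow> 'k::field_char_0 mpoly" and d :: "'i \<Rightarrow> nat"
  assumes I: "finite I" "i0 \<in> I" "\<And>i. i \<in> I \<Longrightarrow> 0 < d i" "3 \<le> d i0"
    and bound: "(\<Sum>i\<in>I. (w + d i) choose d i) \<le> (w + 1) * (m + 1)"
    and f: "\<And>i. i \<in> I \<Longrightarrow> f i \<in> forms (w + m) (d i)"
  obtains g b where "\<And>i. i \<in> I \<Longrightarrow> g i \<in> forms (w + m) (d i)" "\<And>j l. b j l $ 0 = 0"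
    "\<And>i y. i \<in> I \<Longrightarrow> (1 - fps_X) * peval fps_const (graph_point w b y) (g i) + fps_X * peval fps_const (graph_point w b y) (f i)
       = (if i = i0 then fps_const (y w) ^ d i0 else 0)"
proof -
  obtain H :: "nat \<Rightarrow> 'i \<Rightarrow> 'k mpoly" where
    H0': "\<forall>i\<in>I. H 0 i = (if i = i0 then var w ^ (d i0 - 1) else 0)" and
    H': "\<forall>j. \<forall>i\<in>I. H j i \<in> forms w (d i - 1)" and
    surj: "\<forall>E. (\<forall>i\<in>I. E i \<in> forms w (d i)) \<longrightarrow>
       (\<exists>C. \<forall>i\<in>I. (\<Sum>j\<le>m. \<Sum>l\<le>w. const_poly (C j l) * (var l * H j i)) = E i)"
    by (rule general_forms[OF I bound])
  have H0: "H 0 i = (if i = i0 then var w ^ (d i0 - 1) else 0)" if "i \<in> I" for i using H0' that by blast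
  have H: "H j i \<in> forms w (d i - 1)" if "i \<in> I" for i j using H' that by blast
  define g where "g i = (if i = i0 then var w ^ d i0 else 0) + (\<Sum>j=1..m. var (w + j) * H j i)" for i
  have forms_mono: "p \<in> forms (w + m) e" if "p \<in> forms w e" for p :: "'k mpoly" and e
    using that by (fastforce simp: forms_def polys_def)
  have var_power: "var w ^ e \<in> forms (w + m) e" for e
  proof (induction e)
    case 0
    then show ?case by (simp add: forms_def polys_def mdeg_def)
  next
    case (Suc e)
    then show ?case using forms_mult[OF var_in_forms[of w "w + m"] Suc] by simp
  qed
  have g: "g i \<in> forms (w + m) (d i)" if i: "i \<in> I" for i
  proof -
    have "var (w + j) * H j i \<in> forms (w + m) (d i)" if "j \<in> {1..m}" for j
      using forms_mult[OF var_in_forms[of "w + j" "w + m"] forms_mono[OF H[OF i]], of j] that I(3)[OF i] by simp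
    then show ?thesis unfolding g_def by (intro forms_add forms_sum) (auto simp: var_power forms_0)
  qed
  define res where "res i b y = (1 - fps_X) * peval fps_const (graph_point w b y) (g i) +
      fps_X * peval fps_const (graph_point w b y) (f i) - (if i = i0 then fps_const (y w) ^ d i0 else 0)" for i b y
  have res_hom: "hom_family w (d i) (res i b)" if i: "i \<in> I" for i b
  proof -
    have "hom_family w (d i) (\<lambda>y. (1 - fps_X) * peval fps_const (graph_point w b y) (g i) +
      fps_X * peval fps_const (graph_point w b y) (f i) + (- 1) * (if i = i0 then fps_const (y w) ^ d i0 else 0))"
    proof (intro hom_family_add hom_family_cmult)
      show "hom_family w (d i) (\<lambda>y. if i = i0 then fps_const (y w) ^ d i0 else 0)"
      proof (cases "i = i0")
        case True
        then show ?thesis using hom_family_power[OF hom_family_coord[OF order_refl], of w "d i0"]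
          by (simp only: if_True mult_1 refl)
      next
        case False
        then show ?thesis by (simp only: if_False hom_family_0)
      qed
      show "hom_family w (d i) (\<lambda>y. peval fps_const (graph_point w b y) (g i))"
        by (rule hom_family_peval[OF g[OF i] hom_family_graph_point])
      show "hom_family w (d i) (\<lambda>y. peval fps_const (graph_point w b y) (f i))"
        by (rule hom_family_peval[OF f[OF i] hom_family_graph_point])
    qed
    then show ?thesis by (simp add: res_def[abs_def])
  qed
  have res_cong: "fps_X ^ N dvd res i b y - res i b' y" if i: "i \<in> I" and b: "\<And>j l. fps_X ^ N dvd b j l - b' j l" for N i b b' y
  proof -
    have "fps_X ^ N dvd graph_point w b y c - graph_point w b' y c" for c
      unfolding graph_point_eq
      by (auto simp: sum_subtractf[symmetric] right_diff_distrib[symmetric] intro!: dvd_sum dvd_mult b)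
    then have dvd: "fps_X ^ N dvd peval fps_const (graph_point w b y) p - peval fps_const (graph_point w b' y) p" if "p \<in> forms (w + m) e" for p e
      using peval_cong_mod[OF forms_imp_polys[OF that]] by blast
    have "res i b y - res i b' y = (1 - fps_X) * (peval fps_const (graph_point w b y) (g i) - peval fps_const (graph_point w b' y) (g i)) +
        fps_X * (peval fps_const (graph_point w b y) (f i) - peval fps_const (graph_point w b' y) (f i))"
      by (simp add: res_def algebra_simps)
    also have "fps_X ^ N dvd \<dots>"
      by (intro dvd_add dvd_mult dvd[OF g[OF i]] dvd[OF f[OF i]])
    finally show ?thesis .
  qed
  define good where "good N b \<longleftrightarrow> (\<forall>j l. b j l $ 0 = 0) \<and> (\<forall>i\<in>I. \<forall>y. fps_X ^ Suc N dvd res i b y)" for N b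
  define step where "step N b b' \<longleftrightarrow> (\<forall>j l. fps_X ^ Suc N dvd b' j l - b j l)" for N and b b' :: "nat \<Rightarrow> nat \<Rightarrow> 'k fps"
  have start: "good 0 (\<lambda>_ _. 0)"
  proof -
    have "res i (\<lambda>_ _. 0) y $ 0 = 0" if i: "i \<in> I" for i y
    proof -
      have "peval fps_const (graph_point w (\<lambda>_ _. 0) y) (g i) = (if i = i0 then fps_const (y w) ^ d i0 else 0)"
        using coeff_hom_fps_const
        by (auto simp: g_def fps_peval graph_point_eq intro!: sum.neutral)
      then show ?thesis by (simp add: res_def)
    qed
    then show ?thesis using fps_X_power_dvd_iff[of "Suc 0"] by (auto simp: good_def)
  qed
  have next_step: "\<exists>b'. good (Suc N) b' \<and> step N b b'" if b: "good N b" for N b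
  proof -
    define M where "M = Suc N"
    have "\<forall>i\<in>I. \<exists>q. q \<in> forms w (d i) \<and> (\<forall>y. res i b y $ M = value_at y q)"
      using res_hom[of _ b] by (auto simp: hom_family_def Bex_def)
    from bchoice[OF this] obtain E where E: "\<And>i. i \<in> I \<Longrightarrow> E i \<in> forms w (d i)"
      "\<And>i y. i \<in> I \<Longrightarrow> res i b y $ M = value_at y (E i)" by blast
    have "\<forall>i\<in>I. - E i \<in> forms w (d i)"
      using E(1) by (auto simp: forms_def polys_def Poly_Mapping.keys_minus)
    with surj[THEN spec, of "\<lambda>i. - E i"] obtain C where
      C: "\<And>i. i \<in> I \<Longrightarrow> (\<Sum>j\<le>m. \<Sum>l\<le>w. const_poly (C j l) * (var l * H j i)) = - E i" by blast
    define \<delta> where "\<delta> y j = (\<Sum>l\<le>w. C j l * y l)" for y j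
    have CE: "(\<Sum>j\<le>m. \<delta> y j * value_at y (H j i)) = - (res i b y $ M)" if "i \<in> I" for i y
    proof -
      have "value_at y (\<Sum>j\<le>m. \<Sum>l\<le>w. const_poly (C j l) * (var l * H j i)) = value_at y (- E i)"
        using C[OF that] by simp
      then show ?thesis
        using that coeff_hom_id
        by (simp add: idh_peval E \<delta>_def sum_distrib_right mult.assoc)
    qed
    \<comment> \<open>The derivative of \<open>x\<^sub>w ^ d i0\<close> is \<open>d i0\<close> times \<open>H 0 i0\<close>; the factor \<open>c 0\<close> compensates for this.\<close>
    define c where "c j = (if j = 0 then inverse (of_nat (d i0)) else 1 :: 'k)" for j :: nat
    define b' where "b' j l = b j l + fps_X ^ M * fps_const (c j * C j l)" for j l
    have b'0: "b' j l $ 0 = 0" for j l using b by (simp add: b'_def M_def good_def)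
    have st: "step N b b'" by (simp add: step_def b'_def M_def)
    have "fps_X ^ Suc M dvd res i b' y" if i: "i \<in> I" for i y
    proof -
      define a where "a = graph_point w b y"
      define a' where "a' = graph_point w b' y"
      define hv where "hv j = value_at y (H j i)" for j
      have a': "a' (w + j) = a (w + j) + fps_X ^ M * fps_const (c j * \<delta> y j)" for j
      proof -
        have "fps_const (y l) * b' j l = fps_const (y l) * b j l + fps_X ^ M * fps_const (c j * (C j l * y l))" for l
          unfolding b'_def by (simp only: fps_const_mult[symmetric] distrib_left mult_ac)
        then have "(\<Sum>l\<le>w. fps_const (y l) * b' j l) = (\<Sum>l\<le>w. fps_const (y l) * b j l) + fps_X ^ M * fps_const (c j * \<delta> y j)"
          by (simp only: sum.distrib sum_distrib_left fps_const_sum \<delta>_def)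
        then show ?thesis unfolding a_def a'_def graph_point_eq by simp
      qed
      have a0: "a (w + j) $ 0 = 0" if "0 < j" for j
        using that b by (simp add: a_def graph_point_eq good_def fps_sum_nth)
      have aw: "a' c $ 0 = y c" "a c $ 0 = y c" if "c \<le> w" for c
        using that b b'0 by (auto simp: a_def a'_def graph_point_eq good_def fps_sum_nth)
      have low: "fps_X ^ M dvd a' c - a c" for c
      proof (cases "w \<le> c")
        case True then show ?thesis using a'[of "c - w"] by simp
      next
        case False then show ?thesis by (simp add: a_def a'_def graph_point_eq)
      qed
      have X1: "fps_X dvd u" if "u $ 0 = 0" for u :: "'k fps"
        using fps_X_power_dvd_iff[of 1 u] that by simp
      have SucM: "fps_X ^ Suc M dvd u * v" if "fps_X dvd u" "fps_X ^ M dvd v" for u v :: "'k fps"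
        using mult_dvd_mono[OF that] by simp
      have linear: "fps_X ^ Suc M dvd a' (w + j) * peval fps_const a' (H j i) - a (w + j) * peval fps_const a (H j i)
          - fps_X ^ M * fps_const (\<delta> y j * hv j)" if j: "j \<in> {1..m}" for j
      proof -
        let ?h' = "peval fps_const a' (H j i)" and ?h = "peval fps_const a (H j i)"
        have hp: "H j i \<in> polys w" using H[OF i] by (rule forms_imp_polys)
        have h0: "?h' $ 0 = hv j" unfolding hv_def by (rule peval_nth_0[OF hp]) (rule aw)
        have "a' (w + j) * ?h' - a (w + j) * ?h - fps_X ^ M * fps_const (\<delta> y j * hv j) =
            a (w + j) * (?h' - ?h) + (?h' - fps_const (hv j)) * (fps_X ^ M * fps_const (\<delta> y j))"
        proof -
          have *: "(x + z * D) * h' - x * h - z * (D * h0) = x * (h' - h) + (h' - h0) * (z * D)" for x z D h h' h0 :: "'k fps"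
            by (simp add: algebra_simps)
          have "a' (w + j) = a (w + j) + fps_X ^ M * fps_const (\<delta> y j)" using a'[of j] j by (simp add: c_def)
          then show ?thesis unfolding fps_const_mult[symmetric] by (simp only: *)
        qed
        also have "fps_X ^ Suc M dvd \<dots>"
          using j a0 h0 by (intro dvd_add SucM X1 peval_cong_mod[OF hp] low) auto
        finally show ?thesis .
      qed
      have power: "fps_X ^ Suc M dvd a' w ^ d i0 - a w ^ d i0 - fps_X ^ M * fps_const (\<delta> y 0 * y w ^ (d i0 - 1))"
      proof -
        let ?z = "fps_X ^ M * fps_const (c 0 * \<delta> y 0)"
        from power_add_first_order[of "a w" ?z "d i0"] obtain q where
          q: "(a w + ?z) ^ d i0 = a w ^ d i0 + of_nat (d i0) * a w ^ (d i0 - 1) * ?z + ?z ^ 2 * q" by blast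
        have dc: "of_nat (d i0) * fps_const (c 0) = (1 :: 'k fps)"
          using I(4) by (simp add: c_def fps_of_nat[symmetric])
        have *: "(n * k) * p * (x * D) + (x * (k * D)) ^ 2 * q - x * (D * v) =
            (p - v) * (x * D) + (x * (k * D) ^ 2 * q) * x" if "n * k = 1" for n k p x D q v :: "'k fps"
          using that by (simp add: algebra_simps power2_eq_square)
        have "a' w ^ d i0 - a w ^ d i0 - fps_X ^ M * fps_const (\<delta> y 0 * y w ^ (d i0 - 1)) =
            (of_nat (d i0) * fps_const (c 0)) * a w ^ (d i0 - 1) * (fps_X ^ M * fps_const (\<delta> y 0)) + ?z ^ 2 * q
              - fps_X ^ M * fps_const (\<delta> y 0 * y w ^ (d i0 - 1))"
          using a'[of 0] q by (simp add: mult_ac flip: fps_const_mult)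
        also have "\<dots> = (a w ^ (d i0 - 1) - fps_const (y w ^ (d i0 - 1))) * (fps_X ^ M * fps_const (\<delta> y 0)) +
            (fps_X ^ M * fps_const (c 0 * \<delta> y 0) ^ 2 * q) * fps_X ^ M"
          unfolding fps_const_mult[symmetric] by (rule *[OF dc])
        also have "fps_X ^ Suc M dvd \<dots>"
          by (intro dvd_add SucM X1) (auto simp: aw M_def fps_nth_power_0)
        finally show ?thesis .
      qed
      have diff_g: "fps_X ^ Suc M dvd peval fps_const a' (g i) - peval fps_const a (g i) + fps_X ^ M * fps_const (res i b y $ M)"
      proof -
        have ev: "peval fps_const u (g i) = (if i = i0 then u w ^ d i0 else 0) + (\<Sum>j=1..m. u (w + j) * peval fps_const u (H j i))" for u
          using coeff_hom_fps_const by (simp add: g_def fps_peval)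
        have "{..m} = insert 0 {1..m}" by auto
        then have "- (res i b y $ M) = \<delta> y 0 * hv 0 + (\<Sum>j=1..m. \<delta> y j * hv j)"
          using CE[OF i, of y] by (simp add: hv_def)
        then have r: "fps_X ^ M * fps_const (res i b y $ M) = - (fps_X ^ M * fps_const (\<delta> y 0 * hv 0)) - (\<Sum>j=1..m. fps_X ^ M * fps_const (\<delta> y j * hv j))"
        proof -
          have "fps_const (res i b y $ M) = fps_const (- (\<delta> y 0 * hv 0 + (\<Sum>j=1..m. \<delta> y j * hv j)))"
            using \<open>- (res i b y $ M) = _\<close> by (metis minus_minus)
          also have "\<dots> = - fps_const (\<delta> y 0 * hv 0) - (\<Sum>j=1..m. fps_const (\<delta> y j * hv j))"
            by (simp only: fps_const_neg[symmetric] fps_const_add[symmetric] fps_const_sum[symmetric] minus_add_distrib)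
              (simp add: sum_negf)
          finally show ?thesis by (simp only: right_diff_distrib sum_distrib_left mult_minus_right)
        qed
        have hv0: "hv 0 = (if i = i0 then y w ^ (d i0 - 1) else 0)"
          using H0[OF i] coeff_hom_id by (simp add: hv_def idh_peval )
        have "peval fps_const a' (g i) - peval fps_const a (g i) + fps_X ^ M * fps_const (res i b y $ M) =
            (if i = i0 then a' w ^ d i0 - a w ^ d i0 - fps_X ^ M * fps_const (\<delta> y 0 * y w ^ (d i0 - 1)) else 0) +
            (\<Sum>j=1..m. a' (w + j) * peval fps_const a' (H j i) - a (w + j) * peval fps_const a (H j i) - fps_X ^ M * fps_const (\<delta> y j * hv j))"
          unfolding ev r hv0 by (simp add: sum_subtractf)
        also have "fps_X ^ Suc M dvd \<dots>"
        proof (rule dvd_add[OF _ dvd_sum[OF linear]])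
          show "fps_X ^ Suc M dvd (if i = i0 then a' w ^ d i0 - a w ^ d i0 - fps_X ^ M * fps_const (\<delta> y 0 * y w ^ (d i0 - 1)) else 0)"
            using power by (simp only: dvd_0_right simp_thms split: if_split)
        qed
        finally show ?thesis .
      qed
      have diff_f: "fps_X ^ Suc M dvd fps_X * (peval fps_const a' (f i) - peval fps_const a (f i))"
        by (intro SucM peval_cong_mod[OF forms_imp_polys[OF f[OF i]]] low) auto
      have rest: "fps_X ^ Suc M dvd res i b y - fps_X ^ M * fps_const (res i b y $ M)"
      proof -
        have "fps_X ^ M dvd res i b y" using b i unfolding good_def M_def by blast
        then have "\<forall>k<M. res i b y $ k = 0" unfolding fps_X_power_dvd_iff .
        then show ?thesis unfolding fps_X_power_dvd_iff
          by (auto simp: fps_X_power_mult_nth less_Suc_eq)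
      qed
      have "res i b' y = (1 - fps_X) * (peval fps_const a' (g i) - peval fps_const a (g i) + fps_X ^ M * fps_const (res i b y $ M))
          + fps_X * (peval fps_const a' (f i) - peval fps_const a (f i))
          + (res i b y - fps_X ^ M * fps_const (res i b y $ M)) + fps_X * (fps_X ^ M * fps_const (res i b y $ M))"
        unfolding res_def a_def[symmetric] a'_def[symmetric] by (simp add: algebra_simps)
      also have "fps_X ^ Suc M dvd \<dots>"
        by (intro dvd_add diff_f rest dvd_mult[OF diff_g] SucM) auto
      finally show ?thesis .
    qed
    then have "good (Suc N) b'" using b'0 by (simp add: good_def M_def)
    with st show ?thesis by blast
  qed
  from dependent_nat_choice[of good step, OF exI[of _ "\<lambda>_ _. 0"]] start next_step
  obtain B where B: "\<And>N. good N (B N)" "\<And>N. step N (B N) (B (Suc N))" by metis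
  define L where "L j l = Abs_fps (\<lambda>k. B k j l $ k)" for j l
  have stable: "B (N + N') j l $ k = B N j l $ k" if "k \<le> N" for N N' k j l
  proof (induction N')
    case (Suc N')
    have "fps_X ^ Suc (N + N') dvd B (Suc (N + N')) j l - B (N + N') j l" using B(2) by (simp add: step_def)
    then have "(B (Suc (N + N')) j l - B (N + N') j l) $ k = 0" unfolding fps_X_power_dvd_iff using that by auto
    then show ?case using Suc by simp
  qed simp
  have L: "fps_X ^ Suc N dvd L j l - B N j l" for N j l
    unfolding fps_X_power_dvd_iff
    using stable[of _ _ "N - _"] by (auto simp: L_def less_Suc_eq_le) (metis le_add_diff_inverse order_refl stable)
  show ?thesis
  proof (rule that[of g L])
    show "L j l $ 0 = 0" for j l using B(1)[of 0] by (simp add: L_def good_def)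
    show "(1 - fps_X) * peval fps_const (graph_point w L y) (g i) + fps_X * peval fps_const (graph_point w L y) (f i)
       = (if i = i0 then fps_const (y w) ^ d i0 else 0)" if i: "i \<in> I" for i y
    proof -
      have "fps_X ^ Suc N dvd res i L y" for N
      proof -
        have "fps_X ^ Suc N dvd res i L y - res i (B N) y" by (rule res_cong[OF i L])
        moreover have "fps_X ^ Suc N dvd res i (B N) y" using B(1)[of N] i unfolding good_def by blast
        ultimately show ?thesis by (metis dvd_add diff_add_cancel)
      qed
      then have "res i L y = 0" unfolding fps_X_power_dvd_iff by (intro fps_ext) (metis fps_zero_nth lessI)
      then show ?thesis by (simp add: res_def)
    qed
  qed (use g in auto)
qed

section \<open>Limits of flags along a place\<close>

lemma clear_pivots:
  fixes u :: "nat \<Rightarrow> 'c \<Rightarrow> 'f::field"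
  assumes u: "\<And>a. a < N \<Longrightarrow> u a (piv a) = 1" "\<And>a b. a < N \<Longrightarrow> b < a \<Longrightarrow> u a (piv b) = 0"
  shows "\<exists>x. \<forall>b<N. v (piv b) - (\<Sum>a<N. x a * u a (piv b)) = 0"
  using u
proof (induction N)
  case (Suc N)
  then obtain x where x: "\<And>b. b < N \<Longrightarrow> v (piv b) - (\<Sum>a<N. x a * u a (piv b)) = 0" by auto
  define x' where "x' = x(N := v (piv N) - (\<Sum>a<N. x a * u a (piv N)))"
  have "(\<Sum>a<Suc N. x' a * u a c) = (\<Sum>a<N. x a * u a c) + x' N * u N c" for c
    by (simp add: x'_def)
  then have "v (piv b) - (\<Sum>a<Suc N. x' a * u a (piv b)) = 0" if "b < Suc N" for b
    using x[of b] Suc.prems(1)[of N] Suc.prems(2)[of N b] that by (cases "b = N") (auto simp: x'_def)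
  then show ?case by blast
qed simp

locale place =
  fixes G :: "('f::field \<times> 'k::field) set"
  assumes hom: "partial_hom G" and valuation: "x \<in> Domain G \<or> inverse x \<in> Domain G"
begin

lemma Domain_mult: "x \<in> Domain G \<Longrightarrow> y \<in> Domain G \<Longrightarrow> x * y \<in> Domain G"
  using partial_homD(4)[OF hom] by blast

lemma Domain_0: "0 \<in> Domain G" and Domain_1: "1 \<in> Domain G"
  using partial_homD(1,2)[OF hom] by blast+

lemma dominant_entry:
  assumes "finite C" "c0 \<in> C" "v c0 \<noteq> 0"
  shows "\<exists>c\<in>C. v c \<noteq> 0 \<and> (\<forall>c'\<in>C. v c' / v c \<in> Domain G)"
  using assms
proof (induction C arbitrary: c0 rule: finite_induct)
  case empty
  then show ?case by blast
next
  case (insert x C)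
  show ?case
  proof (cases "\<exists>c\<in>C. v c \<noteq> 0")
    case False
    then show ?thesis using insert.prems by (intro bexI[of _ x]) (auto simp: Domain_0 Domain_1)
  next
    case True
    then obtain c where c: "c \<in> C" "v c \<noteq> 0" "\<And>c'. c' \<in> C \<Longrightarrow> v c' / v c \<in> Domain G" using insert.IH by blast
    show ?thesis
    proof (cases "v x / v c \<in> Domain G")
      case True
      then show ?thesis using c by (intro bexI[of _ c]) auto
    next
      case False
      then have "v x \<noteq> 0" using Domain_0 by auto
      have cx: "v c / v x \<in> Domain G" using False valuation[of "v x / v c"] by (simp add: inverse_eq_divide)
      have "v c' / v x \<in> Domain G" if "c' \<in> C" for c'
      proof -
        have "v c' / v x = (v c' / v c) * (v c / v x)" using c(2) by simp
        then show ?thesis using Domain_mult[OF c(3)[OF that] cx] by (simp only:)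
      qed
      then have "\<forall>c'\<in>insert x C. v c' / v x \<in> Domain G" using \<open>v x \<noteq> 0\<close> Domain_1 by simp
      then show ?thesis using \<open>v x \<noteq> 0\<close> by blast
    qed
  qed
qed

text \<open>
  Gaussian elimination over the valuation ring: after subtracting multiples of the earlier vectors to clear their
  pivots, divide by an entry that divides all the others.  The pivots keep the vectors linearly independent
  after reduction to the residue field, and the transition matrix \<open>T\<close> is triangular, so the whole flag is preserved.
\<close>

lemma echelon_form:
  fixes \<phi> :: "nat \<Rightarrow> nat \<Rightarrow> 'f"
  assumes indep: "\<And>a y. a < N \<Longrightarrow> \<exists>c\<le>n. \<phi> a c \<noteq> (\<Sum>l<a. y l * \<phi> l c)"
  shows "\<exists>u T piv. \<forall>a<N. piv a \<le> n \<and> u a (piv a) = 1 \<and> (\<forall>b<a. u a (piv b) = 0) \<and>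
    (\<forall>c\<le>n. u a c \<in> Domain G) \<and> (\<forall>c. u a c = (\<Sum>l\<le>a. T a l * \<phi> l c))"
  using assms
proof (induction N)
  case (Suc N)
  have "\<exists>u T piv. \<forall>a<N. piv a \<le> n \<and> u a (piv a) = 1 \<and> (\<forall>b<a. u a (piv b) = 0) \<and>
    (\<forall>c\<le>n. u a c \<in> Domain G) \<and> (\<forall>c. u a c = (\<Sum>l\<le>a. T a l * \<phi> l c))"
    by (rule Suc.IH) (rule Suc.prems, rule less_SucI)
  then obtain u T piv where *: "\<forall>a<N. piv a \<le> n \<and> u a (piv a) = 1 \<and> (\<forall>b<a. u a (piv b) = 0) \<and>
    (\<forall>c\<le>n. u a c \<in> Domain G) \<and> (\<forall>c. u a c = (\<Sum>l\<le>a. T a l * \<phi> l c))"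
    by blast
  have IH: "\<And>a. a < N \<Longrightarrow> piv a \<le> n" "\<And>a. a < N \<Longrightarrow> u a (piv a) = 1"
    "\<And>a b. a < N \<Longrightarrow> b < a \<Longrightarrow> u a (piv b) = 0" "\<And>a c. a < N \<Longrightarrow> c \<le> n \<Longrightarrow> u a c \<in> Domain G"
    "\<And>a c. a < N \<Longrightarrow> u a c = (\<Sum>l\<le>a. T a l * \<phi> l c)" using * by blast+
  from clear_pivots[of N u piv "\<phi> N"] IH(2,3) have "\<exists>x. \<forall>b<N. \<phi> N (piv b) - (\<Sum>a<N. x a * u a (piv b)) = 0" by blast
  then obtain x where x: "\<And>b. b < N \<Longrightarrow> \<phi> N (piv b) - (\<Sum>a<N. x a * u a (piv b)) = 0" by blast
  define v where "v c = \<phi> N c - (\<Sum>a<N. x a * u a c)" for c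
  define y where "y l = (\<Sum>a<N. if l \<le> a then x a * T a l else 0)" for l
  have y: "(\<Sum>a<N. x a * u a c) = (\<Sum>l<N. y l * \<phi> l c)" for c
  proof -
    have "(\<Sum>a<N. x a * u a c) = (\<Sum>a<N. \<Sum>l<N. (if l \<le> a then x a * T a l else 0) * \<phi> l c)"
    proof (rule sum.cong[OF refl])
      fix a assume "a \<in> {..<N}"
      then have a: "a < N" by simp
      have "x a * u a c = (\<Sum>l\<le>a. x a * T a l * \<phi> l c)" by (simp add: IH(5)[OF a] sum_distrib_left mult.assoc)
      also have "\<dots> = (\<Sum>l<N. (if l \<le> a then x a * T a l else 0) * \<phi> l c)"
        by (rule sum.mono_neutral_cong_left) (use a in auto)
      finally show "x a * u a c = (\<Sum>l<N. (if l \<le> a then x a * T a l else 0) * \<phi> l c)" .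
    qed
    also have "\<dots> = (\<Sum>l<N. y l * \<phi> l c)" by (subst sum.swap) (simp add: y_def sum_distrib_right)
    finally show ?thesis .
  qed
  obtain c0 where "c0 \<le> n" "v c0 \<noteq> 0" using Suc.prems[of N y] by (auto simp: v_def y)
  then obtain p where p: "p \<le> n" "v p \<noteq> 0" "\<And>c. c \<le> n \<Longrightarrow> v c / v p \<in> Domain G"
    using dominant_entry[of "{..n}" c0 v] by auto
  define u' where "u' = u(N := \<lambda>c. v c / v p)"
  define T' where "T' = T(N := \<lambda>l. (if l = N then 1 else - y l) / v p)"
  define piv' where "piv' = piv(N := p)"
  have V: "v c / v p = (\<Sum>l\<le>N. T' N l * \<phi> l c)" for c
  proof -
    have "(\<Sum>l<N. T' N l * \<phi> l c) = (\<Sum>l<N. - (y l * \<phi> l c) / v p)"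
      by (rule sum.cong) (auto simp: T'_def)
    also have "\<dots> = - (\<Sum>l<N. y l * \<phi> l c) / v p" by (simp add: sum_negf sum_divide_distrib)
    finally have "(\<Sum>l<N. T' N l * \<phi> l c) = - (\<Sum>l<N. y l * \<phi> l c) / v p" .
    moreover have "(\<Sum>l\<le>N. T' N l * \<phi> l c) = (\<Sum>l<N. T' N l * \<phi> l c) + T' N N * \<phi> N c"
      by (simp add: lessThan_Suc_atMost[symmetric])
    ultimately show ?thesis by (simp add: T'_def v_def y diff_divide_distrib)
  qed
  have zero: "v (piv b) = 0" if "b < N" for b using x[OF that] by (simp add: v_def)
  show ?case
  proof (rule exI[of _ u'], rule exI[of _ T'], rule exI[of _ piv'], intro allI impI)
    fix a assume "a < Suc N"
    then consider "a = N" | "a < N" by linarith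
    then show "piv' a \<le> n \<and> u' a (piv' a) = 1 \<and> (\<forall>b<a. u' a (piv' b) = 0) \<and>
      (\<forall>c\<le>n. u' a c \<in> Domain G) \<and> (\<forall>c. u' a c = (\<Sum>l\<le>a. T' a l * \<phi> l c))"
    proof cases
      case 1
      show ?thesis unfolding 1
      proof (intro conjI allI impI)
        show "piv' N \<le> n" "u' N (piv' N) = 1" using p by (simp_all add: u'_def piv'_def)
        show "u' N (piv' b) = 0" if "b < N" for b using zero[OF that] that by (simp add: u'_def piv'_def)
        show "u' N c \<in> Domain G" if "c \<le> n" for c using p(3)[OF that] by (simp add: u'_def)
        show "u' N c = (\<Sum>l\<le>N. T' N l * \<phi> l c)" for c using V[of c] by (simp add: u'_def)
      qed
    next
      case 2
      then have eqs: "u' a = u a" "T' a = T a" by (simp_all add: u'_def T'_def)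
      have piv: "piv' b = piv b" if "b \<le> a" for b using that 2 by (simp add: piv'_def)
      show ?thesis unfolding eqs piv[OF order_refl]
      proof (intro conjI allI impI)
        show "u a (piv' b) = 0" if "b < a" for b using IH(3)[OF 2 that] piv[of b] that by (simp only: less_imp_le)
      qed (fact IH(1)[OF 2] IH(2)[OF 2] IH(4)[OF 2] IH(5)[OF 2])+
    qed
  qed
qed simp

end

lemma partial_hom_polys:
  defines "G0 \<equiv> {(fps_to_fls (fps_of_poly Q), poly Q 1) | Q :: 'k::field poly. True}"
  shows "partial_hom G0"
proof (rule partial_homI)
  have *: "(u, a) \<in> G0 \<longleftrightarrow> (\<exists>Q. u = fps_to_fls (fps_of_poly Q) \<and> a = poly Q 1)" for u a by (auto simp: G0_def)
  show "(0, 0) \<in> G0" unfolding * by (intro exI[of _ 0]) simp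
  show "(1, 1) \<in> G0" unfolding * by (intro exI[of _ 1]) simp
  fix x a y b assume "(x, a) \<in> G0" "(y, b) \<in> G0"
  then obtain P Q where "x = fps_to_fls (fps_of_poly P)" "a = poly P 1" "y = fps_to_fls (fps_of_poly Q)" "b = poly Q 1"
    unfolding * by blast
  then show "(x + y, a + b) \<in> G0" "(x * y, a * b) \<in> G0"
    unfolding * by (auto intro: exI[of _ "P + Q"] exI[of _ "P * Q"] simp: fps_of_poly_add fps_of_poly_mult fls_times_fps_to_fls)
next
  fix x a assume "(x, a) \<in> G0"
  then obtain Q where "x = fps_to_fls (fps_of_poly Q)" "a = poly Q 1" by (auto simp: G0_def)
  then show "(- x, - a) \<in> G0" unfolding G0_def mem_Collect_eq by (intro exI[of _ "- Q"]) (simp add: fps_of_poly_uminus)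
next
  fix a assume "(0, a) \<in> G0"
  then show "a = 0" by (auto simp: G0_def)
qed

lemma coeff_hom_fls_const: "coeff_hom fls_const"
  by unfold_locales (auto simp: fls_plus_const)

text \<open>Polynomials can be evaluated at \<open>X = 1\<close>, unlike power series; the place extends this evaluation.\<close>

lemma fls_place:
  obtains G :: "('k::alg_closed_field fls \<times> 'k) set" where "place G" "\<And>c. (fls_const c, c) \<in> G" "(fps_to_fls fps_X, 1) \<in> G"
proof -
  let ?G0 = "{(fps_to_fls (fps_of_poly Q), poly Q 1) | Q :: 'k poly. True}"
  have c: "(fls_const c, c) \<in> ?G0" for c
    by (auto simp: fps_of_poly_const intro!: exI[of _ "[:c:]"])
  have X: "(fps_to_fls fps_X, 1) \<in> ?G0"
    by (auto intro!: exI[of _ "[:0, 1:]"])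
  have surj: "\<exists>x. (x, a) \<in> ?G0" for a using c by blast
  obtain G where G: "?G0 \<subseteq> G" "partial_hom G" "\<forall>x. x \<in> Domain G \<or> inverse x \<in> Domain G"
    by (rule place_extension[OF partial_hom_polys surj])
  show ?thesis
  proof (rule that[of G])
    show "place G" by unfold_locales (use G in blast)+
  qed (use G(1) c X in blast)+
qed

text \<open>
  The solution over power series is transported from \<open>X = 0\<close> to \<open>X = 1\<close>, where the pencil is \<open>f i\<close>.  The
  equations hold at points with coordinates in \<open>'k\<close>, therefore identically; in an echelon basis of the flag, whose entries
  are in the valuation ring, they have the same form, because the base change is triangular; and then they can be
  specialised by the place.  The result is a flag over \<open>'k\<close> with a basis \<open>u\<close> in echelon form.
\<close>

theorem limit_of_deformation:
  fixes f g :: "'i \<Rightarrow> 'k::{alg_closed_field, field_char_0} mpoly" and d :: "'i \<Rightarrow> nat"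
  assumes g: "\<And>i. i \<in> I \<Longrightarrow> g i \<in> polys (w + m)" and f: "\<And>i. i \<in> I \<Longrightarrow> f i \<in> polys (w + m)"
    and b0: "\<And>j l. b j l $ 0 = 0" and i0: "i0 \<in> I"
    and eq: "\<And>i y. i \<in> I \<Longrightarrow> (1 - fps_X) * peval fps_const (graph_point w b y) (g i) + fps_X * peval fps_const (graph_point w b y) (f i)
       = (if i = i0 then fps_const (y w) ^ d i0 else 0)"
  obtains u piv \<gamma> where "\<And>a. a \<le> w \<Longrightarrow> piv a \<le> w + m" "\<And>a. a \<le> w \<Longrightarrow> u a (piv a) = 1"
    "\<And>a b. a \<le> w \<Longrightarrow> b < a \<Longrightarrow> u a (piv b) = 0"
    "\<And>i z. i \<in> I \<Longrightarrow> value_at (\<lambda>c. \<Sum>a\<le>w. z a * u a c) (f i) = (if i = i0 then \<gamma> * z w ^ d i0 else 0)"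
proof -
  obtain G :: "('k fls \<times> 'k) set" where pl: "place G" and Gc: "\<And>c. (fls_const c, c) \<in> G" and GX: "(fps_to_fls fps_X, 1) \<in> G"
    by (rule fls_place) blast
  interpret place G by fact
  define \<phi> where "\<phi> l c = fps_to_fls (graph_vector w b l c)" for l c
  define s where "s = fps_to_fls (fps_X :: 'k fps)"
  define pt where "pt y c = (\<Sum>l\<le>w. y l * \<phi> l c)" for y c
  define sub where "sub p = peval (\<lambda>c. const_poly (fls_const c)) (\<lambda>c. \<Sum>l\<le>w. const_poly (\<phi> l c) * var l) p" for p :: "'k mpoly"
  have sub: "value_at y (sub p) = peval fls_const (pt y) p" if "p \<in> polys n" for p y n
    unfolding sub_def pt_def peval_compose[OF coeff_hom_id that] by (simp add: idh_peval mult.commute)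
  \<comment> \<open>The difference of the two sides is a polynomial in \<open>y\<close> that vanishes on the grid of constants.\<close>
  have over_F: "(1 - s) * peval fls_const (pt y) (g i) + s * peval fls_const (pt y) (f i) = (if i = i0 then y w ^ d i0 else 0)"
    if i: "i \<in> I" for i y
  proof -
    define q where "q = const_poly (1 - s) * sub (g i) + const_poly s * sub (f i) + const_poly (- 1) * (if i = i0 then var w ^ d i0 else 0)"
    have q: "value_at y q = (1 - s) * peval fls_const (pt y) (g i) + s * peval fls_const (pt y) (f i) - (if i = i0 then y w ^ d i0 else 0)" for y
      unfolding q_def by (simp add: idh_peval sub[OF g[OF i]] sub[OF f[OF i]])
    have "q = 0"
    proof (rule peval_grid_imp_0)
      have "inj (fls_const :: 'k \<Rightarrow> 'k fls)" by (rule injI) (metis fls_const_nth)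
      then show "infinite (range (fls_const :: 'k \<Rightarrow> 'k fls))"
        by (simp add: finite_image_iff infinite_UNIV_char_0)
      fix y :: "nat \<Rightarrow> 'k fls" assume "\<And>i. y i \<in> range fls_const"
      then have "\<forall>i. \<exists>x. y i = fls_const x" by blast
      from choice[OF this] obtain y0 where y0: "y = (\<lambda>i. fls_const (y0 i))" by blast
      have pt: "pt y c = fps_to_fls (graph_point w b y0 c)" for c
      proof -
        have "fps_to_fls (\<Sum>l\<in>A. h l) = (\<Sum>l\<in>A. fps_to_fls (h l))" for A :: "nat set" and h :: "nat \<Rightarrow> 'k fps"
          by (induction A rule: infinite_finite_induct) auto
        then show ?thesis by (simp add: pt_def graph_point_def y0 \<phi>_def fls_times_fps_to_fls)
      qed
      have ev: "peval fls_const (pt y) p = fps_to_fls (peval fps_const (graph_point w b y0) p)" if "p \<in> polys n" for p n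
        by (rule peval_rel[where R = "\<lambda>x x'. x = fps_to_fls x'" and n = n])
          (use that in \<open>auto simp: pt fls_times_fps_to_fls\<close>)
      have "value_at y q = fps_to_fls ((1 - fps_X) * peval fps_const (graph_point w b y0) (g i) + fps_X * peval fps_const (graph_point w b y0) (f i)
         - (if i = i0 then fps_const (y0 w) ^ d i0 else 0))"
        unfolding q ev[OF g[OF i]] ev[OF f[OF i]]
        by (simp add: s_def y0 fls_times_fps_to_fls fps_to_fls_power del: fps_const_power)
      then show "value_at y q = 0" by (simp add: eq[OF i])
    qed
    then have "value_at y q = 0" by (simp add: idh_peval)
    then show ?thesis unfolding q by simp
  qed
  have graph_low: "\<phi> l c = (if c = l then 1 else 0)" if "c < w" for l c
    using that by (simp add: \<phi>_def graph_vector_def)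
  have indep: "\<exists>c\<le>w + m. \<phi> a c \<noteq> (\<Sum>l<a. y l * \<phi> l c)" if "a < Suc w" for a y
  proof (rule ccontr)
    assume "\<not> ?thesis"
    then have comb: "\<And>c. c \<le> w + m \<Longrightarrow> \<phi> a c = (\<Sum>l<a. y l * \<phi> l c)" by blast
    show False
    proof (cases "a < w")
      case True
      then have "(\<Sum>l<a. y l * \<phi> l a) = 0" by (intro sum.neutral) (auto simp: graph_low)
      then show False using comb[of a] True by (simp add: graph_low)
    next
      case False
      then have a: "a = w" using that by simp
      have "y l = 0" if l: "l < w" for l
      proof -
        have "\<phi> w l = (\<Sum>l'<w. y l' * \<phi> l' l)" using comb[of l] l a by simp
        also have "\<dots> = (\<Sum>l'<w. if l' = l then y l' else 0)"
          by (rule sum.cong) (use l in \<open>auto simp: graph_low\<close>)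
        finally show ?thesis using l by (simp add: graph_low)
      qed
      then have "\<phi> w w = 0" using comb[of w] a by simp
      then have "graph_vector w b w w $ 0 = 0" by (simp add: \<phi>_def)
      then show False using b0 by (simp add: graph_vector_def)
    qed
  qed
  from echelon_form[of "Suc w" "w + m" \<phi>, OF indep] obtain U T piv where
    echelon: "\<forall>a<Suc w. piv a \<le> w + m \<and> U a (piv a) = 1 \<and> (\<forall>b<a. U a (piv b) = 0) \<and>
      (\<forall>c\<le>w + m. U a c \<in> Domain G) \<and> (\<forall>c. U a c = (\<Sum>l\<le>a. T a l * \<phi> l c))"
    by blast
  have U: "piv a \<le> w + m" "U a (piv a) = 1" "b < a \<Longrightarrow> U a (piv b) = 0"
    "c \<le> w + m \<Longrightarrow> U a c \<in> Domain G" "U a c = (\<Sum>l\<le>a. T a l * \<phi> l c)" if "a \<le> w" for a b c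
    using echelon[THEN spec[of _ a], THEN mp, OF le_imp_less_Suc[OF that]] by blast+
  define u where "u a c = (SOME x. (U a c, x) \<in> G)" for a c
  have u: "(U a c, u a c) \<in> G" if "a \<le> w" "c \<le> w + m" for a c
    using U(4)[OF that] unfolding u_def by (metis Domain.cases someI)
  define pz where "pz z c = (\<Sum>a\<le>w. fls_const (z a) * U a c)" for z c
  define pu where "pu z c = (\<Sum>a\<le>w. z a * u a c)" for z c
  have pz_pt: "pz z = pt (\<lambda>l. \<Sum>a\<le>w. if l \<le> a then fls_const (z a) * T a l else 0)" for z
  proof
    fix c
    have "pz z c = (\<Sum>a\<le>w. \<Sum>l\<le>w. (if l \<le> a then fls_const (z a) * T a l else 0) * \<phi> l c)"
      unfolding pz_def
    proof (rule sum.cong[OF refl])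
      fix a assume "a \<in> {..w}"
      then have a: "a \<le> w" by simp
      have "fls_const (z a) * U a c = (\<Sum>l\<le>a. fls_const (z a) * T a l * \<phi> l c)"
        by (simp add: U(5)[OF a] sum_distrib_left mult.assoc)
      also have "\<dots> = (\<Sum>l\<le>w. (if l \<le> a then fls_const (z a) * T a l else 0) * \<phi> l c)"
        by (rule sum.mono_neutral_cong_left) (use a in auto)
      finally show "fls_const (z a) * U a c = (\<Sum>l\<le>w. (if l \<le> a then fls_const (z a) * T a l else 0) * \<phi> l c)" .
    qed
    then show "pz z c = pt (\<lambda>l. \<Sum>a\<le>w. if l \<le> a then fls_const (z a) * T a l else 0) c"
      unfolding pt_def by (subst (asm) sum.swap) (simp add: sum_distrib_right)
  qed
  have last: "(\<Sum>a\<le>w. if w \<le> a then fls_const (z a) * T a w else 0) = fls_const (z w) * T w w" for z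
  proof -
    have "(\<Sum>a\<le>w. if w \<le> a then fls_const (z a) * T a w else 0) = (\<Sum>a\<le>w. if a = w then fls_const (z a) * T a w else 0)"
      by (rule sum.cong) auto
    then show ?thesis by simp
  qed
  have in_G: "(if i = i0 then (fls_const (z w) * T w w) ^ d i0 else 0, value_at (pu z) (f i)) \<in> G" if i: "i \<in> I" for i z
  proof -
    have ev: "(peval fls_const (pz z) p, value_at (pu z) p) \<in> G" if "p \<in> polys (w + m)" for p
    proof (rule peval_rel[where R = "\<lambda>x y. (x, y) \<in> G" and n = "w + m"])
      show "(pz z c, pu z c) \<in> G" if "c \<le> w + m" for c
        unfolding pz_def pu_def by (intro partial_hom_sum[OF hom] partial_homD(4)[OF hom] Gc u) (use that in auto)
    qed (use partial_homD[OF hom] Gc that in auto)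
    have "((1 - s) * peval fls_const (pz z) (g i) + s * peval fls_const (pz z) (f i),
        (1 - 1) * value_at (pu z) (g i) + 1 * value_at (pu z) (f i)) \<in> G"
      by (intro partial_homD(3,4)[OF hom] partial_hom_diff[OF hom] partial_homD(2)[OF hom] ev g f i GX[folded s_def])
    then show ?thesis unfolding pz_pt over_F[OF i] last by simp
  qed
  define \<gamma> where "\<gamma> = value_at (pu (\<lambda>_. 1)) (f i0)"
  have \<gamma>: "((T w w) ^ d i0, \<gamma>) \<in> G"
    using in_G[OF i0, of "\<lambda>_. 1"] coeff_hom.hom_1[OF coeff_hom_fls_const] by (simp add: \<gamma>_def)
  have Gpow: "(x ^ e, a ^ e) \<in> G" if "(x, a) \<in> G" for x a e
    by (induction e) (use that partial_homD[OF hom] in auto)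
  show ?thesis
  proof (rule that[of piv u \<gamma>])
    show "u a (piv a) = 1" if "a \<le> w" for a
      using u[OF that U(1)[OF that]] U(2)[OF that] partial_homD(2)[OF hom] partial_hom_unique[OF hom] by metis
    show "u a (piv b) = 0" if "a \<le> w" "b < a" for a b
      using u[OF that(1) U(1)[of b]] U(3)[OF that] that partial_homD(6)[OF hom] by auto
    show "value_at (\<lambda>c. \<Sum>a\<le>w. z a * u a c) (f i) = (if i = i0 then \<gamma> * z w ^ d i0 else 0)" if i: "i \<in> I" for i z
    proof (cases "i = i0")
      case True
      have "(fls_const (z w) ^ d i0 * T w w ^ d i0, z w ^ d i0 * \<gamma>) \<in> G"
        by (intro partial_homD(4)[OF hom] Gpow Gc \<gamma>)
      moreover have "(fls_const (z w) ^ d i0 * T w w ^ d i0, value_at (pu z) (f i)) \<in> G"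
        using in_G[OF i, of z] True by (simp add: power_mult_distrib)
      ultimately have "z w ^ d i0 * \<gamma> = value_at (pu z) (f i)" by (rule partial_hom_unique[OF hom])
      then show ?thesis using True by (simp add: pu_def[abs_def] mult.commute)
    next
      case False
      then show ?thesis using in_G[OF i, of z] partial_homD(6)[OF hom] by (simp add: pu_def[abs_def])
    qed
  qed (use U in auto)
qed

section \<open>Linear subspaces and their ideals\<close>

lemma ideal_poly_ring:
  fixes J :: "'k::field mpoly set"
  assumes "ideal J (poly_ring n)"
  shows "p \<in> J \<Longrightarrow> p \<in> polys n" "0 \<in> J" "p \<in> J \<Longrightarrow> q \<in> J \<Longrightarrow> p + q \<in> J"
    "p \<in> J \<Longrightarrow> q \<in> polys n \<Longrightarrow> q * p \<in> J"
  using additive_subgroup.a_subset[OF ideal.axioms(1)[OF assms]] additive_subgroup.zero_closed[OF ideal.axioms(1)[OF assms]]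
    additive_subgroup.a_closed[OF ideal.axioms(1)[OF assms], of p q] ideal.I_l_closed[OF assms, of p q]
  by auto

lemma ideal_sum:
  fixes J :: "'k::field mpoly set"
  assumes "ideal J (poly_ring n)" "\<And>i. i \<in> A \<Longrightarrow> f i \<in> J"
  shows "sum f A \<in> J"
  using assms(2) by (induction A rule: infinite_finite_induct) (auto intro: ideal_poly_ring[OF assms(1)])

lemma ideal_polyI:
  fixes J :: "'k::field mpoly set"
  assumes "J \<subseteq> polys n" "0 \<in> J" "\<And>p q. p \<in> J \<Longrightarrow> q \<in> J \<Longrightarrow> p + q \<in> J"
    "\<And>p q. p \<in> J \<Longrightarrow> q \<in> polys n \<Longrightarrow> q * p \<in> J"
  shows "ideal J (poly_ring n)"
proof (rule idealI)
  interpret cring "poly_ring n :: 'k mpoly ring" by (rule cring_poly_ring)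
  show "ring (poly_ring n :: 'k mpoly ring)" by (rule ring_axioms)
  show "subgroup J (add_monoid (poly_ring n))"
  proof (rule group.subgroupI)
    show "Group.group (add_monoid (poly_ring n :: 'k mpoly ring))" by (rule add.is_group)
    fix p assume p: "p \<in> J"
    then have pp: "p \<in> polys n" using assms(1) by blast
    have "(- 1 :: 'k mpoly) \<in> polys n" by (rule polys_uminus[OF polys_1])
    from assms(4)[OF p this] have "- p \<in> J" by simp
    moreover have "inv\<^bsub>add_monoid (poly_ring n)\<^esub> p = - p"
      using minus_equality[of "- p" p] pp polys_uminus[OF pp] by (simp add: a_inv_def)
    ultimately show "inv\<^bsub>add_monoid (poly_ring n)\<^esub> p \<in> J" by simp
  qed (use assms in auto)
  show "q \<otimes>\<^bsub>poly_ring n\<^esub> p \<in> J" "p \<otimes>\<^bsub>poly_ring n\<^esub> q \<in> J" if "p \<in> J" "q \<in> carrier (poly_ring n)" for p q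
    using assms(4)[of p q] that by (auto simp: mult.commute)
qed

lemma genideal_poly_ring:
  assumes "S \<subseteq> polys n"
  shows "ideal (Idl\<^bsub>poly_ring n\<^esub> S) (poly_ring n)" "S \<subseteq> Idl\<^bsub>poly_ring n\<^esub> S"
    "\<And>J. ideal J (poly_ring n) \<Longrightarrow> S \<subseteq> J \<Longrightarrow> Idl\<^bsub>poly_ring n\<^esub> S \<subseteq> J"
  using ring.genideal_ideal[OF cring.axioms(1)[OF cring_poly_ring], of S n]
    ring.genideal_self[OF cring.axioms(1)[OF cring_poly_ring], of S n]
    ring.genideal_minimal[OF cring.axioms(1)[OF cring_poly_ring], of _ n S] assms
  by auto

lemma genideal_insert_genideal:
  assumes "S \<subseteq> polys n" "x \<in> polys n"
  shows "Idl\<^bsub>poly_ring n\<^esub> (Idl\<^bsub>poly_ring n\<^esub> S \<union> {x}) = Idl\<^bsub>poly_ring n\<^esub> (S \<union> {x})"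
proof -
  have S: "S \<union> {x} \<subseteq> polys n" and I: "Idl\<^bsub>poly_ring n\<^esub> S \<union> {x} \<subseteq> polys n"
    using assms genideal_poly_ring(1)[OF assms(1)] ideal_poly_ring(1) by blast+
  have "Idl\<^bsub>poly_ring n\<^esub> S \<subseteq> Idl\<^bsub>poly_ring n\<^esub> (S \<union> {x})"
    using genideal_poly_ring(1,2)[OF S] by (intro genideal_poly_ring(3)[OF assms(1)]) auto
  then have "Idl\<^bsub>poly_ring n\<^esub> (Idl\<^bsub>poly_ring n\<^esub> S \<union> {x}) \<subseteq> Idl\<^bsub>poly_ring n\<^esub> (S \<union> {x})"
    using genideal_poly_ring(1,2)[OF S] by (intro genideal_poly_ring(3)[OF I]) auto
  moreover have "Idl\<^bsub>poly_ring n\<^esub> (S \<union> {x}) \<subseteq> Idl\<^bsub>poly_ring n\<^esub> (Idl\<^bsub>poly_ring n\<^esub> S \<union> {x})"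
    using genideal_poly_ring(1,2)[OF I] genideal_poly_ring(2)[OF assms(1)] by (intro genideal_poly_ring(3)[OF S]) auto
  ultimately show ?thesis by blast
qed

lemma saturation_mono: "I \<subseteq> J \<Longrightarrow> saturation n I \<subseteq> saturation n J"
  unfolding saturation_def by blast

lemma saturation_superset:
  assumes "ideal I (poly_ring n)" shows "I \<subseteq> saturation n I"
  using ideal_poly_ring(1,4)[OF assms] forms_imp_polys unfolding saturation_def by blast

lemma peval_cong_ideal:
  fixes p :: "'k::field mpoly"
  assumes J: "ideal J (poly_ring n)" and p: "p \<in> polys n"
    and ab: "\<And>i. i \<le> n \<Longrightarrow> a i \<in> polys n" "\<And>i. i \<le> n \<Longrightarrow> b i \<in> polys n" "\<And>i. i \<le> n \<Longrightarrow> a i - b i \<in> J"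
  shows "peval const_poly a p - peval const_poly b p \<in> J"
proof -
  let ?R = "\<lambda>x y. x \<in> polys n \<and> y \<in> polys n \<and> x - y \<in> J"
  have "?R (peval const_poly a p) (peval const_poly b p)"
  proof (rule peval_rel[where R = ?R, OF _ _ _ _ _ p])
    show "?R (x + y) (x' + y')" if "?R x x'" "?R y y'" for x y x' y'
      using that ideal_poly_ring(3)[OF J, of "x - x'" "y - y'"] by (simp add: add_diff_add polys_add)
    show "?R (x * y) (x' * y')" if "?R x x'" "?R y y'" for x y x' y'
    proof -
      have "x * y - x' * y' = y * (x - x') + x' * (y - y')" by (simp add: algebra_simps)
      then show ?thesis using that polys_mult ideal_poly_ring(3,4)[OF J] by auto
    qed
  qed (use ideal_poly_ring(2)[OF J] ab in \<open>auto simp: polys_0 polys_1\<close>)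
  then show ?thesis by blast
qed

text \<open>
  A basis \<open>U\<close> of \<open>'k\<^bsup>n + 1\<^esup>\<close> whose first \<open>w + 1\<close> vectors span the \<open>w\<close>-plane under consideration, with its dual
  basis \<open>E\<close>.
\<close>

locale adapted_basis =
  fixes n w :: nat and U E :: "nat \<Rightarrow> nat \<Rightarrow> 'k::field_char_0"
  assumes w: "w \<le> n"
    and dual: "\<And>a b. a \<le> n \<Longrightarrow> b \<le> n \<Longrightarrow> (\<Sum>h\<le>n. E a h * U b h) = of_bool (a = b)"
    and resolution: "\<And>c h. c \<le> n \<Longrightarrow> h \<le> n \<Longrightarrow> (\<Sum>a\<le>n. U a c * E a h) = of_bool (c = h)"
begin

definition coord :: "nat \<Rightarrow> 'k mpoly" where
  "coord a = (\<Sum>h\<le>n. const_poly (E a h) * var h)"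

definition point :: "(nat \<Rightarrow> 'k) \<Rightarrow> nat \<Rightarrow> 'k" where
  "point z c = (\<Sum>a\<le>w. z a * U a c)"

definition equations :: "'k mpoly set" where
  "equations = coord ` {w<..n}"

lemma coord_form: "coord a \<in> forms n 1"
  unfolding coord_def by (intro forms_sum forms_const_mult) simp

lemma coord_polys: "coord a \<in> polys n"
  using coord_form by (rule forms_imp_polys)

lemma peval_coord: "value_at v (coord a) = (\<Sum>h\<le>n. E a h * v h)"
  by (simp add: coord_def idh_peval)

lemma peval_coord_basis: "a \<le> n \<Longrightarrow> b \<le> n \<Longrightarrow> value_at (U b) (coord a) = of_bool (a = b)"
  by (simp add: peval_coord dual)

lemma peval_coord_point:
  assumes "a \<le> n" shows "value_at (point z) (coord a) = (if a \<le> w then z a else 0)"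
proof -
  have "value_at (point z) (coord a) = (\<Sum>b\<le>w. z b * (\<Sum>h\<le>n. E a h * U b h))"
    unfolding peval_coord point_def sum_distrib_left
    by (subst sum.swap) (simp add: mult_ac)
  also have "\<dots> = (\<Sum>b\<le>w. if b = a then z b else 0)"
    by (rule sum.cong) (use w assms in \<open>auto simp: dual\<close>)
  finally show ?thesis by simp
qed

lemma linearly_independent_coords:
  assumes "inj_on \<sigma> {..<h}" "\<sigma> ` {..<h} \<subseteq> {..n}"
  shows "linearly_independent h (\<lambda>j. coord (\<sigma> j))"
  unfolding linearly_independent_def
proof (intro allI impI)
  fix c j assume eq: "(\<Sum>i<h. const_poly (c i) * coord (\<sigma> i)) = 0" and j: "j < h"
  have "0 = value_at (U (\<sigma> j)) (\<Sum>i<h. const_poly (c i) * coord (\<sigma> i))"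
    by (simp add: eq idh_peval)
  also have "\<dots> = (\<Sum>i<h. c i * of_bool (\<sigma> i = \<sigma> j))"
    unfolding idh_peval by (rule sum.cong) (use assms j in \<open>auto simp: peval_coord_basis image_subset_iff\<close>)
  also have "\<dots> = (\<Sum>i<h. if i = j then c i else 0)"
    by (rule sum.cong) (use assms(1) j in \<open>auto simp: inj_on_def\<close>)
  finally show "c j = 0" using j by simp
qed

lemma ideal_equations: "ideal (Idl\<^bsub>poly_ring n\<^esub> equations) (poly_ring n)"
  and equations_subset: "equations \<subseteq> Idl\<^bsub>poly_ring n\<^esub> equations"
  and equations_polys: "equations \<subseteq> polys n"
proof -
  show "equations \<subseteq> polys n" using coord_polys by (auto simp: equations_def)
  from genideal_poly_ring(1,2)[OF this]
  show "ideal (Idl\<^bsub>poly_ring n\<^esub> equations) (poly_ring n)" "equations \<subseteq> Idl\<^bsub>poly_ring n\<^esub> equations" by auto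
qed

definition vanishing :: "'k mpoly set" where
  "vanishing = {p \<in> polys n. \<forall>z. value_at (point z) p = 0}"

text \<open>
  Modulo the equations of the plane, the coordinates of a point agree with those of its projection \<open>proj\<close> to the
  plane.  A polynomial that vanishes on the plane becomes zero when composed with this projection.
\<close>

lemma vanishing_subset_ideal:
  assumes p: "p \<in> vanishing"
  shows "p \<in> Idl\<^bsub>poly_ring n\<^esub> equations"
proof -
  let ?I = "Idl\<^bsub>poly_ring n\<^esub> equations"
  define proj where "proj c = (\<Sum>a\<le>w. const_poly (U a c) * coord a)" for c
  have pp: "p \<in> polys n" and p0: "\<And>z. value_at (point z) p = 0" using p by (auto simp: vanishing_def)
  have proj_polys: "proj c \<in> polys n" for c
    unfolding proj_def by (intro polys_sum polys_mult coord_polys) simp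
  have var: "var c = (\<Sum>a\<le>n. const_poly (U a c) * coord a)" if c: "c \<le> n" for c
  proof -
    interpret cp: coeff_hom "const_poly :: 'k \<Rightarrow> 'k mpoly" by (rule coeff_hom_const_poly)
    have cp_sum: "const_poly (\<Sum>a\<in>A. f a) = (\<Sum>a\<in>A. const_poly (f a))" for A :: "nat set" and f :: "nat \<Rightarrow> 'k"
      by (induction A rule: infinite_finite_induct) (auto simp: cp.hom_add)
    have "(\<Sum>a\<le>n. const_poly (U a c) * coord a) = (\<Sum>h\<le>n. const_poly (\<Sum>a\<le>n. U a c * E a h) * var h)"
      unfolding coord_def sum_distrib_left cp_sum sum_distrib_right
      by (subst sum.swap) (simp add: cp.hom_mult mult.assoc)
    also have "\<dots> = (\<Sum>h\<le>n. if h = c then var h else 0)"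
      by (rule sum.cong) (use c in \<open>auto simp: resolution\<close>)
    also have "\<dots> = var c" using c by simp
    finally show ?thesis by simp
  qed
  have "var c - proj c \<in> ?I" if c: "c \<le> n" for c
  proof -
    have split: "{..n} = {..w} \<union> {w<..n}" using w by auto
    have "(\<Sum>a\<le>n. const_poly (U a c) * coord a) = proj c + (\<Sum>a\<in>{w<..n}. const_poly (U a c) * coord a)"
      unfolding proj_def split by (rule sum.union_disjoint) auto
    then have "var c - proj c = (\<Sum>a\<in>{w<..n}. const_poly (U a c) * coord a)"
      unfolding var[OF c] by simp
    also have "\<dots> \<in> ?I"
      using equations_subset
      by (intro ideal_sum[OF ideal_equations] ideal_poly_ring(4)[OF ideal_equations]) (auto simp: equations_def)
    finally show ?thesis .
  qed
  then have "peval const_poly var p - peval const_poly proj p \<in> ?I"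
    by (intro peval_cong_ideal[OF ideal_equations pp]) (auto simp: proj_polys intro: forms_imp_polys[OF var_in_forms])
  moreover have "peval const_poly proj p = 0"
  proof (rule peval_grid_imp_0)
    show "infinite (UNIV :: 'k set)" by (rule infinite_UNIV_char_0)
    fix y :: "nat \<Rightarrow> 'k"
    have "value_at y (peval (\<lambda>c. const_poly c) proj p) = value_at (\<lambda>i. value_at y (proj i)) p"
      by (rule peval_compose[OF coeff_hom_id pp])
    also have "(\<lambda>i. value_at y (proj i)) = point (\<lambda>a. value_at y (coord a))"
      by (rule ext) (simp add: proj_def idh_peval point_def mult.commute)
    finally show "value_at y (peval const_poly proj p) = 0" by (simp add: p0)
  qed
  ultimately show ?thesis by (simp add: peval_identity)
qed

lemma ideal_vanishing: "ideal vanishing (poly_ring n)"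
  by (rule ideal_polyI) (auto simp: vanishing_def idh_peval polys_0 polys_add polys_mult)

lemma ideal_equations_eq: "Idl\<^bsub>poly_ring n\<^esub> equations = vanishing"
proof
  show "vanishing \<subseteq> Idl\<^bsub>poly_ring n\<^esub> equations" using vanishing_subset_ideal by blast
  have "equations \<subseteq> vanishing"
    by (auto simp: equations_def vanishing_def coord_polys peval_coord_point)
  then show "Idl\<^bsub>poly_ring n\<^esub> equations \<subseteq> vanishing"
    by (rule genideal_poly_ring(3)[OF equations_polys ideal_vanishing])
qed

text \<open>
  The ideal of a linear subspace is saturated: at a point of the plane with all coordinates \<open>z\<close> nonzero some variable
  is nonzero, and it is enough to know that a polynomial vanishes at these points.
\<close>

lemma subscheme_equations:
  shows "subscheme n equations = Idl\<^bsub>poly_ring n\<^esub> equations"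
proof
  show "Idl\<^bsub>poly_ring n\<^esub> equations \<subseteq> subscheme n equations"
    unfolding subscheme_def by (rule saturation_superset[OF ideal_equations])
  show "subscheme n equations \<subseteq> Idl\<^bsub>poly_ring n\<^esub> equations"
  proof
    fix p assume "p \<in> subscheme n equations"
    then obtain N where pp: "p \<in> polys n" and N: "\<And>q. q \<in> forms n N \<Longrightarrow> q * p \<in> vanishing"
      by (auto simp: subscheme_def saturation_def ideal_equations_eq)
    define P where "P = peval (\<lambda>c. const_poly c) (\<lambda>c. \<Sum>a\<le>w. const_poly (U a c) * var a) p"
    have P: "value_at z P = value_at (point z) p" for z
      unfolding P_def peval_compose[OF coeff_hom_id pp] by (simp add: idh_peval point_def[abs_def] mult.commute)
    have "P = 0"
    proof (rule peval_grid_imp_0)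
      show "infinite (UNIV - {0 :: 'k})" by (simp add: infinite_UNIV_char_0)
      fix z :: "nat \<Rightarrow> 'k" assume z: "\<And>i. z i \<in> UNIV - {0}"
      have "\<exists>c\<le>n. point z c \<noteq> 0"
      proof (rule ccontr)
        assume "\<not> ?thesis"
        then have "value_at (point z) (coord 0) = 0" by (simp add: peval_coord)
        then show False using peval_coord_point[of 0 z] z[of 0] by simp
      qed
      then obtain c where c: "c \<le> n" "point z c \<noteq> 0" by blast
      have "var c ^ e \<in> (forms n e :: 'k mpoly set)" for e
      proof (induction e)
        case 0
        then show ?case by (simp add: forms_def polys_def mdeg_def)
      next
        case (Suc e)
        then show ?case using forms_mult[OF var_in_forms[OF c(1)] Suc] by simp
      qed
      then have "value_at (point z) (var c ^ N * p) = 0" using N by (simp add: vanishing_def)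
      then show "value_at z P = 0" using c(2) by (simp add: idh_peval P)
    qed
    then have "value_at (point z) p = 0" for z using P[of z] by (simp add: idh_peval)
    then show "p \<in> Idl\<^bsub>poly_ring n\<^esub> equations" using pp by (simp add: ideal_equations_eq vanishing_def)
  qed
qed

lemma equations_image: "equations = (\<lambda>j. coord (Suc w + j)) ` {..<n - w}"
proof -
  have "{w<..n} = (\<lambda>j. Suc w + j) ` {..<n - w}"
  proof (intro equalityI subsetI)
    fix a assume "a \<in> {w<..n}"
    then show "a \<in> (\<lambda>j. Suc w + j) ` {..<n - w}" by (intro image_eqI[of _ _ "a - Suc w"]) auto
  qed auto
  then show ?thesis by (simp add: equations_def image_image)
qed

lemma is_plane_equations: "is_plane n w (subscheme n equations)"
  unfolding is_plane_def
proof (intro conjI exI)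
  show "linearly_independent (n - w) (\<lambda>j. coord (Suc w + j))"
    by (rule linearly_independent_coords) (auto simp: inj_on_def)
qed (auto simp: w equations_image intro: coord_form[unfolded One_nat_def])

lemma is_plane_hyperplane:
  assumes "0 < w"
  shows "is_plane n (w - 1) (subscheme n (equations \<union> {coord w}))"
  unfolding is_plane_def
proof (intro conjI exI)
  have "equations \<union> {coord w} = (\<lambda>j. coord (w + j)) ` {..<n - (w - 1)}"
  proof -
    have "n - (w - 1) = Suc (n - w)" using w assms by auto
    then have "{..<n - (w - 1)} = insert 0 (Suc ` {..<n - w})" by (simp add: lessThan_Suc_eq_insert_0)
    then show ?thesis by (simp add: equations_image image_image)
  qed
  then show "subscheme n (equations \<union> {coord w}) = subscheme n ((\<lambda>j. coord (w + j)) ` {..<n - (w - 1)})" by simp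
  show "linearly_independent (n - (w - 1)) (\<lambda>j. coord (w + j))"
    by (rule linearly_independent_coords) (use w assms in \<open>auto simp: inj_on_def\<close>)
qed (use w in \<open>auto intro: coord_form[unfolded One_nat_def]\<close>)

text \<open>
  If a polynomial restricts to \<open>c * x ^ t\<close> on the plane, where \<open>x = coord w\<close>, then it differs from \<open>c * x ^ t\<close> by an
  element of the ideal of the plane.
\<close>

lemma fat_plane:
  assumes "0 < w" and S: "S \<subseteq> polys n"
    and eqs: "\<And>p. p \<in> S \<Longrightarrow> \<exists>c. \<forall>z. value_at (point z) p = c * z w ^ t"
  shows "\<exists>Z. is_fat_plane n (w - 1) t Z \<and> contained_in Z (subscheme n S)"
proof (intro exI conjI)
  let ?L = "subscheme n equations" and ?x = "coord w"
  have L: "?L = Idl\<^bsub>poly_ring n\<^esub> equations" by (rule subscheme_equations)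
  have insert: "subscheme n (?L \<union> {x}) = subscheme n (equations \<union> {x})" if "x \<in> polys n" for x
    by (simp only: L) (simp only: subscheme_def genideal_insert_genideal[OF equations_polys that])
  have xt: "?x ^ t \<in> polys n" by (intro polys_power coord_polys)
  show "is_fat_plane n (w - 1) t (subscheme n (?L \<union> {?x ^ t}))"
    unfolding is_fat_plane_def
    using is_plane_equations is_plane_hyperplane[OF assms(1)] coord_form insert[OF coord_polys] assms(1)
    by (intro exI[of _ ?L] exI[of _ ?x]) auto
  let ?I = "Idl\<^bsub>poly_ring n\<^esub> (equations \<union> {?x ^ t})"
  have gens: "equations \<union> {?x ^ t} \<subseteq> polys n" using equations_polys xt by auto
  note I = genideal_poly_ring(1)[OF gens]
  have "p \<in> ?I" if p: "p \<in> S" for p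
  proof -
    from eqs[OF p] obtain c where c: "\<And>z. value_at (point z) p = c * z w ^ t" by blast
    have "p - const_poly c * ?x ^ t \<in> vanishing"
      using S p w by (auto simp: vanishing_def c polys_diff polys_mult xt coeff_hom.peval_diff[OF coeff_hom_id] idh_peval peval_coord_point)
    also have "vanishing \<subseteq> ?I"
      unfolding ideal_equations_eq[symmetric]
      using genideal_poly_ring(2)[OF gens] by (intro genideal_poly_ring(3)[OF equations_polys I]) auto
    finally have "p - const_poly c * ?x ^ t \<in> ?I" .
    moreover have "const_poly c * ?x ^ t \<in> ?I"
      using genideal_poly_ring(2)[OF gens] by (intro ideal_poly_ring(4)[OF I]) auto
    ultimately have "p - const_poly c * ?x ^ t + const_poly c * ?x ^ t \<in> ?I" by (rule ideal_poly_ring(3)[OF I])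
    then show ?thesis by simp
  qed
  then have "Idl\<^bsub>poly_ring n\<^esub> S \<subseteq> ?I" by (intro genideal_poly_ring(3)[OF S I]) blast
  then have "subscheme n S \<subseteq> subscheme n (equations \<union> {?x ^ t})"
    unfolding subscheme_def by (rule saturation_mono)
  then show "contained_in (subscheme n (?L \<union> {?x ^ t})) (subscheme n S)"
    unfolding contained_in_def insert[OF xt] .
qed

end

text \<open>
  Vectors in echelon form are completed to a basis by the unit vectors at the coordinates \<open>e j\<close> that are not pivots.
\<close>

lemma adapted_basis_of_echelon:
  fixes u :: "nat \<Rightarrow> nat \<Rightarrow> 'k::field_char_0"
  assumes piv: "\<And>a. a \<le> w \<Longrightarrow> piv a \<le> w + m" and one: "\<And>a. a \<le> w \<Longrightarrow> u a (piv a) = 1"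
    and zero: "\<And>a b. a \<le> w \<Longrightarrow> b < a \<Longrightarrow> u a (piv b) = 0"
  obtains U E where "adapted_basis (w + m) w U E" "\<forall>a\<le>w. U a = u a"
proof -
  let ?n = "w + m"
  have "inj_on piv {..w}"
  proof (rule linorder_inj_onI)
    show "piv b \<noteq> piv a" if "b < a" "b \<in> {..w}" "a \<in> {..w}" for a b
      using one[of a] zero[of a b] that by auto
  qed auto
  then have "card ({..?n} - piv ` {..w}) = m"
    using piv by (subst card_Diff_subset) (auto simp: card_image)
  then obtain e where "bij_betw e {..<m} ({..?n} - piv ` {..w})"
    using ex_bij_betw_nat_finite[of "{..?n} - piv ` {..w}"] by (auto simp: atLeast0LessThan)
  then have e: "inj_on e {..<m}" "e ` {..<m} = {..?n} - piv ` {..w}" by (auto simp: bij_betw_def)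
  define U where "U a = (if a \<le> w then u a else (\<lambda>c. of_bool (c = e (a - Suc w))))" for a
  have split: "(\<Sum>a\<le>?n. F a) = (\<Sum>a\<le>w. F a) + (\<Sum>j<m. F (Suc w + j))" for F :: "nat \<Rightarrow> 'k"
  proof -
    have "{..?n} = {..w} \<union> (\<lambda>j. Suc w + j) ` {..<m}"
    proof (intro equalityI subsetI)
      fix a assume "a \<in> {..?n}"
      then show "a \<in> {..w} \<union> (\<lambda>j. Suc w + j) ` {..<m}"
        by (cases "a \<le> w") (auto intro: image_eqI[of _ _ "a - Suc w"])
    qed auto
    then have "(\<Sum>a\<le>?n. F a) = (\<Sum>a\<le>w. F a) + sum F ((\<lambda>j. Suc w + j) ` {..<m})"
      by (simp only:) (rule sum.union_disjoint, auto)
    also have "sum F ((\<lambda>j. Suc w + j) ` {..<m}) = (\<Sum>j<m. F (Suc w + j))"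
      by (subst sum.reindex) (auto simp: inj_on_def)
    finally show ?thesis .
  qed
  have comb: "(\<Sum>a\<le>?n. c a * U a h) = (\<Sum>a\<le>w. c a * u a h) + (\<Sum>j<m. c (Suc w + j) * of_bool (h = e j))" for c h
    unfolding split by (simp add: U_def)
  have at_e: "(\<Sum>j<m. c j * of_bool (h = e j)) = c j0" if "j0 < m" "h = e j0" for c :: "nat \<Rightarrow> 'k" and h j0
  proof -
    have "(\<Sum>j<m. c j * of_bool (h = e j)) = (\<Sum>j<m. if j = j0 then c j else 0)"
      by (rule sum.cong) (use that e(1) in \<open>auto simp: inj_on_def\<close>)
    then show ?thesis using that by simp
  qed
  have at_piv: "(\<Sum>j<m. c j * of_bool (piv b = e j)) = 0" if "b \<le> w" for c :: "nat \<Rightarrow> 'k" and b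
    by (rule sum.neutral) (use e(2) that in auto)
  interpret k: residue_field "{0 :: 'k}" by (rule residue_field_0)
  have "k.independent {..?n} {..?n} U"
    unfolding k.independent_def
  proof (intro allI impI)
    fix c assume c: "\<forall>h\<in>{..?n}. (\<Sum>a\<le>?n. c a * U a h) \<in> {0}"
    have low: "b \<le> w \<Longrightarrow> c b = 0" for b
    proof (induction b rule: less_induct)
      case (less b)
      have "(\<Sum>a\<le>?n. c a * U a (piv b)) = 0" using c piv[OF less.prems] by blast
      then have "0 = (\<Sum>a\<le>w. c a * u a (piv b))" unfolding comb at_piv[OF less.prems] by simp
      also have "\<dots> = (\<Sum>a\<le>w. if a = b then c a else 0)"
      proof (rule sum.cong)
        fix a assume "a \<in> {..w}"
        then show "c a * u a (piv b) = (if a = b then c a else 0)"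
          using less.IH[of a] zero[of a b] one[of b] less.prems by (cases a b rule: linorder_cases) auto
      qed simp
      finally show ?case using less.prems by simp
    qed
    have high: "c (Suc w + j) = 0" if "j < m" for j
    proof -
      have "e j \<le> ?n" using e(2) that by blast
      then have "(\<Sum>a\<le>?n. c a * U a (e j)) = 0" using c by blast
      then show ?thesis unfolding comb at_e[OF that refl] by (simp add: low)
    qed
    show "\<forall>a\<in>{..?n}. c a \<in> {0}"
    proof
      fix a assume "a \<in> {..?n}"
      then show "c a \<in> {0}" using low[of a] high[of "a - Suc w"] by (cases "a \<le> w") auto
    qed
  qed
  from k.dual_vectors[OF _ _ this] obtain E where
    E: "\<And>a b. a \<le> ?n \<Longrightarrow> b \<le> ?n \<Longrightarrow> (\<Sum>h\<le>?n. E a h * U b h) = of_bool (a = b)" by auto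
  have spanning: "\<exists>x. \<forall>h\<le>?n. v h = (\<Sum>a\<le>?n. x a * U a h)" for v
  proof -
    from clear_pivots[of "Suc w" u piv v] one zero
    obtain x where "\<And>b. b < Suc w \<Longrightarrow> v (piv b) - (\<Sum>a<Suc w. x a * u a (piv b)) = 0" by auto
    then have x: "v (piv b) = (\<Sum>a\<le>w. x a * u a (piv b))" if "b \<le> w" for b
      using that by (simp add: lessThan_Suc_atMost less_Suc_eq_le)
    define x' where "x' a = (if a \<le> w then x a else v (e (a - Suc w)) - (\<Sum>a'\<le>w. x a' * u a' (e (a - Suc w))))" for a
    have "v h = (\<Sum>a\<le>?n. x' a * U a h)" if h: "h \<le> ?n" for h
    proof (cases "h \<in> piv ` {..w}")
      case True
      then obtain b where b: "b \<le> w" "h = piv b" by auto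
      show ?thesis unfolding comb b(2) at_piv[OF b(1)] x[OF b(1)] by (simp add: x'_def)
    next
      case False
      then have "h \<in> e ` {..<m}" using e(2) h by simp
      then obtain j where j: "j < m" "h = e j" by blast
      show ?thesis unfolding comb at_e[OF j] by (simp add: x'_def j(2))
    qed
    then show ?thesis by blast
  qed
  have "(\<Sum>a\<le>?n. U a c * E a h) = of_bool (c = h)" if "c \<le> ?n" "h \<le> ?n" for c h
  proof -
    from spanning[of "\<lambda>c. of_bool (c = h)"] obtain x where
      x: "\<And>c. c \<le> ?n \<Longrightarrow> of_bool (c = h) = (\<Sum>a\<le>?n. x a * U a c)" by blast
    have "E b h = x b" if b: "b \<le> ?n" for b
    proof -
      have "E b h = (\<Sum>c\<le>?n. if c = h then E b c else 0)" using \<open>h \<le> ?n\<close> by simp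
      also have "\<dots> = (\<Sum>c\<le>?n. E b c * (\<Sum>a\<le>?n. x a * U a c))"
        by (rule sum.cong) (auto simp flip: x)
      also have "\<dots> = (\<Sum>a\<le>?n. x a * (\<Sum>c\<le>?n. E b c * U a c))"
        unfolding sum_distrib_left by (subst sum.swap) (simp add: mult_ac)
      also have "\<dots> = (\<Sum>a\<le>?n. if a = b then x a else 0)"
        by (rule sum.cong) (use b in \<open>auto simp: E\<close>)
      finally show ?thesis using b by simp
    qed
    then have "(\<Sum>a\<le>?n. U a c * E a h) = (\<Sum>a\<le>?n. x a * U a c)"
      by (intro sum.cong) (auto simp: mult.commute)
    then show ?thesis using x[OF that(1)] by simp
  qed
  then have "adapted_basis ?n w U E" by unfold_locales (simp_all add: E)
  moreover have "\<forall>a\<le>w. U a = u a" by (simp add: U_def)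
  ultimately show ?thesis using that by blast
qed

theorem exists_fat_plane:
  fixes f :: "'i \<Rightarrow> 'k::{alg_closed_field, field_char_0} mpoly" and d :: "'i \<Rightarrow> nat"
  assumes I: "finite I" "i0 \<in> I" "\<And>i. i \<in> I \<Longrightarrow> 0 < d i" "3 \<le> d i0"
    and bound: "(\<Sum>i\<in>I. (w + d i) choose d i) \<le> (w + 1) * (m + 1)" and w_pos: "0 < w"
    and f: "\<And>i. i \<in> I \<Longrightarrow> f i \<in> forms (w + m) (d i)"
  shows "\<exists>Z. is_fat_plane (w + m) (w - 1) (d i0) Z \<and> contained_in Z (subscheme (w + m) (f ` I))"
proof (rule deformation[OF I bound f])
  fix g b assume g: "\<And>i. i \<in> I \<Longrightarrow> g i \<in> forms (w + m) (d i)" and b: "\<And>j l. b j l $ 0 = 0"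
    and eq: "\<And>i y. i \<in> I \<Longrightarrow> (1 - fps_X) * peval fps_const (graph_point w b y) (g i) + fps_X * peval fps_const (graph_point w b y) (f i)
       = (if i = i0 then fps_const (y w) ^ d i0 else 0)"
  show ?thesis
  proof (rule limit_of_deformation[where I = I and f = f and g = g and w = w and m = m and b = b and d = d and ?i0.0 = i0, OF forms_imp_polys[OF g] forms_imp_polys[OF f] b I(2) eq])
    fix u piv \<gamma> assume u: "\<And>a. a \<le> w \<Longrightarrow> piv a \<le> w + m" "\<And>a. a \<le> w \<Longrightarrow> u a (piv a) = 1"
      "\<And>a b. a \<le> w \<Longrightarrow> b < a \<Longrightarrow> u a (piv b) = 0"
      and ev: "\<And>i z. i \<in> I \<Longrightarrow> value_at (\<lambda>c. \<Sum>a\<le>w. z a * u a c) (f i) = (if i = i0 then \<gamma> * z w ^ d i0 else 0)"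
    obtain U E where basis: "adapted_basis (w + m) w U E" and U: "\<forall>a\<le>w. U a = u a"
      by (rule adapted_basis_of_echelon[where w = w and m = m and u = u and piv = piv, OF u])
    interpret adapted_basis "w + m" w U E by (rule basis)
    have pt: "point z = (\<lambda>c. \<Sum>a\<le>w. z a * u a c)" for z
      by (rule ext) (simp add: point_def U)
    show ?thesis
    proof (rule fat_plane[OF w_pos])
      show "f ` I \<subseteq> polys (w + m)" using f forms_imp_polys by blast
      show "\<exists>c. \<forall>z. value_at (point z) p = c * z w ^ d i0" if "p \<in> f ` I" for p
      proof -
        from that obtain i where "i \<in> I" "p = f i" by blast
        then show ?thesis using ev[of i] by (intro exI[of _ "if i = i0 then \<gamma> else 0"]) (simp add: pt)
      qed
    qed
  qed
qed

theorem proposition5p1: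
  fixes n r s t :: nat and d :: "nat \<Rightarrow> nat" and \<rho> :: int
    and Y :: "'k::{alg_closed_field, field_char_0} mpoly set"
  assumes "r < n" and "1 \<le> s" and "s \<le> n - r - 1"
    and "\<forall>i\<in>{1..s}. 0 < d i"
    and "t = Max (d ` {1..s})"
    and "3 \<le> t"
    and "\<exists>!i. i \<in> {1..s} \<and> d i = t"
    and "\<rho> = (int r + 2) * (int n - int r) - 1
              - (\<Sum>i\<in>{1..s}. int ((d i + r + 1) choose (r + 1)))
              + (\<Sum>i\<in>{i\<in>{1..s}. d i \<ge> t}. int ((d i - t + r + 1) choose (r + 1)))"
    and "0 \<le> \<rho>"
    and "complete_intersection n s d Y"
  shows "Hilbert_fat_planes n r t Y \<noteq> {}"
proof -
  from assms(7)[unfolded Ex1_def] obtain i0 where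
    i0: "i0 \<in> {1..s}" "d i0 = t" and unique: "\<forall>i. i \<in> {1..s} \<and> d i = t \<longrightarrow> i = i0"
    by (elim exE conjE)
  have max: "d i \<le> t" if "i \<in> {1..s}" for i using assms(5) that by simp
  have "i = i0" if "i \<in> {1..s}" "d i \<ge> t" for i
    using unique[THEN spec, of i] max[OF that(1)] that by simp
  then have top: "{i \<in> {1..s}. d i \<ge> t} = {i0}" using i0 by blast
  define w where "w = r + 1"
  define m where "m = n - w"
  have n: "n = w + m" using assms(1) by (simp add: m_def w_def)
  have "(\<Sum>i\<in>{1..s}. int ((d i + r + 1) choose (r + 1))) \<le> (int r + 2) * (int n - int r)"
    using assms(8,9) i0(2) unfolding top by simp
  also have "(\<Sum>i\<in>{1..s}. int ((d i + r + 1) choose (r + 1))) = int (\<Sum>i\<in>{1..s}. (w + d i) choose d i)"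
  proof -
    have "(d i + r + 1) choose (r + 1) = (w + d i) choose d i" for i
      by (subst binomial_symmetric) (auto simp: w_def add_ac)
    then show ?thesis by simp
  qed
  also have "(int r + 2) * (int n - int r) = int ((w + 1) * (m + 1))"
  proof -
    have "int (m + 1) = int n - int r" "int (w + 1) = int r + 2" using assms(1) by (simp_all add: w_def m_def)
    then show ?thesis by (simp only: of_nat_mult)
  qed
  finally have bound: "(\<Sum>i\<in>{1..s}. (w + d i) choose d i) \<le> (w + 1) * (m + 1)" by (simp only: of_nat_le_iff)
  obtain f where f: "\<And>i. i \<in> {1..s} \<Longrightarrow> f i \<in> forms n (d i)" and Y: "Y = subscheme n (f ` {1..s})"
    using assms(10) unfolding complete_intersection_def by blast
  have "\<exists>Z. is_fat_plane (w + m) (w - 1) (d i0) Z \<and> contained_in Z (subscheme (w + m) (f ` {1..s}))"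
    by (rule exists_fat_plane) (use assms(4,6) i0 bound f n in \<open>auto simp: w_def\<close>)
  then show ?thesis
    unfolding Hilbert_fat_planes_def Y n[symmetric] i0(2) by (auto simp: w_def)
qed

end
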